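(* Assume (A1), (A2), (A3) (see context). Let the parameters satisfy $\theta_i\in(0,2)$, $\alpha_i>0$, $\gamma_i>0$ and $0<\gamma_i\beta<1/\lambda_{\max}(L)$ for all $i=1,\dots,m$, and let the precisions satisfy $\sum_{k=0}^\infty\varepsilon_i^k<\infty$ for all $i$. Let $\{\xi^k\}_{k\ge0}$, $\{\widehat\xi^k\}_{k\ge0}$ and $\{V^k\}_{k\ge0}$ be generated by the inexact DPMM algorithm described in the context. Then: (a) for every $\xi^*=\mathrm{col}(\mathrm{x}^*,\mathrm{Y}^*,\mathrm{Z}^* )\in\Phi^{-1}(0)$ and every $k\ge0$, $$\|\xi^{k+1}-\xi^*\|_{\mathbf H}^2\le\|\xi^k-\xi^*\|_{\mathbf H}^2-\|\xi^k-\widehat\xi^k\|_{\mathbf D}^2+2\langle\widehat\xi^k-\xi^*,V^k\rangle;$$ (b) the sequence $\{\xi^k\}_{k\ge0}$ is bounded; (c) $\{\xi^k\}_{k\ge0}$ converges to some $\xi^\infty=\mathrm{col}(\mathrm{x}^\infty,\mathrm{Y}^\infty,\mathrm{Z}^\infty)\in\Phi^{-1}(0)$; in particular $\mathrm{x}^\infty$ is an optimal solution of (P), $\mathrm{Y}^\infty=\mathbf 1_m\otimes\mathrm{y}^\infty$ for some $\mathrm{y}^\infty\in\mathbb R^{p+q}$, and $\mathrm{y}^\infty$ is an optimal solution of (D).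
   Context: Problem. Let $m\ge2$, $n_1,\dots,n_m\ge1$, $p,q\ge0$ be integers, $n=\sum_i n_i$, $\mathcal V=\{1,\dots,m\}$. For $i\in\mathcal V$ let $f_i:\mathbb R^{n_i}\to\mathbb R$, $A_i\in\mathbb R^{p\times n_i}$, $b_i\in\mathbb R^p$, $g_i:\mathbb R^{n_i}\to\mathbb R^q$, $\Omega_i\subseteq\mathbb R^{n_i}$, and $G_i(\mathrm x_i)=\mathrm{col}(A_i\mathrm x_i-b_i,\,g_i(\mathrm x_i))\in\mathbb R^{p+q}$. Let $\mathcal K=\{0_p\}\times\mathbb R^q_-$ and $\mathcal K^\circ=\mathbb R^p\times\mathbb R^q_+$. Problem (P): minimize $F(\mathrm x)=\sum_i f_i(\mathrm x_i)$ over $\mathrm x=\mathrm{col}(\mathrm x_1,\dots,\mathrm x_m)\in\mathbb R^n$ subject to $\sum_iG_i(\mathrm x_i)\in\mathcal K$ and $\mathrm x_i\in\Omega_i$ for all $i$. With $\delta_S$ the indicator function of a set $S$ ($0$ on $S$, $+\infty$ off $S$), put $\ell_i(\mathrm x_i,\mathrm y)=f_i(\mathrm x_i)+\mathrm y^\top G_i(\mathrm x_i)+\delta_{\Omega_i}(\mathrm x_i)-\delta_{\mathcal K^\circ}(\mathrm y)$ for $\mathrm y\in\mathbb R^{p+q}$. Dual problem (D): maximize $\varphi(\mathrm y)=\sum_i\inf_{\mathrm x_i}\ell_i(\mathrm x_i,\mathrm y)$ over $\mathrm y\in\mathbb R^{p+q}$. Assumptions. (A1) $\mathcal G=(\mathcal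 V,\mathcal E)$ is a connected undirected graph; $L\in\mathbb R^{m\times m}$ is symmetric and compatible with $\mathcal G$ (i.e. $L_{ij}=0$ whenever $i\ne j$ and $(i,j)\notin\mathcal E$, and $\mathrm{null}(L)=\mathrm{span}\{\mathbf 1_m\}$), and $L=U^\top U$ for a full-row-rank matrix $U\in\mathbb R^{r\times m}$ with $U\mathbf 1_m=0$. (A2) each $f_i$ and each component of $g_i$ is a proper closed convex function, each $\Omega_i$ is a nonempty closed convex set, and the optimal solution set of (P) is nonempty. (A3) (Slater) there is $\bar{\mathrm x}$ with $\bar{\mathrm x}_i\in\mathrm{int}(\Omega_i)$ for all $i$, $\sum_i(A_i\bar{\mathrm x}_i-b_i)=0$ and $\sum_ig_i(\bar{\mathrm x}_i)<0$ componentwise. Operator. $\mathbf L=L\otimes I_{p+q}$, $\mathbf U=U\otimes I_{p+q}\in\mathbb R^{r(p+q)\times m(p+q)}$. For $\mathrm x\in\mathbb R^n$ and $\mathrm Y=\mathrm{col}(\mathrm y_1,\dots,\mathrm y_m)$, $\mathrm y_i\in\mathbb R^{p+q}$, let $\mathcal L(\mathrm x,\mathrm Y)=\sum_i\ell_i(\mathrm x_i,\mathrm y_i)$; $\partial_{\mathrm x}\mathcal L$ is the convex subdifferential in $\mathrm x$ and $\partial_{\mathrm Y}\mathcal L(\mathrm x,\mathrm Y):=-\partial_{\mathrm Y}[-\mathcal L(\mathrm x,\mathrm Y)]$. For $\mathrm Z\in\mathbb R^{r(p+q)}$ define the set-valued map $\Phi(\mathrm x,\mathrm Y,\mathrm Z)=\partial_{\mathrm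 x}\mathcal L(\mathrm x,\mathrm Y)\times\big(-\partial_{\mathrm Y}\mathcal L(\mathrm x,\mathrm Y)+\mathbf U^\top\mathrm Z\big)\times\{-\mathbf U\mathrm Y\}$, and $\Phi^{-1}(0)$ its zero set. Matrices. Parameters $\theta_i,\alpha_i,\gamma_i>0$ ($i\in\mathcal V$) and $\beta>0$; $\Theta=\mathrm{diag}(\theta_iI_{n_i})_i$, $\Upsilon=\mathrm{diag}(\alpha_iI_{n_i})_i$, $\Gamma=\mathrm{diag}(\gamma_iI_{p+q})_i$; $Q=\begin{pmatrix}\Upsilon^{-1}&0&0\\0&\Gamma^{-1}&-\mathbf U^\top\\0&0&\frac1\beta I\end{pmatrix}$, $M=\begin{pmatrix}\Theta&0&0\\0&I&-\Gamma\mathbf U^\top\\0&0&I\end{pmatrix}$ (identities of sizes $m(p+q)$ and $r(p+q)$ as appropriate), $\mathbf H=QM^{-1}$, $\mathbf D=Q^\top+Q-M^\top\mathbf HM$, $\|v\|_{\mathbf H}=\sqrt{\langle v,\mathbf Hv\rangle}$. Algorithm (inexact DPMM). $\mathcal P_{\mathcal K^\circ}(u_1,u_2)=(u_1,\max(u_2,0))$ for $(u_1,u_2)\in\mathbb R^p\times\mathbb R^q$. Initialize $\mathrm x_i^0\in\Omega_i$, $\mathrm y_i^0\in\mathcal K^\circ$, $\lambda_i^0=0\in\mathbb R^{p+q}$. At iteration $k$, each agent $i$ chooses $\varepsilon_i^k\ge0$, sets $\phi_i^k(\mathrm x_i,\mathrm y_i)=f_i(\mathrm x_i)+\frac1{2\gamma_i}(\|\mathcal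 P_{\mathcal K^\circ}(\mathrm y_i+\gamma_iG_i(\mathrm x_i))\|^2-\|\mathrm y_i\|^2)+\frac1{2\alpha_i}\|\mathrm x_i-\mathrm x_i^k\|^2+\delta_{\Omega_i}(\mathrm x_i)$, computes $\widehat{\mathrm x}_i^k$ and $v_i^k\in\partial_{\mathrm x_i}\phi_i^k(\widehat{\mathrm x}_i^k,\mathrm y_i^k-\gamma_i\lambda_i^k)$ with $\|v_i^k\|\le\varepsilon_i^k$, and sets $\widehat{\mathrm y}_i^k=\mathcal P_{\mathcal K^\circ}(\mathrm y_i^k-\gamma_i\lambda_i^k+\gamma_iG_i(\widehat{\mathrm x}_i^k))$, $\mathrm x_i^{k+1}=(1-\theta_i)\mathrm x_i^k+\theta_i\widehat{\mathrm x}_i^k$, $\lambda_i^{k+1}=\lambda_i^k+\beta\sum_jL_{ij}\widehat{\mathrm y}_j^k$, $\mathrm y_i^{k+1}=\widehat{\mathrm y}_i^k+\gamma_i(\lambda_i^k-\lambda_i^{k+1})$. Stack $\mathrm x^k,\mathrm Y^k,\Lambda^k=\mathrm{col}(\lambda_i^k)_i,\widehat{\mathrm x}^k,\widehat{\mathrm Y}^k$. Let $\mathrm Z^k\in\mathbb R^{r(p+q)}$ be the (unique) vector with $\Lambda^k=\mathbf U^\top\mathrm Z^k$ and $\widehat{\mathrm Z}^k$ the one with $\Lambda^{k+1}=\mathbf U^\top\widehat{\mathrm Z}^k$; $\xi^k=\mathrm{col}(\mathrm x^k,\mathrm Y^k,\mathrm Z^k)$, $\widehat\xi^k=\mathrm{col}(\widehat{\mathrm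 x}^k,\widehat{\mathrm Y}^k,\widehat{\mathrm Z}^k)$, $V^k=\mathrm{col}(v_1^k,\dots,v_m^k,0,0)$. *)

theory Defs
  imports "Jordan_Normal_Form.Char_Poly" "HOL-Library.Extended_Real" "HOL-Library.Liminf_Limsup"
begin

(* Vectors of R^d are represented as JNF vectors in carrier_vec d.
   Agents are indexed by 0..m-1 (instead of 1..m). *)

definition vnorm :: "real vec \<Rightarrow> real" where
  "vnorm v = sqrt (v \<bullet> v)"

definition vconv :: "(nat \<Rightarrow> real vec) \<Rightarrow> real vec \<Rightarrow> bool" where
  "vconv s l \<longleftrightarrow> (\<forall>k. dim_vec (s k) = dim_vec l) \<and> (\<lambda>k. vnorm (s k - l)) \<longlonglongrightarrow> 0"

definition vclosed :: "nat \<Rightarrow> real vec set \<Rightarrow> bool" where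
  "vclosed d S \<longleftrightarrow> S \<subseteq> carrier_vec d \<and> (\<forall>s l. (\<forall>k. s k \<in> S) \<longrightarrow> vconv s l \<longrightarrow> l \<in> S)"

definition vinterior :: "nat \<Rightarrow> real vec set \<Rightarrow> real vec set" where
  "vinterior d S = {x \<in> carrier_vec d. \<exists>e>0. \<forall>y\<in>carrier_vec d. vnorm (y - x) < e \<longrightarrow> y \<in> S}"

definition vconvex_set :: "nat \<Rightarrow> real vec set \<Rightarrow> bool" where
  "vconvex_set d S \<longleftrightarrow> S \<subseteq> carrier_vec d \<and>
     (\<forall>x\<in>S. \<forall>y\<in>S. \<forall>t::real. 0 \<le> t \<and> t \<le> 1 \<longrightarrow> t \<cdot>\<^sub>v x + (1 - t) \<cdot>\<^sub>v y \<in> S)"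

definition vconvex_fun :: "nat \<Rightarrow> (real vec \<Rightarrow> real) \<Rightarrow> bool" where
  "vconvex_fun d f \<longleftrightarrow> (\<forall>x\<in>carrier_vec d. \<forall>y\<in>carrier_vec d. \<forall>t::real. 0 \<le> t \<and> t \<le> 1 \<longrightarrow>
       f (t \<cdot>\<^sub>v x + (1 - t) \<cdot>\<^sub>v y) \<le> t * f x + (1 - t) * f y)"

definition vlsc :: "nat \<Rightarrow> (real vec \<Rightarrow> real) \<Rightarrow> bool" where
  "vlsc d f \<longleftrightarrow> (\<forall>s x. (\<forall>k. s k \<in> carrier_vec d) \<longrightarrow> x \<in> carrier_vec d \<longrightarrow> vconv s x \<longrightarrow>
       ereal (f x) \<le> liminf (\<lambda>k. ereal (f (s k))))"

(* a real-valued function R^d -> R is automatically proper *)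
definition proper_closed_convex :: "nat \<Rightarrow> (real vec \<Rightarrow> real) \<Rightarrow> bool" where
  "proper_closed_convex d f \<longleftrightarrow> vconvex_fun d f \<and> vlsc d f"

definition esubdiff :: "nat \<Rightarrow> (real vec \<Rightarrow> ereal) \<Rightarrow> real vec \<Rightarrow> real vec set" where
  "esubdiff d F x = {v \<in> carrier_vec d. x \<in> carrier_vec d \<and> F x \<noteq> \<infinity> \<and> F x \<noteq> -\<infinity> \<and>
       (\<forall>y\<in>carrier_vec d. F x + ereal (v \<bullet> (y - x)) \<le> F y)}"

definition ind :: "'a set \<Rightarrow> 'a \<Rightarrow> ereal" where
  "ind S x = (if x \<in> S then 0 else \<infinity>)"

definition offs :: "(nat \<Rightarrow> nat) \<Rightarrow> nat \<Rightarrow> nat" where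
  "offs ds i = (\<Sum>j<i. ds j)"

definition blk :: "(nat \<Rightarrow> nat) \<Rightarrow> nat \<Rightarrow> real vec \<Rightarrow> real vec" where
  "blk ds i x = vec (ds i) (\<lambda>j. x $ (offs ds i + j))"

fun stack :: "nat \<Rightarrow> (nat \<Rightarrow> real vec) \<Rightarrow> real vec" where
  "stack 0 vs = vec 0 (\<lambda>_. 0)"
| "stack (Suc k) vs = stack k vs @\<^sub>v vs k"

definition vsum :: "nat \<Rightarrow> nat \<Rightarrow> (nat \<Rightarrow> real vec) \<Rightarrow> real vec" where
  "vsum d m F = vec d (\<lambda>c. \<Sum>i<m. F i $ c)"

definition Kcone :: "nat \<Rightarrow> nat \<Rightarrow> real vec set" where
  "Kcone p q = {y \<in> carrier_vec (p + q). (\<forall>c<p. y $ c = 0) \<and> (\<forall>c. p \<le> c \<and> c < p + q \<longrightarrow> y $ c \<le> 0)}"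

definition Kpol :: "nat \<Rightarrow> nat \<Rightarrow> real vec set" where
  "Kpol p q = {y \<in> carrier_vec (p + q). \<forall>c. p \<le> c \<and> c < p + q \<longrightarrow> 0 \<le> y $ c}"

definition projK :: "nat \<Rightarrow> nat \<Rightarrow> real vec \<Rightarrow> real vec" where
  "projK p q u = vec (p + q) (\<lambda>c. if c < p then u $ c else max (u $ c) 0)"

definition Gfun :: "(nat \<Rightarrow> real mat) \<Rightarrow> (nat \<Rightarrow> real vec) \<Rightarrow> (nat \<Rightarrow> real vec \<Rightarrow> real vec)
    \<Rightarrow> nat \<Rightarrow> real vec \<Rightarrow> real vec" where
  "Gfun A b g i x = (A i *\<^sub>v x - b i) @\<^sub>v g i x"

definition ell :: "(nat \<Rightarrow> real vec \<Rightarrow> real) \<Rightarrow> (nat \<Rightarrow> real mat) \<Rightarrow> (nat \<Rightarrow> real vec)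
    \<Rightarrow> (nat \<Rightarrow> real vec \<Rightarrow> real vec) \<Rightarrow> (nat \<Rightarrow> real vec set) \<Rightarrow> nat \<Rightarrow> nat
    \<Rightarrow> nat \<Rightarrow> real vec \<Rightarrow> real vec \<Rightarrow> ereal" where
  "ell f A b g \<Omega> p q i x y =
     ereal (f i x + y \<bullet> Gfun A b g i x) + ind (\<Omega> i) x - ind (Kpol p q) y"

definition Lag :: "nat \<Rightarrow> (nat \<Rightarrow> nat) \<Rightarrow> (nat \<Rightarrow> real vec \<Rightarrow> real) \<Rightarrow> (nat \<Rightarrow> real mat)
    \<Rightarrow> (nat \<Rightarrow> real vec) \<Rightarrow> (nat \<Rightarrow> real vec \<Rightarrow> real vec) \<Rightarrow> (nat \<Rightarrow> real vec set)
    \<Rightarrow> nat \<Rightarrow> nat \<Rightarrow> real vec \<Rightarrow> real vec \<Rightarrow> ereal" where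
  "Lag m nd f A b g \<Omega> p q x Y =
     (\<Sum>i<m. ell f A b g \<Omega> p q i (blk nd i x) (blk (\<lambda>_. p + q) i Y))"

definition feasibleP :: "nat \<Rightarrow> (nat \<Rightarrow> nat) \<Rightarrow> (nat \<Rightarrow> real mat)
    \<Rightarrow> (nat \<Rightarrow> real vec) \<Rightarrow> (nat \<Rightarrow> real vec \<Rightarrow> real vec) \<Rightarrow> (nat \<Rightarrow> real vec set)
    \<Rightarrow> nat \<Rightarrow> nat \<Rightarrow> real vec \<Rightarrow> bool" where
  "feasibleP m nd A b g \<Omega> p q x \<longleftrightarrow>
     x \<in> carrier_vec (\<Sum>i<m. nd i) \<and>
     vsum (p + q) m (\<lambda>i. Gfun A b g i (blk nd i x)) \<in> Kcone p q \<and>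
     (\<forall>i<m. blk nd i x \<in> \<Omega> i)"

definition optimalP :: "nat \<Rightarrow> (nat \<Rightarrow> nat) \<Rightarrow> (nat \<Rightarrow> real vec \<Rightarrow> real) \<Rightarrow> (nat \<Rightarrow> real mat)
    \<Rightarrow> (nat \<Rightarrow> real vec) \<Rightarrow> (nat \<Rightarrow> real vec \<Rightarrow> real vec) \<Rightarrow> (nat \<Rightarrow> real vec set)
    \<Rightarrow> nat \<Rightarrow> nat \<Rightarrow> real vec \<Rightarrow> bool" where
  "optimalP m nd f A b g \<Omega> p q x \<longleftrightarrow>
     feasibleP m nd A b g \<Omega> p q x \<and>
     (\<forall>x'. feasibleP m nd A b g \<Omega> p q x' \<longrightarrow>
        (\<Sum>i<m. f i (blk nd i x)) \<le> (\<Sum>i<m. f i (blk nd i x')))"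

definition dualfun :: "nat \<Rightarrow> (nat \<Rightarrow> nat) \<Rightarrow> (nat \<Rightarrow> real vec \<Rightarrow> real) \<Rightarrow> (nat \<Rightarrow> real mat)
    \<Rightarrow> (nat \<Rightarrow> real vec) \<Rightarrow> (nat \<Rightarrow> real vec \<Rightarrow> real vec) \<Rightarrow> (nat \<Rightarrow> real vec set)
    \<Rightarrow> nat \<Rightarrow> nat \<Rightarrow> real vec \<Rightarrow> ereal" where
  "dualfun m nd f A b g \<Omega> p q y =
     (\<Sum>i<m. INF xi\<in>carrier_vec (nd i). ell f A b g \<Omega> p q i xi y)"

definition optimalD :: "nat \<Rightarrow> (nat \<Rightarrow> nat) \<Rightarrow> (nat \<Rightarrow> real vec \<Rightarrow> real) \<Rightarrow> (nat \<Rightarrow> real mat)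
    \<Rightarrow> (nat \<Rightarrow> real vec) \<Rightarrow> (nat \<Rightarrow> real vec \<Rightarrow> real vec) \<Rightarrow> (nat \<Rightarrow> real vec set)
    \<Rightarrow> nat \<Rightarrow> nat \<Rightarrow> real vec \<Rightarrow> bool" where
  "optimalD m nd f A b g \<Omega> p q y \<longleftrightarrow>
     y \<in> carrier_vec (p + q) \<and>
     (\<forall>y'\<in>carrier_vec (p + q). dualfun m nd f A b g \<Omega> p q y' \<le> dualfun m nd f A b g \<Omega> p q y)"

definition kron :: "real mat \<Rightarrow> real mat \<Rightarrow> real mat" where
  "kron A B = mat (dim_row A * dim_row B) (dim_col A * dim_col B)
     (\<lambda>(i, j). A $$ (i div dim_row B, j div dim_col B) * B $$ (i mod dim_row B, j mod dim_col B))"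

definition minv :: "real mat \<Rightarrow> real mat" where
  "minv M = (THE B. B \<in> carrier_mat (dim_row M) (dim_row M) \<and> inverts_mat M B \<and> inverts_mat B M)"

definition bdiag :: "nat \<Rightarrow> (nat \<Rightarrow> nat) \<Rightarrow> (nat \<Rightarrow> real) \<Rightarrow> real mat" where
  "bdiag m ds cs = diag_block_mat (map (\<lambda>i. cs i \<cdot>\<^sub>m 1\<^sub>m (ds i)) [0..<m])"

definition lam_max :: "real mat \<Rightarrow> real" where
  "lam_max L = Max {c. eigenvalue L c}"

definition full_row_rank :: "real mat \<Rightarrow> bool" where
  "full_row_rank U \<longleftrightarrow> (\<forall>c\<in>carrier_vec (dim_row U).
      (\<forall>j<dim_col U. (\<Sum>i<dim_row U. c $ i * U $$ (i, j)) = 0) \<longrightarrow> c = 0\<^sub>v (dim_row U))"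

definition qn :: "real mat \<Rightarrow> real vec \<Rightarrow> real" where
  "qn H v = v \<bullet> (H *\<^sub>v v)"

definition PhiZero :: "nat \<Rightarrow> (nat \<Rightarrow> nat) \<Rightarrow> (nat \<Rightarrow> real vec \<Rightarrow> real) \<Rightarrow> (nat \<Rightarrow> real mat)
    \<Rightarrow> (nat \<Rightarrow> real vec) \<Rightarrow> (nat \<Rightarrow> real vec \<Rightarrow> real vec) \<Rightarrow> (nat \<Rightarrow> real vec set)
    \<Rightarrow> nat \<Rightarrow> nat \<Rightarrow> real mat \<Rightarrow> real vec set" where
  "PhiZero m nd f A b g \<Omega> p q U =
    (let N = (\<Sum>i<m. nd i); MY = m * (p + q); RZ = dim_row U * (p + q);
         bU = kron U (1\<^sub>m (p + q)) in
     {\<xi> \<in> carrier_vec (N + MY + RZ).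
       let x = vec_first \<xi> N; Y = vec_first (vec_last \<xi> (MY + RZ)) MY; Z = vec_last \<xi> RZ in
       0\<^sub>v N \<in> esubdiff N (\<lambda>x'. Lag m nd f A b g \<Omega> p q x' Y) x \<and>
       0\<^sub>v MY \<in> (\<lambda>s. s + bU\<^sup>T *\<^sub>v Z) `
                 ((\<lambda>s. - s) ` ((\<lambda>s. - s) ` esubdiff MY (\<lambda>Y'. - Lag m nd f A b g \<Omega> p q x Y') Y)) \<and>
       0\<^sub>v RZ = - (bU *\<^sub>v Y)})"

end

theory Submission
  imports Defs
begin

text \<open>Write \<open>\<xi>\<^sup>k\<^sup>+\<^sup>1 = \<xi>\<^sup>k - M d\<close> with \<open>d = \<xi>\<^sup>k - \<xi>h\<^sup>k\<close>. Since \<open>H M = Q\<close> and \<open>H\<close> turns out to be the diagonal matrix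
  \<open>diag(1/(\<alpha>\<theta>), 1/\<gamma>, 1/\<beta>)\<close>, expanding \<open>\<parallel>\<xi>\<^sup>k\<^sup>+\<^sup>1 - \<xi>\<^sup>*\<parallel>\<^sub>H\<close> reduces (a) to \<open>\<langle>\<xi>h\<^sup>k - \<xi>\<^sup>*, Q d + V\<^sup>k\<rangle> \<ge> 0\<close>, which is monotonicity of
  \<open>\<Phi>\<close> because the inexact prox step says \<open>Q d + V\<^sup>k \<in> \<Phi>(\<xi>h\<^sup>k)\<close>. The matrix
  \<open>D = diag((2 - \<theta>)/\<alpha>, 1/\<gamma>, I/\<beta> - U \<Gamma> U\<^sup>T)\<close> is positive definite by the bound on \<open>\<gamma> \<beta>\<close>. Bounding \<open>xh\<^sup>k - x\<^sup>*\<close> by the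
  distances of \<open>x\<^sup>k\<close> and \<open>x\<^sup>k\<^sup>+\<^sup>1\<close> to \<open>x\<^sup>*\<close> turns (a) into \<open>a\<^sub>k\<^sub>+\<^sub>1 \<le> a\<^sub>k + C \<epsilon>\<^sub>k\<close> for \<open>a\<^sub>k = \<parallel>\<xi>\<^sup>k - \<xi>\<^sup>*\<parallel>\<^sub>H\<close>, so \<open>a\<^sub>k\<close> converges and
  \<open>d\<close> tends to 0; every cluster point is then a zero of \<open>\<Phi>\<close>, and applying the same argument to such a cluster point gives
  convergence. A zero exists because Slater's condition yields a Lagrange multiplier \<open>y\<close> of (P), and the consensus multiplier
  can be chosen with \<open>\<lambda>\<^sub>i = G\<^sub>i(x\<^sub>i) - (1/m) \<Sum>\<^sub>j G\<^sub>j(x\<^sub>j)\<close>, which lies in the range of \<open>U\<^sup>T \<otimes> I\<close>.\<close>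

section \<open>Vectors, convergence and lower semicontinuity\<close>

text \<open>Apart from the affine constraints, the data are only assumed lower semicontinuous, so
  limits are taken in inequalities, and subdifferentials are replaced by the variational
  inequalities that they stand for; no sum or chain rule is invoked. The delicate limit is
  complementarity at a cluster point, where \<open>y . G\<close> is only known to be semicontinuous:
  testing the prox inequality at the cluster point itself supplies the missing reverse estimate. The
  recursion for \<open>a_k\<close> has no squares because \<open>a_{k+1}^2 - a_k^2\<close> is
  divided by \<open>a_{k+1} + a_k\<close>, the very factor that bounds the error term; this is why
  xh is estimated through two consecutive iterates. Slater's condition imposes no rank on the
  matrices \<open>A_i\<close>, so a normalised limit of multipliers might live on the equality
  constraints alone; penalty multipliers exclude this, since their equality part is a multiple of
  the constraint value. Finally, Z is observed only through \<open>U^T Z\<close>; full row rank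
  makes it a function of the lambda iterates.\<close>

lemma scalar_prod_lessThan: "x \<bullet> y = (\<Sum>c<dim_vec y. x $ c * y $ c)"
  by (simp add: scalar_prod_def atLeast0LessThan)

lemma sp_add_left: "dim_vec y = dim_vec z \<Longrightarrow> (x + y) \<bullet> z = x \<bullet> z + y \<bullet> (z :: real vec)"
  by (simp add: scalar_prod_lessThan algebra_simps sum.distrib)

lemma sp_add_right: "dim_vec y = dim_vec z \<Longrightarrow> x \<bullet> (y + z) = x \<bullet> y + x \<bullet> (z :: real vec)"
  by (simp add: scalar_prod_lessThan algebra_simps sum.distrib)

lemma sp_minus_left: "dim_vec y = dim_vec z \<Longrightarrow> (x - y) \<bullet> z = x \<bullet> z - y \<bullet> (z :: real vec)"
  by (simp add: scalar_prod_lessThan algebra_simps sum_subtractf)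

lemma sp_minus_right: "dim_vec y = dim_vec z \<Longrightarrow> x \<bullet> (y - z) = x \<bullet> y - x \<bullet> (z :: real vec)"
  by (simp add: scalar_prod_lessThan algebra_simps sum_subtractf)

lemma sp_smult_left: "dim_vec y = dim_vec z \<Longrightarrow> (a \<cdot>\<^sub>v y) \<bullet> z = a * (y \<bullet> (z :: real vec))"
  by (simp add: scalar_prod_lessThan algebra_simps sum_distrib_left)

lemma sp_smult_right: "x \<bullet> (a \<cdot>\<^sub>v z) = a * (x \<bullet> (z :: real vec))"
  by (simp add: scalar_prod_lessThan algebra_simps sum_distrib_left)

lemma sp_comm: "dim_vec x = dim_vec y \<Longrightarrow> x \<bullet> y = y \<bullet> (x :: real vec)"
  by (simp add: scalar_prod_lessThan mult.commute)

lemmas sp_simps = sp_add_left sp_add_right sp_minus_left sp_minus_right sp_smult_left sp_smult_right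

lemma vec_eq_if_minus_zero:
  assumes "x \<in> carrier_vec n" "y \<in> carrier_vec n" "x - y = 0\<^sub>v n"
  shows "x = (y :: real vec)"
proof (rule eq_vecI)
  fix i assume "i < dim_vec y"
  then show "x $ i = y $ i" using assms index_minus_vec(1)[of i y x] by simp
qed (use assms in simp)

lemma sp_self_nonneg: "0 \<le> x \<bullet> (x :: real vec)"
  by (simp add: scalar_prod_lessThan sum_nonneg)

lemma sp_self_eq_0: "x \<bullet> (x :: real vec) = 0 \<Longrightarrow> x = 0\<^sub>v (dim_vec x)"
  by (auto simp: scalar_prod_lessThan sum_nonneg_eq_0_iff)

lemma vnorm_nonneg: "0 \<le> vnorm x"
  by (simp add: vnorm_def sp_self_nonneg)

lemma vnorm_sq: "(vnorm x)\<^sup>2 = x \<bullet> x"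
  by (simp add: vnorm_def sp_self_nonneg)

lemma index_le_vnorm:
  assumes "c < dim_vec x"
  shows "\<bar>x $ c\<bar> \<le> vnorm x"
proof -
  have "(x $ c)\<^sup>2 \<le> (\<Sum>c<dim_vec x. (x $ c)\<^sup>2)"
    using assms by (intro member_le_sum) auto
  then have "sqrt ((x $ c)\<^sup>2) \<le> sqrt (\<Sum>c<dim_vec x. (x $ c)\<^sup>2)" by (rule real_sqrt_le_mono)
  then show ?thesis by (simp add: vnorm_def scalar_prod_lessThan power2_eq_square)
qed

lemma cauchy_schwarz_vec:
  assumes "dim_vec x = dim_vec y"
  shows "\<bar>x \<bullet> y\<bar> \<le> vnorm x * vnorm y"
proof -
  \<comment> \<open>The vector is \<open>y . y\<close> times the component of \<open>x\<close>
    orthogonal to \<open>y\<close>, scaled so that nothing is divided.\<close>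
  have "0 \<le> ((y \<bullet> y) \<cdot>\<^sub>v x - (x \<bullet> y) \<cdot>\<^sub>v y) \<bullet> ((y \<bullet> y) \<cdot>\<^sub>v x - (x \<bullet> y) \<cdot>\<^sub>v y)"
    by (rule sp_self_nonneg)
  also have "\<dots> = (y \<bullet> y) * ((y \<bullet> y) * (x \<bullet> x) - (x \<bullet> y) * (x \<bullet> y))"
    using assms by (simp add: sp_simps sp_comm[of y x] algebra_simps)
  finally have *: "0 \<le> (y \<bullet> y) * ((y \<bullet> y) * (x \<bullet> x) - (x \<bullet> y) * (x \<bullet> y))" .
  have "(x \<bullet> y)\<^sup>2 \<le> (x \<bullet> x) * (y \<bullet> y)"
  proof (cases "y \<bullet> y = 0")
    case True
    then have "y = 0\<^sub>v (dim_vec y)" by (rule sp_self_eq_0)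
    then have "x \<bullet> y = 0" by (metis assms carrier_vec_dim_vec scalar_prod_right_zero)
    then show ?thesis using True by simp
  next
    case False
    then have "0 < y \<bullet> y" using sp_self_nonneg[of y] by linarith
    then show ?thesis using * by (simp add: zero_le_mult_iff power2_eq_square algebra_simps)
  qed
  then have "sqrt ((x \<bullet> y)\<^sup>2) \<le> sqrt ((x \<bullet> x) * (y \<bullet> y))" by (rule real_sqrt_le_mono)
  then show ?thesis by (simp add: vnorm_def real_sqrt_mult)
qed

lemma vnorm_smult: "vnorm (a \<cdot>\<^sub>v x) = \<bar>a\<bar> * vnorm x"
  by (simp add: vnorm_def sp_simps real_sqrt_mult flip: mult.assoc power2_eq_square)

lemma vnorm_triangle:
  assumes "dim_vec x = dim_vec y"
  shows "vnorm (x + y) \<le> vnorm x + vnorm y"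
proof (rule power2_le_imp_le)
  have "(vnorm (x + y))\<^sup>2 = (vnorm x)\<^sup>2 + 2 * (x \<bullet> y) + (vnorm y)\<^sup>2"
    using assms by (simp add: vnorm_sq sp_simps sp_comm[of y x])
  also have "\<dots> \<le> (vnorm x)\<^sup>2 + 2 * (vnorm x * vnorm y) + (vnorm y)\<^sup>2"
    using cauchy_schwarz_vec[OF assms] by linarith
  finally show "(vnorm (x + y))\<^sup>2 \<le> (vnorm x + vnorm y)\<^sup>2" by (simp add: power2_eq_square algebra_simps)
qed (simp add: vnorm_nonneg)

text \<open>Norm convergence is reduced to coordinates once, so that later limits of sums, inner
  products, blocks and matrix images follow from the \<open>tendsto\<close> rules for reals.\<close>

lemma vconv_iff:
  "vconv s l \<longleftrightarrow> (\<forall>k. dim_vec (s k) = dim_vec l) \<and> (\<forall>c<dim_vec l. (\<lambda>k. s k $ c) \<longlonglongrightarrow> l $ c)"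
proof (cases "\<forall>k. dim_vec (s k) = dim_vec l")
  case dims: True
  have "(\<lambda>k. s k $ c) \<longlonglongrightarrow> l $ c"
    if "(\<lambda>k. vnorm (s k - l)) \<longlonglongrightarrow> 0" "c < dim_vec l" for c
  proof -
    have "(\<lambda>k. s k $ c - l $ c) \<longlonglongrightarrow> 0"
    proof (rule tendsto_rabs_zero_cancel, rule tendsto_sandwich[OF _ _ tendsto_const that(1)])
      show "\<forall>\<^sub>F k in sequentially. \<bar>s k $ c - l $ c\<bar> \<le> vnorm (s k - l)"
        using index_le_vnorm[of c "s k - l" for k] that(2) dims by (intro always_eventually) auto
    qed simp
    then show ?thesis using LIM_zero_iff by blast
  qed
  moreover have "(\<lambda>k. vnorm (s k - l)) \<longlonglongrightarrow> 0"
    if lim: "\<forall>c<dim_vec l. (\<lambda>k. s k $ c) \<longlonglongrightarrow> l $ c"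
  proof -
    have "(\<lambda>k. \<Sum>c<dim_vec l. (s k $ c - l $ c) * (s k $ c - l $ c)) \<longlonglongrightarrow> (\<Sum>c<dim_vec l. (l $ c - l $ c) * (l $ c - l $ c))"
      using lim by (intro tendsto_intros) auto
    then have "(\<lambda>k. sqrt (\<Sum>c<dim_vec l. (s k $ c - l $ c) * (s k $ c - l $ c))) \<longlonglongrightarrow> sqrt 0"
      by (intro tendsto_real_sqrt) simp
    then show ?thesis using dims by (simp add: vnorm_def scalar_prod_lessThan)
  qed
  ultimately show ?thesis using dims unfolding vconv_def by blast
qed (auto simp: vconv_def)

lemma vconv_index: "vconv s l \<Longrightarrow> c < dim_vec l \<Longrightarrow> (\<lambda>k. s k $ c) \<longlonglongrightarrow> l $ c"
  by (simp add: vconv_iff)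

lemma vconv_subseq: "vconv s l \<Longrightarrow> strict_mono r \<Longrightarrow> vconv (s \<circ> r) l"
  unfolding vconv_iff by (auto intro: LIMSEQ_subseq_LIMSEQ[unfolded o_def])

lemma vconv_const: "vconv (\<lambda>_. x) x"
  by (simp add: vconv_iff)

lemma vconv_minus: "vconv s x \<Longrightarrow> vconv t y \<Longrightarrow> dim_vec x = dim_vec y \<Longrightarrow> vconv (\<lambda>k. s k - t k) (x - y)"
  by (auto simp: vconv_iff intro!: tendsto_diff)

lemma vconv_add: "vconv s x \<Longrightarrow> vconv t y \<Longrightarrow> dim_vec x = dim_vec y \<Longrightarrow> vconv (\<lambda>k. s k + t k) (x + y)"
  by (auto simp: vconv_iff intro!: tendsto_add)

lemma vconv_smult: "a \<longlonglongrightarrow> a' \<Longrightarrow> vconv s x \<Longrightarrow> vconv (\<lambda>k. a k \<cdot>\<^sub>v s k) (a' \<cdot>\<^sub>v x)"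
  by (auto simp: vconv_iff intro!: tendsto_mult)

lemma vconv_scalar_prod:
  assumes "vconv s x" "vconv t y" "dim_vec x = dim_vec y"
  shows "(\<lambda>k. s k \<bullet> t k) \<longlonglongrightarrow> x \<bullet> y"
  using assms by (auto simp: vconv_iff scalar_prod_lessThan intro!: tendsto_sum tendsto_mult)

lemma vconv_vnorm: "vconv s x \<Longrightarrow> (\<lambda>k. vnorm (s k)) \<longlonglongrightarrow> vnorm x"
  unfolding vnorm_def by (intro tendsto_real_sqrt vconv_scalar_prod) auto

text \<open>Bolzano-Weierstrass by induction on the index set: a further coordinate has a monotone,
  hence convergent, subsequence within the one already chosen, and refining keeps the earlier
  limits.\<close>

lemma finite_family_convergent_subsequence:
  fixes s :: "'c \<Rightarrow> nat \<Rightarrow> real"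
  assumes "finite C" "\<And>c. c \<in> C \<Longrightarrow> Bseq (s c)"
  shows "\<exists>r l. strict_mono r \<and> (\<forall>c\<in>C. (\<lambda>k. s c (r k)) \<longlonglongrightarrow> l c)"
  using assms
proof (induction C rule: finite_induct)
  case empty
  then show ?case by (auto intro!: exI[of _ "\<lambda>k. k"] simp: strict_mono_def)
next
  case (insert d C)
  then obtain r l where r: "strict_mono r" "\<forall>c\<in>C. (\<lambda>k. s c (r k)) \<longlonglongrightarrow> l c" by auto
  obtain r' where r': "strict_mono (r' :: nat \<Rightarrow> nat)" "monoseq (\<lambda>k. s d (r (r' k)))"
    using seq_monosub[of "\<lambda>k. s d (r k)"] by auto
  have "Bseq (\<lambda>k. s d (r (r' k)))"
    using insert.prems[of d] unfolding Bseq_def by auto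
  then obtain l' where l': "(\<lambda>k. s d (r (r' k))) \<longlonglongrightarrow> l'"
    using r'(2) Bseq_monoseq_convergent convergent_def by blast
  have "strict_mono (r \<circ> r')" using r(1) r'(1) by (rule strict_mono_o)
  moreover have "(\<lambda>k. s c (r (r' k))) \<longlonglongrightarrow> l c" if "c \<in> C" for c
    using LIMSEQ_subseq_LIMSEQ[OF r(2)[rule_format, OF that] r'(1)] by (simp add: o_def)
  ultimately show ?case using l' insert.hyps
    by (intro exI[of _ "r \<circ> r'"] exI[of _ "l(d := l')"]) (auto simp: o_def)
qed

lemma bounded_vec_convergent_subsequence:
  fixes s :: "nat \<Rightarrow> real vec"
  assumes "\<And>k. s k \<in> carrier_vec d" "\<And>k. vnorm (s k) \<le> B"
  shows "\<exists>r l. strict_mono r \<and> l \<in> carrier_vec d \<and> vconv (s \<circ> r) l"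
proof -
  have "Bseq (\<lambda>k. s k $ c)" if "c \<in> {..<d}" for c
  proof (rule BseqI')
    fix k
    show "norm (s k $ c) \<le> B"
      using that assms(1)[of k] order_trans[OF index_le_vnorm assms(2), of c k] by auto
  qed
  then obtain r l where "strict_mono r" "\<forall>c\<in>{..<d}. (\<lambda>k. s (r k) $ c) \<longlonglongrightarrow> l c"
    using finite_family_convergent_subsequence[of "{..<d}" "\<lambda>c k. s k $ c"] by auto
  then show ?thesis using assms(1)
    by (intro exI[of _ r] exI[of _ "vec d l"]) (auto simp: vconv_iff)
qed

text \<open>This is \<open>a <= liminf u\<close> without extended reals, so that sums and products
  of such bounds stay inside real arithmetic.\<close>

definition liminf_ge :: "(nat \<Rightarrow> real) \<Rightarrow> real \<Rightarrow> bool" where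
  "liminf_ge u a \<longleftrightarrow> (\<forall>e>0. \<forall>\<^sub>F k in sequentially. a - e < u k)"

lemma liminf_ge_tendsto: "u \<longlonglongrightarrow> a \<Longrightarrow> liminf_ge u a"
  unfolding liminf_ge_def by (auto intro: order_tendstoD)

lemma liminf_ge_add:
  assumes "liminf_ge u a" "liminf_ge v b"
  shows "liminf_ge (\<lambda>k. u k + v k) (a + b)"
  unfolding liminf_ge_def
proof (intro allI impI)
  fix e :: real assume "e > 0"
  then have "\<forall>\<^sub>F k in sequentially. a - e / 2 < u k" "\<forall>\<^sub>F k in sequentially. b - e / 2 < v k"
    using assms half_gt_zero unfolding liminf_ge_def by blast+
  then show "\<forall>\<^sub>F k in sequentially. a + b - e < u k + v k"
    by eventually_elim linarith
qed

lemma liminf_ge_sum: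
  "(\<And>j. j \<in> J \<Longrightarrow> liminf_ge (u j) (a j)) \<Longrightarrow> liminf_ge (\<lambda>k. \<Sum>j\<in>J. u j k) (\<Sum>j\<in>J. a j)"
proof (induction J rule: infinite_finite_induct)
  case (insert j J)
  then show ?case by (auto intro: liminf_ge_add)
qed (auto intro: liminf_ge_tendsto)

lemma liminf_ge_mult:
  assumes u: "liminf_ge u a" and w: "w \<longlonglongrightarrow> w'" "\<And>k. 0 \<le> w k"
  shows "liminf_ge (\<lambda>k. w k * u k) (w' * a)"
  unfolding liminf_ge_def
proof (intro allI impI)
  fix e :: real assume e: "e > 0"
  have w'0: "0 \<le> w'" using w by (intro LIMSEQ_le_const) auto
  \<comment> \<open>The denominator uses \<open>w' + 1\<close> because the limit weight
    \<open>w'\<close> may be 0; then \<open>w' * h <= e / 2\<close> in every case.\<close>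
  define h where "h = e / (2 * (w' + 1))"
  have h: "h > 0" using e w'0 by (simp add: h_def)
  have "w' * h \<le> e / 2" using w'0 e by (simp add: h_def field_simps)
  then have "w' * a - e < w' * (a - h)" using e by (simp add: algebra_simps)
  moreover have "(\<lambda>k. w k * (a - h)) \<longlonglongrightarrow> w' * (a - h)" by (intro tendsto_intros w)
  ultimately have "\<forall>\<^sub>F k in sequentially. w' * a - e < w k * (a - h)"
    by (rule order_tendstoD(1)[rotated])
  moreover have "\<forall>\<^sub>F k in sequentially. a - h < u k" using u h unfolding liminf_ge_def by blast
  ultimately show "\<forall>\<^sub>F k in sequentially. w' * a - e < w k * u k"
    by eventually_elim (meson less_imp_le less_le_trans mult_left_mono w(2))
qed

lemma liminf_ge_mono:
  assumes "liminf_ge u a" "\<And>k. u k \<le> v k"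
  shows "liminf_ge v a"
  unfolding liminf_ge_def
proof (intro allI impI)
  fix e :: real assume "e > 0"
  then have "\<forall>\<^sub>F k in sequentially. a - e < u k" using assms(1) by (simp add: liminf_ge_def)
  then show "\<forall>\<^sub>F k in sequentially. a - e < v k"
    by (rule eventually_mono) (use assms(2) less_le_trans in blast)
qed

text \<open>The form in which limits are taken below: a semicontinuous left side against a
  convergent right side.\<close>

lemma liminf_ge_le:
  assumes "liminf_ge u a" "\<And>k. u k \<le> v k" "v \<longlonglongrightarrow> b"
  shows "a \<le> b"
proof (rule field_le_epsilon)
  fix e :: real assume "e > 0"
  then have "\<forall>\<^sub>F k in sequentially. a - e / 2 < u k" "\<forall>\<^sub>F k in sequentially. v k < b + e / 2"
    using assms(1) order_tendstoD(2)[OF assms(3)] half_gt_zero unfolding liminf_ge_def by fastforce+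
  then have "\<forall>\<^sub>F k in sequentially. a < b + e"
    by eventually_elim (use assms(2) in \<open>smt (verit) field_sum_of_halves\<close>)
  then show "a \<le> b + e" by simp
qed

lemma tendsto_if_liminf_ge:
  assumes "liminf_ge u a" "liminf_ge (\<lambda>k. - u k) (- a)"
  shows "u \<longlonglongrightarrow> a"
proof (rule order_tendstoI)
  fix x assume "x < a"
  then show "\<forall>\<^sub>F k in sequentially. x < u k" using assms(1)[unfolded liminf_ge_def, rule_format, of "a - x"] by simp
next
  fix x assume "a < x"
  then have "\<forall>\<^sub>F k in sequentially. - a - (x - a) < - u k"
    using assms(2)[unfolded liminf_ge_def, rule_format, of "x - a"] by simp
  then show "\<forall>\<^sub>F k in sequentially. u k < x" by eventually_elim simp
qed

lemma vlscD:
  assumes "vlsc d f" "\<And>k. s k \<in> carrier_vec d" "x \<in> carrier_vec d" "vconv s x"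
  shows "liminf_ge (\<lambda>k. f (s k)) (f x)"
  unfolding liminf_ge_def
proof (intro allI impI)
  fix e :: real assume "e > 0"
  have "ereal (f x) \<le> liminf (\<lambda>k. ereal (f (s k)))" using assms unfolding vlsc_def by blast
  moreover have "ereal (f x - e) < ereal (f x)" using \<open>e > 0\<close> by simp
  ultimately have "ereal (f x - e) < liminf (\<lambda>k. ereal (f (s k)))" by (rule less_le_trans[rotated])
  then show "\<forall>\<^sub>F k in sequentially. f x - e < f (s k)" by (auto dest: less_LiminfD)
qed

lemma vlscI:
  assumes "\<And>s x. (\<And>k. s k \<in> carrier_vec d) \<Longrightarrow> x \<in> carrier_vec d \<Longrightarrow> vconv s x \<Longrightarrow> liminf_ge (\<lambda>k. f (s k)) (f x)"
  shows "vlsc d f"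
  unfolding vlsc_def
proof (intro allI impI)
  fix s x assume "\<forall>k. s k \<in> carrier_vec d" "x \<in> carrier_vec d" "vconv s x"
  then have lim: "liminf_ge (\<lambda>k. f (s k)) (f x)" using assms by blast
  show "ereal (f x) \<le> liminf (\<lambda>k. ereal (f (s k)))"
  proof (subst le_Liminf_iff, intro allI impI)
    fix y assume "y < ereal (f x)"
    then show "\<forall>\<^sub>F k in sequentially. y < ereal (f (s k))"
    proof (cases y)
      case (real r)
      with \<open>y < ereal (f x)\<close> show ?thesis
        using lim[unfolded liminf_ge_def, rule_format, of "f x - r"] by simp
    qed auto
  qed
qed

text \<open>A cluster point of a minimising sequence is a minimiser, by semicontinuity. Only
  sequences inside \<open>B\<close> are tested, so the behaviour of the function off the constraint
  set is irrelevant.\<close>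

lemma lsc_attains_min:
  assumes B: "x0 \<in> B" "vclosed d B" "\<And>x. x \<in> B \<Longrightarrow> vnorm x \<le> R"
    and lsc: "\<And>s x. (\<And>k. s k \<in> B) \<Longrightarrow> x \<in> B \<Longrightarrow> vconv s x \<Longrightarrow> liminf_ge (\<lambda>k. \<psi> (s k)) (\<psi> x)"
  shows "\<exists>x\<in>B. \<forall>y\<in>B. \<psi> x \<le> \<psi> y"
proof -
  have compact: "\<exists>r x. strict_mono r \<and> x \<in> B \<and> vconv (s \<circ> r) x" if "\<And>k. s k \<in> B" for s :: "nat \<Rightarrow> real vec"
  proof -
    have "s k \<in> carrier_vec d" "vnorm (s k) \<le> R" for k
      using that[of k] B unfolding vclosed_def by auto
    then obtain r l where "strict_mono r" "vconv (s \<circ> r) l"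
      using bounded_vec_convergent_subsequence[of s d R] by blast
    moreover have "l \<in> B" using B(2) that \<open>vconv (s \<circ> r) l\<close> unfolding vclosed_def by (metis comp_apply)
    ultimately show ?thesis by blast
  qed
  \<comment> \<open>If values fell below every \<open>-n\<close>, a cluster point of such points
    would have a finite value that eventually bounds them from below, up to 1.\<close>
  have "bdd_below (\<psi> ` B)"
  proof (rule ccontr)
    assume "\<not> bdd_below (\<psi> ` B)"
    then have "\<exists>x\<in>B. \<psi> x < - real n" for n
      by (meson bdd_below.I2 not_less)
    then obtain s where s: "\<And>n. s n \<in> B" "\<And>n. \<psi> (s n) < - real n" by metis
    obtain r x where r: "strict_mono r" "x \<in> B" "vconv (s \<circ> r) x" using compact[where s = s] s(1) by metis
    have "\<forall>\<^sub>F k in sequentially. \<psi> x - 1 < \<psi> (s (r k))"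
      using lsc[of "s \<circ> r" x] r s(1) unfolding liminf_ge_def by auto
    moreover have "\<forall>\<^sub>F k in sequentially. 1 - \<psi> x < real k"
      using filterlim_real_sequentially by (simp add: filterlim_at_top_dense)
    ultimately have "\<forall>\<^sub>F k in sequentially. False"
    proof eventually_elim
      case (elim k)
      have "real k \<le> real (r k)" using seq_suble[OF r(1)] by simp
      then show False using elim s(2)[of "r k"] by linarith
    qed
    then show False by simp
  qed
  define I where "I = Inf (\<psi> ` B)"
  have I: "I \<le> \<psi> y" if "y \<in> B" for y
    unfolding I_def using that \<open>bdd_below (\<psi> ` B)\<close> by (simp add: cINF_lower)
  have "\<exists>x\<in>B. \<psi> x < I + 1 / real (Suc n)" for n
    using cInf_lessD[of "\<psi> ` B" "I + 1 / real (Suc n)"] B(1) by (auto simp: I_def)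
  then obtain s where s: "\<And>n. s n \<in> B" "\<And>n. \<psi> (s n) < I + 1 / real (Suc n)" by metis
  obtain r x where r: "strict_mono r" "x \<in> B" "vconv (s \<circ> r) x" using compact[where s = s] s(1) by metis
  have "\<psi> x \<le> I + 0"
  proof (rule liminf_ge_le)
    show "liminf_ge (\<lambda>k. \<psi> (s (r k))) (\<psi> x)" using lsc[of "s \<circ> r" x] r s(1) by auto
    show "\<psi> (s (r k)) \<le> I + 1 / real (Suc (r k))" for k using s(2)[of "r k"] by linarith
    show "(\<lambda>k. I + 1 / real (Suc (r k))) \<longlonglongrightarrow> I + 0"
      using LIMSEQ_subseq_LIMSEQ[OF LIMSEQ_inverse_real_of_nat r(1)]
      by (intro tendsto_add tendsto_const) (simp add: o_def inverse_eq_divide)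
  qed
  then show ?thesis using r(2) I by (metis add.right_neutral order_trans)
qed

text \<open>Divide by \<open>t\<close> and let it tend to 0 through \<open>1 / (n + 1)\<close>. This
  stands in for differentiation in the first-order conditions of the prox step and of the Rayleigh
  quotient.\<close>

lemma linear_le_if_quadratic:
  fixes a b c :: real
  assumes "\<And>t. 0 < t \<Longrightarrow> t \<le> 1 \<Longrightarrow> t * a \<le> t * b + t\<^sup>2 * c"
  shows "a \<le> b"
proof (rule LIMSEQ_le)
  have *: "a \<le> b + inverse (real (Suc n)) * c" for n
  proof -
    define t where "t = inverse (real (Suc n))"
    have t: "0 < t" "t \<le> 1" by (auto simp: t_def field_simps)
    then have "t * a \<le> t * (b + t * c)" using assms[OF t] by (simp add: power2_eq_square algebra_simps)
    then show ?thesis using t by (simp add: t_def)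
  qed
  then show "\<exists>N. \<forall>n\<ge>N. a \<le> b + inverse (real (Suc n)) * c" by blast
  have "(\<lambda>n. b + inverse (real (Suc n)) * c) \<longlonglongrightarrow> b + 0 * c"
    by (intro tendsto_intros LIMSEQ_inverse_real_of_nat)
  then show "(\<lambda>n. b + inverse (real (Suc n)) * c) \<longlonglongrightarrow> b" by simp
qed auto

section \<open>Lagrange multipliers under Slater's condition\<close>

lemma dim_projK [simp]: "dim_vec (projK p q u) = p + q"
  by (simp add: projK_def)

lemma projK_in_Kpol: "projK p q u \<in> Kpol p q"
  by (auto simp: projK_def Kpol_def)

lemma dim_Kpol: "y \<in> Kpol p q \<Longrightarrow> dim_vec y = p + q"
  by (auto simp: Kpol_def)

lemma Kpol_limit:
  assumes "\<And>k. w k \<in> Kpol p q" "vconv w y"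
  shows "y \<in> Kpol p q"
proof -
  have dy: "dim_vec y = p + q" using assms dim_Kpol unfolding vconv_iff by metis
  have "0 \<le> y $ c" if "p \<le> c" "c < p + q" for c
  proof (rule LIMSEQ_le_const[OF vconv_index[OF assms(2)]])
    show "c < dim_vec y" using that dy by simp
    show "\<exists>N. \<forall>n\<ge>N. 0 \<le> w n $ c" using assms(1) that by (auto simp: Kpol_def)
  qed
  then show ?thesis using carrier_vecI[OF dy] by (auto simp: Kpol_def)
qed

text \<open>The obtuse-angle property of the projection holds coordinate by coordinate: where the
  residual is nonzero, it is negative and the projection is 0.\<close>

lemma projK_variational:
  assumes "u \<in> carrier_vec (p + q)" "y \<in> Kpol p q"
  shows "(u - projK p q u) \<bullet> (y - projK p q u) \<le> 0"
  using assms unfolding scalar_prod_lessThan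
  by (intro sum_nonpos) (auto simp: projK_def Kpol_def max_def mult_nonpos_nonneg)

lemma Kpol_Kcone_nonpos: "y \<in> Kpol p q \<Longrightarrow> u \<in> Kcone p q \<Longrightarrow> y \<bullet> u \<le> 0"
  unfolding scalar_prod_lessThan
proof (intro sum_nonpos)
  fix c assume "y \<in> Kpol p q" "u \<in> Kcone p q" "c \<in> {..<dim_vec u}"
  then show "y $ c * u $ c \<le> 0"
    by (cases "c < p") (auto simp: Kpol_def Kcone_def not_less mult_nonneg_nonpos)
qed

text \<open>Affineness of the first \<open>p\<close> components is expressed by convexity of \<open>G\<close> and \<open>-G\<close>,
  continuity likewise by semicontinuity of both.\<close>

definition K_convex :: "nat \<Rightarrow> nat \<Rightarrow> nat \<Rightarrow> (real vec \<Rightarrow> real vec) \<Rightarrow> bool" where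
  "K_convex p q d G \<longleftrightarrow> (\<forall>x\<in>carrier_vec d. G x \<in> carrier_vec (p + q)) \<and>
     (\<forall>c<p + q. proper_closed_convex d (\<lambda>x. G x $ c)) \<and>
     (\<forall>c<p. proper_closed_convex d (\<lambda>x. - (G x $ c)))"

lemma K_convex_dim: "K_convex p q d G \<Longrightarrow> x \<in> carrier_vec d \<Longrightarrow> dim_vec (G x) = p + q"
  by (auto simp: K_convex_def)

lemma vconvex_funD:
  "vconvex_fun d f \<Longrightarrow> x \<in> carrier_vec d \<Longrightarrow> y \<in> carrier_vec d \<Longrightarrow> 0 \<le> t \<Longrightarrow> t \<le> 1 \<Longrightarrow>
    f (t \<cdot>\<^sub>v x + (1 - t) \<cdot>\<^sub>v y) \<le> t * f x + (1 - t) * f y"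
  by (simp add: vconvex_fun_def)

lemma K_convex_index_le:
  assumes "K_convex p q d G" "c < p + q" "x \<in> carrier_vec d" "x' \<in> carrier_vec d" "0 \<le> t" "t \<le> 1"
  shows "G (t \<cdot>\<^sub>v x + (1 - t) \<cdot>\<^sub>v x') $ c \<le> t * G x $ c + (1 - t) * G x' $ c"
  using assms vconvex_funD[of d "\<lambda>x. G x $ c" x x' t]
  by (auto simp: K_convex_def proper_closed_convex_def)

lemma K_convex_index_eq:
  assumes "K_convex p q d G" "c < p" "x \<in> carrier_vec d" "x' \<in> carrier_vec d" "0 \<le> t" "t \<le> 1"
  shows "G (t \<cdot>\<^sub>v x + (1 - t) \<cdot>\<^sub>v x') $ c = t * G x $ c + (1 - t) * G x' $ c"
  using assms K_convex_index_le[of p q d G c x x' t] vconvex_funD[of d "\<lambda>x. - (G x $ c)" x x' t]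
  by (auto simp: K_convex_def proper_closed_convex_def)

text \<open>The first \<open>p\<close> coordinates of \<open>y\<close> have no sign, so there the
  equality along segments is used; in the others \<open>y >= 0\<close> preserves the
  inequality.\<close>

lemma K_convex_scalar_prod:
  assumes G: "K_convex p q d G" and y: "y \<in> Kpol p q"
    and x: "x \<in> carrier_vec d" "x' \<in> carrier_vec d" "0 \<le> t" "t \<le> 1"
  shows "y \<bullet> G (t \<cdot>\<^sub>v x + (1 - t) \<cdot>\<^sub>v x') \<le> t * (y \<bullet> G x) + (1 - t) * (y \<bullet> G x')"
proof -
  have z: "t \<cdot>\<^sub>v x + (1 - t) \<cdot>\<^sub>v x' \<in> carrier_vec d" using x by auto
  have "y $ c * G (t \<cdot>\<^sub>v x + (1 - t) \<cdot>\<^sub>v x') $ c \<le> y $ c * (t * G x $ c + (1 - t) * G x' $ c)" if "c < p + q" for c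
  proof (cases "c < p")
    case True
    then show ?thesis using K_convex_index_eq[OF G _ x] by simp
  next
    case False
    then show ?thesis using that y K_convex_index_le[OF G that x] by (auto simp: Kpol_def intro: mult_left_mono)
  qed
  then have "(\<Sum>c<p + q. y $ c * G (t \<cdot>\<^sub>v x + (1 - t) \<cdot>\<^sub>v x') $ c)
      \<le> (\<Sum>c<p + q. y $ c * (t * G x $ c + (1 - t) * G x' $ c))"
    by (intro sum_mono) auto
  also have "\<dots> = t * (y \<bullet> G x) + (1 - t) * (y \<bullet> G x')"
    using x by (simp add: scalar_prod_lessThan K_convex_dim[OF G] sum_distrib_left algebra_simps
        flip: sum.distrib sum_subtractf)
  finally show ?thesis using z by (simp add: scalar_prod_lessThan K_convex_dim[OF G])
qed

lemma K_convex_index_liminf: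
  assumes "K_convex p q d G" "c < p + q" "\<And>k. s k \<in> carrier_vec d" "x \<in> carrier_vec d" "vconv s x"
  shows "liminf_ge (\<lambda>k. G (s k) $ c) (G x $ c)"
  using assms vlscD[of d "\<lambda>x. G x $ c" s x] by (auto simp: K_convex_def proper_closed_convex_def)

lemma K_convex_index_tendsto:
  assumes "K_convex p q d G" "c < p" "\<And>k. s k \<in> carrier_vec d" "x \<in> carrier_vec d" "vconv s x"
  shows "(\<lambda>k. G (s k) $ c) \<longlonglongrightarrow> G x $ c"
  using assms vlscD[of d "\<lambda>x. - G x $ c" s x]
  by (intro tendsto_if_liminf_ge K_convex_index_liminf[of p q d]) (auto simp: K_convex_def proper_closed_convex_def)

text \<open>The same split as for convexity: continuity where the weight has no sign, semicontinuity
  where it is nonnegative. Multiplier and point may vary together, as they do along the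
  iterates.\<close>

lemma K_convex_scalar_prod_liminf:
  assumes G: "K_convex p q d G" and y: "\<And>k. w k \<in> Kpol p q" "vconv w y"
    and x: "\<And>k. s k \<in> carrier_vec d" "x \<in> carrier_vec d" "vconv s x"
  shows "liminf_ge (\<lambda>k. w k \<bullet> G (s k)) (y \<bullet> G x)"
proof -
  have dy: "dim_vec y = p + q" using y dim_Kpol unfolding vconv_iff by metis
  have "liminf_ge (\<lambda>k. w k $ c * G (s k) $ c) (y $ c * G x $ c)" if c: "c < p + q" for c
  proof (cases "c < p")
    case True
    then show ?thesis using c dy
      by (intro liminf_ge_tendsto tendsto_mult vconv_index[OF y(2)] K_convex_index_tendsto[OF G _ x]) auto
  next
    case False
    then show ?thesis using c y(1) dy
      by (intro liminf_ge_mult K_convex_index_liminf[OF G c x] vconv_index[OF y(2)]) (auto simp: Kpol_def)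
  qed
  then have "liminf_ge (\<lambda>k. \<Sum>c<p + q. w k $ c * G (s k) $ c) (\<Sum>c<p + q. y $ c * G x $ c)"
    by (intro liminf_ge_sum) auto
  then show ?thesis using x by (simp add: scalar_prod_lessThan K_convex_dim[OF G])
qed

text \<open>The squared projection has gradient \<open>\<P>\<close> and is nondecreasing in the inequality components,
  so along a segment it is bounded above by its first-order expansion composed with the chord of \<open>G\<close>.\<close>

lemma prox_step_stationary:
  assumes \<Omega>: "vconvex_set d \<Omega>" and f: "vconvex_fun d f" and G: "K_convex p q d G"
    and dims: "x0 \<in> carrier_vec d" "y \<in> carrier_vec (p + q)" "v \<in> carrier_vec d"
    and pos: "0 < \<gamma>" "0 < \<alpha>" and xh: "xh \<in> \<Omega>"
    and sub: "\<And>x. x \<in> \<Omega> \<Longrightarrow>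
      f xh + 1 / (2 * \<gamma>) * (projK p q (y + \<gamma> \<cdot>\<^sub>v G xh) \<bullet> projK p q (y + \<gamma> \<cdot>\<^sub>v G xh) - y \<bullet> y)
        + 1 / (2 * \<alpha>) * ((xh - x0) \<bullet> (xh - x0)) + v \<bullet> (x - xh)
      \<le> f x + 1 / (2 * \<gamma>) * (projK p q (y + \<gamma> \<cdot>\<^sub>v G x) \<bullet> projK p q (y + \<gamma> \<cdot>\<^sub>v G x) - y \<bullet> y)
        + 1 / (2 * \<alpha>) * ((x - x0) \<bullet> (x - x0))"
    and x: "x \<in> \<Omega>"
  defines "yh \<equiv> projK p q (y + \<gamma> \<cdot>\<^sub>v G xh)"
  shows "f xh + yh \<bullet> G xh + (v + (1 / \<alpha>) \<cdot>\<^sub>v (x0 - xh)) \<bullet> (x - xh) \<le> f x + yh \<bullet> G x"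
proof -
  have c: "xh \<in> carrier_vec d" "x \<in> carrier_vec d" using \<Omega> xh x by (auto simp: vconvex_set_def)
  define \<Delta> where "\<Delta> = G x - G xh"
  define C where "C = \<gamma> / 2 * (\<Delta> \<bullet> \<Delta>) + 1 / (2 * \<alpha>) * ((x - xh) \<bullet> (x - xh))"
  \<comment> \<open>Compare \<open>xh\<close> with the point at fraction \<open>t\<close> of the way
    to \<open>x\<close>; all second-order terms are collected in \<open>C\<close> and disappear when
    \<open>t\<close> tends to 0.\<close>
  have "t * (v \<bullet> (x - xh))
      \<le> t * (f x - f xh + yh \<bullet> \<Delta> + 1 / \<alpha> * ((xh - x0) \<bullet> (x - xh))) + t\<^sup>2 * C" if t: "0 < t" "t \<le> 1" for t
  proof -
    define z where "z = t \<cdot>\<^sub>v x + (1 - t) \<cdot>\<^sub>v xh"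
    have z: "z \<in> \<Omega>" "z \<in> carrier_vec d" using \<Omega> xh x t by (auto simp: vconvex_set_def z_def)
    have zx: "z - xh = t \<cdot>\<^sub>v (x - xh)" using c by (auto simp: z_def algebra_simps)
    have zx0: "z - x0 = (xh - x0) + t \<cdot>\<^sub>v (x - xh)" using c dims by (auto simp: z_def algebra_simps)
    have fz: "f z \<le> f xh + t * (f x - f xh)"
      using vconvex_funD[OF f c(2,1), of t] t by (simp add: z_def algebra_simps)
    have nz: "(z - x0) \<bullet> (z - x0) = (xh - x0) \<bullet> (xh - x0) + 2 * t * ((xh - x0) \<bullet> (x - xh)) + t\<^sup>2 * ((x - xh) \<bullet> (x - xh))"
      unfolding zx0 using c dims
      by (simp add: sp_simps sp_comm[of x0 xh] sp_comm[of x xh] sp_comm[of x x0] power2_eq_square algebra_simps)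
    \<comment> \<open>Coordinate form of the quadratic upper bound: \<open>2 * yh\<close> is the
      gradient of the squared projection at \<open>y + \<gamma> G(xh)\<close>.\<close>
    have comp: "(projK p q (y + \<gamma> \<cdot>\<^sub>v G z) $ j)\<^sup>2
        \<le> (yh $ j)\<^sup>2 + 2 * t * \<gamma> * (yh $ j * \<Delta> $ j) + t\<^sup>2 * \<gamma>\<^sup>2 * (\<Delta> $ j)\<^sup>2" if j: "j < p + q" for j
    proof -
      define u where "u = y $ j + \<gamma> * G xh $ j"
      define w where "w = y $ j + \<gamma> * G z $ j"
      have dG: "dim_vec (G xh) = p + q" "dim_vec (G x) = p + q" "dim_vec (G z) = p + q"
        using c z(2) K_convex_dim[OF G] by auto
      have \<Delta>j: "\<Delta> $ j = G x $ j - G xh $ j" using j dG by (simp add: \<Delta>_def)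
      show ?thesis
      proof (cases "j < p")
        case True
        have "w = u + t * \<gamma> * \<Delta> $ j"
          using K_convex_index_eq[OF G True c(2,1), of t] t unfolding w_def u_def z_def \<Delta>j
          by (simp add: right_diff_distrib distrib_left left_diff_distrib)
        moreover have "yh $ j = u" "projK p q (y + \<gamma> \<cdot>\<^sub>v G z) $ j = w"
          using True j dG dims by (auto simp: yh_def projK_def u_def w_def)
        ultimately show ?thesis by (simp add: power2_eq_square algebra_simps)
      next
        case False
        have "G z $ j \<le> t * G x $ j + (1 - t) * G xh $ j"
          using K_convex_index_le[OF G j c(2,1), of t] t by (simp add: z_def)
        then have "\<gamma> * G z $ j \<le> \<gamma> * (t * G x $ j + (1 - t) * G xh $ j)" using pos by (intro mult_left_mono) auto
        then have "w \<le> u + t * \<gamma> * \<Delta> $ j"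
          by (simp add: w_def u_def \<Delta>j algebra_simps)
        \<comment> \<open>Truncation makes squaring monotone, since \<open>w\<close> itself may be
          negative.\<close>
        then have "(max w 0)\<^sup>2 \<le> (max (u + t * \<gamma> * \<Delta> $ j) 0)\<^sup>2"
          by (intro power_mono) auto
        \<comment> \<open>If the left maximum is positive, replacing \<open>u\<close> by
          \<open>max u 0\<close> only increases a positive number; otherwise the left side is
          0.\<close>
        also have "\<dots> \<le> (max u 0 + t * \<gamma> * \<Delta> $ j)\<^sup>2"
          by (auto simp: max_def not_le intro!: power_mono)
        finally have "(max w 0)\<^sup>2 \<le> (max u 0 + t * \<gamma> * \<Delta> $ j)\<^sup>2" .
        moreover have "yh $ j = max u 0" "projK p q (y + \<gamma> \<cdot>\<^sub>v G z) $ j = max w 0"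
          using False j dG dims by (auto simp: yh_def projK_def u_def w_def)
        ultimately show ?thesis by (simp add: power2_eq_square algebra_simps)
      qed
    qed
    have d\<Delta>: "dim_vec \<Delta> = p + q" "dim_vec yh = p + q"
      using c K_convex_dim[OF G] by (auto simp: \<Delta>_def yh_def)
    have "projK p q (y + \<gamma> \<cdot>\<^sub>v G z) \<bullet> projK p q (y + \<gamma> \<cdot>\<^sub>v G z) = (\<Sum>j<p + q. (projK p q (y + \<gamma> \<cdot>\<^sub>v G z) $ j)\<^sup>2)"
      by (simp add: scalar_prod_lessThan power2_eq_square)
    also have "\<dots> \<le> (\<Sum>j<p + q. (yh $ j)\<^sup>2 + 2 * t * \<gamma> * (yh $ j * \<Delta> $ j) + t\<^sup>2 * \<gamma>\<^sup>2 * (\<Delta> $ j)\<^sup>2)"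
      using comp by (intro sum_mono) auto
    also have "\<dots> = yh \<bullet> yh + 2 * t * \<gamma> * (yh \<bullet> \<Delta>) + t\<^sup>2 * \<gamma>\<^sup>2 * (\<Delta> \<bullet> \<Delta>)"
      using d\<Delta> by (simp add: scalar_prod_lessThan sum.distrib sum_distrib_left power2_eq_square)
    finally have Pz: "1 / (2 * \<gamma>) * (projK p q (y + \<gamma> \<cdot>\<^sub>v G z) \<bullet> projK p q (y + \<gamma> \<cdot>\<^sub>v G z) - y \<bullet> y)
        \<le> 1 / (2 * \<gamma>) * ((yh \<bullet> yh + 2 * t * \<gamma> * (yh \<bullet> \<Delta>) + t\<^sup>2 * \<gamma>\<^sup>2 * (\<Delta> \<bullet> \<Delta>)) - y \<bullet> y)"
      using pos by (intro mult_left_mono) auto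
    also have "\<dots> = 1 / (2 * \<gamma>) * (yh \<bullet> yh - y \<bullet> y) + t * (yh \<bullet> \<Delta>) + t\<^sup>2 * (\<gamma> / 2 * (\<Delta> \<bullet> \<Delta>))"
      using pos by (simp add: field_simps power2_eq_square)
    finally have Pz: "1 / (2 * \<gamma>) * (projK p q (y + \<gamma> \<cdot>\<^sub>v G z) \<bullet> projK p q (y + \<gamma> \<cdot>\<^sub>v G z) - y \<bullet> y)
        \<le> 1 / (2 * \<gamma>) * (yh \<bullet> yh - y \<bullet> y) + t * (yh \<bullet> \<Delta>) + t\<^sup>2 * (\<gamma> / 2 * (\<Delta> \<bullet> \<Delta>))" .
    have nz': "1 / (2 * \<alpha>) * ((z - x0) \<bullet> (z - x0)) = 1 / (2 * \<alpha>) * ((xh - x0) \<bullet> (xh - x0))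
        + t * (1 / \<alpha> * ((xh - x0) \<bullet> (x - xh))) + t\<^sup>2 * (1 / (2 * \<alpha>) * ((x - xh) \<bullet> (x - xh)))"
      unfolding nz using pos by (simp add: field_simps)
    have "v \<bullet> (z - xh) = t * (v \<bullet> (x - xh))" unfolding zx by (simp add: sp_simps)
    then show ?thesis using sub[OF z(1)] fz Pz nz' unfolding C_def yh_def[symmetric]
      by (simp add: algebra_simps)
  qed
  then have "v \<bullet> (x - xh) \<le> f x - f xh + yh \<bullet> \<Delta> + 1 / \<alpha> * ((xh - x0) \<bullet> (x - xh))"
    by (rule linear_le_if_quadratic)
  moreover have "yh \<bullet> \<Delta> = yh \<bullet> G x - yh \<bullet> G xh"
    using c by (simp add: \<Delta>_def sp_simps K_convex_dim[OF G])
  moreover have "(v + (1 / \<alpha>) \<cdot>\<^sub>v (x0 - xh)) \<bullet> (x - xh) = v \<bullet> (x - xh) - 1 / \<alpha> * ((xh - x0) \<bullet> (x - xh))"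
    using c dims by (simp add: sp_simps algebra_simps)
  ultimately show ?thesis by linarith
qed

text \<open>Unit vectors suffice as tests: every coordinate direction lies in \<open>Kpol\<close>,
  and for the first \<open>p\<close> coordinates so does its negative, which forces
  equality.\<close>

lemma Kcone_if_polar:
  assumes u: "u \<in> carrier_vec (p + q)" and neg: "\<And>w. w \<in> Kpol p q \<Longrightarrow> w \<bullet> u \<le> 0"
  shows "u \<in> Kcone p q"
proof -
  have e: "(a \<cdot>\<^sub>v unit_vec (p + q) c) \<bullet> u = a * u $ c" if "c < p + q" for a c
    using that u by (simp add: sp_simps)
  have "u $ c \<le> 0" if "c < p + q" for c
    using neg[of "1 \<cdot>\<^sub>v unit_vec (p + q) c"] e[OF that, of 1] that by (auto simp: Kpol_def unit_vec_def)
  moreover have "0 \<le> u $ c" if "c < p" for c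
    using neg[of "(- 1) \<cdot>\<^sub>v unit_vec (p + q) c"] e[of c "-1"] that by (auto simp: Kpol_def)
  ultimately show ?thesis using u by (auto simp: Kcone_def intro: antisym)
qed

text \<open>For fixed \<open>u\<close> the left side is concave in \<open>w\<close>, with its
  maximum over the cone at \<open>projK p q u\<close>. The penalty is thus a supremum of functions
  affine in \<open>u\<close>, which yields both its semicontinuity and the estimate of the
  constraint violation.\<close>

lemma projK_sq_ge:
  assumes "w \<in> Kpol p q" "u \<in> carrier_vec (p + q)"
  shows "2 * (w \<bullet> u) - w \<bullet> w \<le> projK p q u \<bullet> projK p q u"
proof -
  have "2 * (w $ c * u $ c) - w $ c * w $ c \<le> projK p q u $ c * projK p q u $ c" if c: "c < p + q" for c
  proof (cases "c < p")
    case True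
    then show ?thesis using c sum_squares_ge_zero[of "w $ c - u $ c" 0] by (simp add: projK_def algebra_simps)
  next
    case False
    then have "0 \<le> w $ c" using assms c by (auto simp: Kpol_def)
    then have "w $ c * u $ c \<le> w $ c * max (u $ c) 0" by (intro mult_left_mono) auto
    then show ?thesis using False c sum_squares_ge_zero[of "w $ c - max (u $ c) 0" 0] by (simp add: projK_def algebra_simps)
  qed
  then have "(\<Sum>c<p + q. 2 * (w $ c * u $ c) - w $ c * w $ c) \<le> (\<Sum>c<p + q. projK p q u $ c * projK p q u $ c)"
    by (intro sum_mono) auto
  then show ?thesis using assms by (simp add: scalar_prod_lessThan dim_Kpol sum_subtractf sum_distrib_left)
qed

lemma projK_sp_self:
  assumes "u \<in> carrier_vec (p + q)"
  shows "projK p q u \<bullet> u = projK p q u \<bullet> projK p q u"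
  using assms by (auto simp: scalar_prod_lessThan projK_def max_def intro!: sum.cong)

text \<open>Intersecting with a ball gives the penalised problems minimisers without any coercivity
  of the objective.\<close>

lemma vconvex_set_unit_ball:
  assumes "vconvex_set d \<Omega>" "x0 \<in> \<Omega>"
  shows "vconvex_set d {x \<in> \<Omega>. vnorm (x - x0) \<le> 1}"
  unfolding vconvex_set_def
proof (intro conjI ballI allI impI)
  show "{x \<in> \<Omega>. vnorm (x - x0) \<le> 1} \<subseteq> carrier_vec d" using assms by (auto simp: vconvex_set_def)
  fix x y and t :: real
  assume xy: "x \<in> {x \<in> \<Omega>. vnorm (x - x0) \<le> 1}" "y \<in> {x \<in> \<Omega>. vnorm (x - x0) \<le> 1}" and t: "0 \<le> t \<and> t \<le> 1"
  have c: "x \<in> carrier_vec d" "y \<in> carrier_vec d" "x0 \<in> carrier_vec d"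
    using xy assms by (auto simp: vconvex_set_def)
  have "t \<cdot>\<^sub>v x + (1 - t) \<cdot>\<^sub>v y - x0 = t \<cdot>\<^sub>v (x - x0) + (1 - t) \<cdot>\<^sub>v (y - x0)"
    using c by (auto simp: algebra_simps)
  then have "vnorm (t \<cdot>\<^sub>v x + (1 - t) \<cdot>\<^sub>v y - x0) \<le> t * vnorm (x - x0) + (1 - t) * vnorm (y - x0)"
    using vnorm_triangle[of "t \<cdot>\<^sub>v (x - x0)" "(1 - t) \<cdot>\<^sub>v (y - x0)"] c t by (simp add: vnorm_smult)
  also have "\<dots> \<le> t * 1 + (1 - t) * 1" using xy t by (intro add_mono mult_left_mono) auto
  finally show "t \<cdot>\<^sub>v x + (1 - t) \<cdot>\<^sub>v y \<in> {x \<in> \<Omega>. vnorm (x - x0) \<le> 1}"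
    using assms xy t by (auto simp: vconvex_set_def)
qed

lemma vclosed_unit_ball:
  assumes "vclosed d \<Omega>" "x0 \<in> \<Omega>"
  shows "vclosed d {x \<in> \<Omega>. vnorm (x - x0) \<le> 1}"
  unfolding vclosed_def
proof (intro conjI allI impI)
  show "{x \<in> \<Omega>. vnorm (x - x0) \<le> 1} \<subseteq> carrier_vec d" using assms by (auto simp: vclosed_def)
  fix s l assume s: "\<forall>k. s k \<in> {x \<in> \<Omega>. vnorm (x - x0) \<le> 1}" "vconv s l"
  then have l: "l \<in> \<Omega>" using assms by (auto simp: vclosed_def)
  have "(\<lambda>k. vnorm (s k - x0)) \<longlonglongrightarrow> vnorm (l - x0)"
    using s l assms carrier_vecD[of _ d] by (intro vconv_vnorm vconv_minus vconv_const) (auto simp: vclosed_def subset_iff)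
  then have "vnorm (l - x0) \<le> 1" using s by (intro LIMSEQ_le_const2) auto
  then show "l \<in> {x \<in> \<Omega>. vnorm (x - x0) \<le> 1}" using l by simp
qed

text \<open>McShane's penalty argument: the minimisers of the penalised problem near the solution carry
  approximate multipliers \<open>n \<P>(G x\<^sub>n)\<close>; after normalisation these have a Fritz John limit,
  whose objective weight \<open>\<tau>\<close> cannot vanish by Slater's condition. In the degenerate case \<open>\<tau> = 0\<close> the limit
  multiplier annihilates the range of the affine constraints, which contains the approximate multipliers.\<close>

lemma slater_multiplier:
  assumes \<Omega>: "vclosed d \<Omega>" "vconvex_set d \<Omega>" and F: "proper_closed_convex d F" and G: "K_convex p q d G"
    and xs: "xs \<in> \<Omega>" "G xs \<in> Kcone p q" and opt: "\<And>x. x \<in> \<Omega> \<Longrightarrow> G x \<in> Kcone p q \<Longrightarrow> F xs \<le> F x"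
    and xb: "xb \<in> vinterior d \<Omega>" "\<And>c. c < p \<Longrightarrow> G xb $ c = 0" "\<And>c. p \<le> c \<Longrightarrow> c < p + q \<Longrightarrow> G xb $ c < 0"
  shows "\<exists>y\<in>Kpol p q. \<forall>x\<in>\<Omega>. F xs \<le> F x + y \<bullet> G x"
proof -
  define B where "B = {x \<in> \<Omega>. vnorm (x - xs) \<le> 1}"
  have \<Omega>c: "x \<in> carrier_vec d" if "x \<in> \<Omega>" for x using that \<Omega> by (auto simp: vclosed_def)
  have Bc: "x \<in> carrier_vec d" "x \<in> \<Omega>" if "x \<in> B" for x using that \<Omega>c by (auto simp: B_def)
  have dG: "dim_vec (G x) = p + q" if "x \<in> carrier_vec d" for x using K_convex_dim[OF G that] .
  have Gc: "G x \<in> carrier_vec (p + q)" if "x \<in> carrier_vec d" for x using G that by (simp add: K_convex_def)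
  have Bcl: "vclosed d B" and Bcv: "vconvex_set d B"
    unfolding B_def using vclosed_unit_ball vconvex_set_unit_ball \<Omega> xs by auto
  have "xs - xs = 0\<^sub>v d" using \<Omega>c xs by auto
  then have "vnorm (xs - xs) = 0" by (simp add: vnorm_def)
  then have xsB: "xs \<in> B" using xs by (simp add: B_def)
  have xsc: "xs \<in> carrier_vec d" using xs \<Omega>c by auto
  have Bbd: "vnorm x \<le> 1 + vnorm xs" if "x \<in> B" for x
  proof -
    have "x = (x - xs) + xs" using Bc[OF that] xsc by auto
    then have "vnorm x \<le> vnorm (x - xs) + vnorm xs" using vnorm_triangle[of "x - xs" xs] xsc by (metis index_minus_vec(2))
    then show ?thesis using that by (simp add: B_def)
  qed
  have Fl: "liminf_ge (\<lambda>k. F (s k)) (F x)" if "\<And>k. s k \<in> carrier_vec d" "x \<in> carrier_vec d" "vconv s x" for s x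
    using F that by (intro vlscD) (auto simp: proper_closed_convex_def)
  have dl: "(\<lambda>k. (s k - xs) \<bullet> (s k - xs)) \<longlonglongrightarrow> (x - xs) \<bullet> (x - xs)" if "x \<in> carrier_vec d" "vconv s x" for s x
    using that xsc by (intro vconv_scalar_prod vconv_minus vconv_const) auto
  \<comment> \<open>\<open>\<Psi> n\<close> is the prox objective of
    \<open>prox_step_stationary\<close> with \<open>y = 0\<close>, \<open>\<gamma> = n\<close>,
    \<open>\<alpha> = 1\<close> and centre \<open>xs\<close>, written to match it literally. For
    \<open>n > 0\<close> its middle term is \<open>n / 2\<close> times the squared violation, and
    \<open>W n x\<close> is the multiplier \<open>n P(G x)\<close>.\<close>
  define W where "W n x = projK p q (0\<^sub>v (p + q) + n \<cdot>\<^sub>v G x)" for n :: real and x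
  define \<Psi> where "\<Psi> n x = F x + 1 / (2 * n) * (W n x \<bullet> W n x - 0\<^sub>v (p + q) \<bullet> 0\<^sub>v (p + q))
      + 1 / (2 * 1) * ((x - xs) \<bullet> (x - xs))" for n x
  have Wp: "W n x \<in> Kpol p q" for n x by (simp add: W_def projK_in_Kpol)
  have WG: "n * (W n x \<bullet> G x) = W n x \<bullet> W n x" if "x \<in> carrier_vec d" for n x
    using projK_sp_self[of "n \<cdot>\<^sub>v G x" p q] Gc[OF that] by (simp add: W_def sp_smult_right)
  have W_ge: "2 * n * (w \<bullet> G x) - w \<bullet> w \<le> W n x \<bullet> W n x" if "x \<in> carrier_vec d" "w \<in> Kpol p q" for n x w
    using projK_sq_ge[OF that(2), of "n \<cdot>\<^sub>v G x"] Gc[OF that(1)] by (simp add: W_def sp_smult_right)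
  have "\<exists>x\<in>B. \<forall>z\<in>B. \<Psi> n x \<le> \<Psi> n z" if n: "n > 0" for n
  proof (rule lsc_attains_min[OF xsB Bcl Bbd])
    fix s x assume s: "\<And>k. s k \<in> B" "x \<in> B" "vconv s x"
    note c = Bc(1)[OF s(1)] Bc(1)[OF s(2)] s(3)
    \<comment> \<open>The minorant of \<open>projK_sq_ge\<close> is frozen at the multiplier
      \<open>W n x\<close> of the limit point, where it is exact.\<close>
    have "liminf_ge (\<lambda>k. 2 * n * (W n x \<bullet> G (s k)) + - (W n x \<bullet> W n x)) (2 * n * (W n x \<bullet> G x) + - (W n x \<bullet> W n x))"
      using n by (intro liminf_ge_add liminf_ge_mult K_convex_scalar_prod_liminf[OF G _ _ c] Wp vconv_const
          liminf_ge_tendsto tendsto_const) auto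
    then have "liminf_ge (\<lambda>k. 2 * n * (W n x \<bullet> G (s k)) - W n x \<bullet> W n x) (W n x \<bullet> W n x)"
      by (simp add: WG[OF c(2), of n] mult.assoc)
    then have "liminf_ge (\<lambda>k. W n (s k) \<bullet> W n (s k)) (W n x \<bullet> W n x)"
      by (rule liminf_ge_mono) (use W_ge[OF c(1) Wp] in auto)
    then have "liminf_ge (\<lambda>k. F (s k) + 1 / (2 * n) * (W n (s k) \<bullet> W n (s k)) + 1 / 2 * ((s k - xs) \<bullet> (s k - xs)))
        (F x + 1 / (2 * n) * (W n x \<bullet> W n x) + 1 / 2 * ((x - xs) \<bullet> (x - xs)))"
      using n by (intro liminf_ge_add liminf_ge_mult Fl[OF c] liminf_ge_tendsto[OF dl] c tendsto_const) auto
    then show "liminf_ge (\<lambda>k. \<Psi> n (s k)) (\<Psi> n x)" by (simp add: \<Psi>_def)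
  qed
  then have "\<forall>k. \<exists>x\<in>B. \<forall>z\<in>B. \<Psi> (real (Suc k)) x \<le> \<Psi> (real (Suc k)) z" by simp
  then obtain X where X: "\<And>k. X k \<in> B" "\<And>k z. z \<in> B \<Longrightarrow> \<Psi> (real (Suc k)) (X k) \<le> \<Psi> (real (Suc k)) z" by metis
  have Xc: "X k \<in> carrier_vec d" for k using Bc X by blast
  define Y where "Y k = W (real (Suc k)) (X k)" for k
  have Yp: "Y k \<in> Kpol p q" for k by (simp add: Y_def Wp)
  have "W n xs \<bullet> W n xs = 0" if "n > 0" for n
  proof -
    have "W n xs $ c = 0" if c: "c < p + q" for c
    proof (cases "c < p")
      case True
      then show ?thesis using xs(2) c dG[OF xsc] by (auto simp: W_def projK_def Kcone_def)
    next
      case False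
      then have "G xs $ c \<le> 0" using xs(2) c by (simp add: Kcone_def)
      then have "n * G xs $ c \<le> 0" using \<open>n > 0\<close> by (simp add: mult_nonneg_nonpos)
      then show ?thesis using False c dG[OF xsc] by (simp add: W_def projK_def)
    qed
    then show ?thesis using dim_Kpol[OF Wp] by (simp add: scalar_prod_lessThan)
  qed
  then have \<Psi>xs: "\<Psi> (real (Suc k)) xs = F xs" for k
    using \<open>xs - xs = 0\<^sub>v d\<close> by (simp add: \<Psi>_def)
  \<comment> \<open>Comparison with \<open>xs\<close>, at which penalty and proximal term
    vanish.\<close>
  have up: "F (X k) + 1 / (2 * real (Suc k)) * (Y k \<bullet> Y k) + 1 / 2 * ((X k - xs) \<bullet> (X k - xs)) \<le> F xs" for k
    using X(2)[OF xsB, of k] unfolding \<Psi>xs by (simp add: \<Psi>_def Y_def)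
  \<comment> \<open>Stationarity of \<open>X k\<close>, with the term \<open>Y k . G (X k)\<close>
    dropped from the left; it is the squared norm of \<open>Y k\<close> divided by
    \<open>k + 1\<close>, hence nonnegative.\<close>
  have stat: "F (X k) + (xs - X k) \<bullet> (x - X k) \<le> F x + Y k \<bullet> G x" if x: "x \<in> B" for k x
  proof -
    have "F (X k) + Y k \<bullet> G (X k) + (0\<^sub>v d + (1 / 1) \<cdot>\<^sub>v (xs - X k)) \<bullet> (x - X k) \<le> F x + Y k \<bullet> G x"
      unfolding Y_def W_def
    proof (rule prox_step_stationary[OF Bcv _ G])
      show "vconvex_fun d F" using F by (simp add: proper_closed_convex_def)
      show "X k \<in> B" "x \<in> B" using X x by auto
      fix z assume z: "z \<in> B"
      have "0\<^sub>v d \<bullet> (z - X k) = 0" using Bc[OF z] Xc by (intro scalar_prod_left_zero) auto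
      then show "F (X k) + 1 / (2 * real (Suc k)) * (projK p q (0\<^sub>v (p + q) + real (Suc k) \<cdot>\<^sub>v G (X k)) \<bullet>
          projK p q (0\<^sub>v (p + q) + real (Suc k) \<cdot>\<^sub>v G (X k)) - 0\<^sub>v (p + q) \<bullet> 0\<^sub>v (p + q)) +
          1 / (2 * 1) * ((X k - xs) \<bullet> (X k - xs)) + 0\<^sub>v d \<bullet> (z - X k)
        \<le> F z + 1 / (2 * real (Suc k)) * (projK p q (0\<^sub>v (p + q) + real (Suc k) \<cdot>\<^sub>v G z) \<bullet>
          projK p q (0\<^sub>v (p + q) + real (Suc k) \<cdot>\<^sub>v G z) - 0\<^sub>v (p + q) \<bullet> 0\<^sub>v (p + q)) +
          1 / (2 * 1) * ((z - xs) \<bullet> (z - xs))"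
        using X(2)[OF z, of k] unfolding \<Psi>_def W_def by linarith
    qed (use xsc in auto)
    moreover have "0 \<le> real (Suc k) * (Y k \<bullet> G (X k))" unfolding Y_def WG[OF Xc] by (rule sp_self_nonneg)
    then have "0 \<le> Y k \<bullet> G (X k)" by (simp add: zero_le_mult_iff del: of_nat_Suc)
    moreover have "0\<^sub>v d + (1 / 1) \<cdot>\<^sub>v (xs - X k) = xs - X k" using xsc Xc by auto
    ultimately show ?thesis by simp
  qed
  obtain x1 where x1: "x1 \<in> B" "\<And>x. x \<in> B \<Longrightarrow> F x1 \<le> F x"
    using lsc_attains_min[OF xsB Bcl Bbd, of F] Fl Bc(1) by (metis (no_types, lifting))
  define C where "C = F xs - F x1"
  have Ybd: "Y k \<bullet> Y k \<le> 2 * real (Suc k) * C" for k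
  proof -
    have "1 / (2 * real (Suc k)) * (Y k \<bullet> Y k) \<le> C"
      using up[of k] x1(2)[OF X(1)[of k]] sp_self_nonneg[of "X k - xs"] unfolding C_def by linarith
    then show ?thesis by (simp add: field_simps)
  qed
  obtain r x' where r: "strict_mono r" "x' \<in> carrier_vec d" "vconv (X \<circ> r) x'"
    using bounded_vec_convergent_subsequence[of X d "1 + vnorm xs"] Xc Bbd X(1) by blast
  have x'B: "x' \<in> B" using Bcl r X(1) unfolding vclosed_def by (metis comp_apply)
  have "G x' \<in> Kcone p q"
  proof (rule Kcone_if_polar)
    show "G x' \<in> carrier_vec (p + q)" using Gc[OF r(2)] .
    fix w assume w: "w \<in> Kpol p q"
    show "w \<bullet> G x' \<le> 0"
    proof (rule liminf_ge_le)
      show "liminf_ge (\<lambda>k. w \<bullet> G ((X \<circ> r) k)) (w \<bullet> G x')"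
        using w r Xc by (intro K_convex_scalar_prod_liminf[OF G] vconv_const) (auto simp: o_def)
      \<comment> \<open>Testing with \<open>sqrt n\<close> times \<open>w\<close> balances
        \<open>n (w . w)\<close> against the bound \<open>2 n C\<close>, so the violation decays
        like \<open>1 / sqrt n\<close>.\<close>
      have *: "w \<bullet> G (X k) \<le> (w \<bullet> w + 2 * C) / (2 * sqrt (real (Suc k)))" for k
      proof -
        define n where "n = real (Suc k)"
        define s where "s = sqrt n"
        have s: "s > 0" "n = s * s" by (auto simp: s_def n_def)
        have sw: "s \<cdot>\<^sub>v w \<in> Kpol p q" using w s by (auto simp: Kpol_def)
        have "2 * n * (s * (w \<bullet> G (X k))) - n * (w \<bullet> w) \<le> 2 * n * C"
        proof -
          have "(s \<cdot>\<^sub>v w) \<bullet> (s \<cdot>\<^sub>v w) = n * (w \<bullet> w)" "(s \<cdot>\<^sub>v w) \<bullet> G (X k) = s * (w \<bullet> G (X k))"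
            using dim_Kpol[OF w] dG[OF Xc, of k] by (simp_all add: sp_simps s(2))
          then show ?thesis using W_ge[OF Xc[of k] sw, of n] Ybd[of k] unfolding Y_def n_def[symmetric]
            by (metis order_trans)
        qed
        then have "n * (2 * (s * (w \<bullet> G (X k))) - w \<bullet> w) \<le> n * (2 * C)" by (simp add: algebra_simps)
        then have "2 * (s * (w \<bullet> G (X k))) - w \<bullet> w \<le> 2 * C" using s by (simp add: n_def del: of_nat_Suc)
        then show ?thesis using s(1) unfolding n_def[symmetric] s_def[symmetric] by (simp add: field_simps)
      qed
      then show "w \<bullet> G ((X \<circ> r) k) \<le> (w \<bullet> w + 2 * C) / (2 * sqrt (real (Suc (r k))))" for k
        by (simp del: of_nat_Suc)
      have "filterlim (\<lambda>k. 2 * sqrt (real (Suc k))) at_top sequentially"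
        by (intro filterlim_tendsto_pos_mult_at_top[OF tendsto_const] filterlim_compose[OF sqrt_at_top]
            filterlim_compose[OF filterlim_real_sequentially] filterlim_Suc) auto
      then have "(\<lambda>k. (w \<bullet> w + 2 * C) / (2 * sqrt (real (Suc k)))) \<longlonglongrightarrow> 0"
        by (intro tendsto_divide_0[OF tendsto_const]) (rule filterlim_at_top_imp_at_infinity)
      from LIMSEQ_subseq_LIMSEQ[OF this r(1)]
      show "(\<lambda>k. (w \<bullet> w + 2 * C) / (2 * sqrt (real (Suc (r k))))) \<longlonglongrightarrow> 0" by (simp add: o_def)
    qed
  qed
  then have "F xs \<le> F x'" using opt x'B Bc by blast
  \<comment> \<open>The proximal term now pays off: \<open>x'\<close> is feasible, hence no better
    than \<open>xs\<close>, so the squared distance must vanish and the subsequence tends to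
    \<open>xs\<close>.\<close>
  moreover have "F x' + 1 / 2 * ((x' - xs) \<bullet> (x' - xs)) \<le> F xs"
  proof (rule liminf_ge_le[OF _ _ tendsto_const])
    show "liminf_ge (\<lambda>k. F ((X \<circ> r) k) + 1 / 2 * (((X \<circ> r) k - xs) \<bullet> ((X \<circ> r) k - xs))) (F x' + 1 / 2 * ((x' - xs) \<bullet> (x' - xs)))"
      using Xc r by (intro liminf_ge_add Fl liminf_ge_tendsto tendsto_mult tendsto_const dl) (auto simp: o_def)
    show "F ((X \<circ> r) k) + 1 / 2 * (((X \<circ> r) k - xs) \<bullet> ((X \<circ> r) k - xs)) \<le> F xs" for k
    proof -
      have "0 \<le> 1 / (2 * real (Suc (r k))) * (Y (r k) \<bullet> Y (r k))" by (simp add: sp_self_nonneg)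
      then show ?thesis using up[of "r k"] unfolding o_def by linarith
    qed
  qed
  ultimately have "(x' - xs) \<bullet> (x' - xs) = 0" using sp_self_nonneg[of "x' - xs"] by linarith
  then have "x' - xs = 0\<^sub>v d" using sp_self_eq_0 xsc by fastforce
  then have "x' = xs" by (rule vec_eq_if_minus_zero[OF r(2) xsc])
  then have Xr: "vconv (X \<circ> r) xs" using r by simp
  \<comment> \<open>The weights are normalised by \<open>\<sigma> + |wk| = 1\<close>, so the limit
    pair \<open>(\<tau>, w)\<close> is nonzero even if the multipliers \<open>Y\<close> are
    unbounded.\<close>
  define \<sigma> where "\<sigma> k = 1 / (1 + vnorm (Y (r k)))" for k
  define wk where "wk k = \<sigma> k \<cdot>\<^sub>v Y (r k)" for k
  have \<sigma>: "0 < \<sigma> k" for k using vnorm_nonneg[of "Y (r k)"] by (simp add: \<sigma>_def)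
  have nw: "vnorm (wk k) = 1 - \<sigma> k" for k
    using vnorm_nonneg[of "Y (r k)"] by (simp add: wk_def vnorm_smult \<sigma>_def field_simps)
  have wkp: "wk k \<in> Kpol p q" for k using Yp[of "r k"] \<sigma>[of k] by (auto simp: wk_def Kpol_def)
  obtain r2 w where r2: "strict_mono r2" "w \<in> carrier_vec (p + q)" "vconv (wk \<circ> r2) w"
    using bounded_vec_convergent_subsequence[of wk "p + q" 1] wkp nw \<sigma>
    by (metis (no_types, lifting) carrier_vecI diff_le_eq dim_Kpol le_add_same_cancel1 less_imp_le)
  define \<tau> where "\<tau> = 1 - vnorm w"
  have \<tau>lim: "(\<lambda>k. \<sigma> (r2 k)) \<longlonglongrightarrow> \<tau>"
  proof -
    have "(\<lambda>k. 1 - vnorm ((wk \<circ> r2) k)) \<longlonglongrightarrow> 1 - vnorm w"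
      by (intro tendsto_intros vconv_vnorm r2)
    then show ?thesis by (simp add: nw \<tau>_def)
  qed
  have \<tau>0: "0 \<le> \<tau>" using \<tau>lim \<sigma> by (intro LIMSEQ_le_const[OF \<tau>lim]) (auto intro: less_imp_le)
  have wp: "w \<in> Kpol p q" using wkp by (intro Kpol_limit[OF _ r2(3)]) simp
  define X2 where "X2 k = X (r (r2 k))" for k
  have X2: "vconv X2 xs" using vconv_subseq[OF Xr r2(1)] by (simp add: X2_def[abs_def] o_def)
  have X2c: "X2 k \<in> carrier_vec d" for k by (simp add: X2_def Xc)
  have FJB: "\<tau> * F xs \<le> \<tau> * F x + w \<bullet> G x" if x: "x \<in> B" for x
  proof (rule liminf_ge_le)
    show "liminf_ge (\<lambda>k. \<sigma> (r2 k) * F (X2 k)) (\<tau> * F xs)"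
      using \<sigma> X2c xsc X2 by (intro liminf_ge_mult \<tau>lim Fl) (auto intro: less_imp_le)
    show "\<sigma> (r2 k) * F (X2 k) \<le> \<sigma> (r2 k) * F x + (wk \<circ> r2) k \<bullet> G x - \<sigma> (r2 k) * ((xs - X2 k) \<bullet> (x - X2 k))" for k
      using mult_left_mono[OF stat[OF x, of "r (r2 k)"], of "\<sigma> (r2 k)"] \<sigma>[of "r2 k"] dim_Kpol[OF Yp] dG[OF Bc(1)[OF x]]
      by (simp add: wk_def X2_def sp_simps algebra_simps)
    have "(\<lambda>k. \<sigma> (r2 k) * F x + (wk \<circ> r2) k \<bullet> G x - \<sigma> (r2 k) * ((xs - X2 k) \<bullet> (x - X2 k)))
        \<longlonglongrightarrow> \<tau> * F x + w \<bullet> G x - \<tau> * ((xs - xs) \<bullet> (x - xs))"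
      using Bc(1)[OF x] xsc r2 dG[OF Bc(1)[OF x]]
      by (intro tendsto_intros \<tau>lim vconv_scalar_prod vconv_minus vconv_const X2 r2(3)) auto
    moreover have "(xs - xs) \<bullet> (x - xs) = 0" unfolding \<open>xs - xs = 0\<^sub>v d\<close> using Bc(1)[OF x] xsc by (intro scalar_prod_left_zero) auto
    ultimately show "(\<lambda>k. \<sigma> (r2 k) * F x + (wk \<circ> r2) k \<bullet> G x - \<sigma> (r2 k) * ((xs - X2 k) \<bullet> (x - X2 k)))
        \<longlonglongrightarrow> \<tau> * F x + w \<bullet> G x" by simp
  qed
  \<comment> \<open>Convexity removes the ball: move from \<open>x\<close> towards \<open>xs\<close>
    until inside it, then divide by \<open>t\<close>; the value of \<open>w . G\<close> at
    \<open>xs\<close> is nonpositive by polarity.\<close>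
  have FJ: "\<tau> * F xs \<le> \<tau> * F x + w \<bullet> G x" if x: "x \<in> \<Omega>" for x
  proof -
    define t where "t = 1 / (1 + vnorm (x - xs))"
    have t: "0 < t" "t \<le> 1" using vnorm_nonneg[of "x - xs"] by (auto simp: t_def)
    define z where "z = t \<cdot>\<^sub>v x + (1 - t) \<cdot>\<^sub>v xs"
    have zz: "z - xs = t \<cdot>\<^sub>v (x - xs)" using \<Omega>c[OF x] xsc by (auto simp: z_def algebra_simps)
    have "vnorm (z - xs) \<le> 1" unfolding zz using vnorm_nonneg[of "x - xs"] by (simp add: vnorm_smult t_def)
    moreover have "z \<in> \<Omega>" using \<Omega>(2) x xs(1) t by (auto simp: vconvex_set_def z_def)
    ultimately have "\<tau> * F xs \<le> \<tau> * F z + w \<bullet> G z" using FJB by (simp add: B_def)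
    also have "\<tau> * F z \<le> \<tau> * (t * F x + (1 - t) * F xs)"
      using vconvex_funD[of d F x xs t] F t \<tau>0 \<Omega>c[OF x] xsc
      by (intro mult_left_mono) (auto simp: z_def proper_closed_convex_def)
    also have "w \<bullet> G z \<le> t * (w \<bullet> G x) + (1 - t) * (w \<bullet> G xs)"
      unfolding z_def using K_convex_scalar_prod[OF G wp \<Omega>c[OF x] xsc] t by auto
    also have "(1 - t) * (w \<bullet> G xs) \<le> 0" using Kpol_Kcone_nonpos[OF wp xs(2)] t by (simp add: mult_nonneg_nonpos)
    finally have "t * (\<tau> * F xs) \<le> t * (\<tau> * F x + w \<bullet> G x)" by (simp add: algebra_simps)
    then show ?thesis using t by simp
  qed
  have "\<tau> \<noteq> 0"
  proof
    assume \<tau>: "\<tau> = 0"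
    obtain e where e: "e > 0" "\<And>y. y \<in> carrier_vec d \<Longrightarrow> vnorm (y - xb) < e \<Longrightarrow> y \<in> \<Omega>"
      and xbc: "xb \<in> carrier_vec d" using xb(1) by (auto simp: vinterior_def)
    have "xb - xb = 0\<^sub>v d" using xbc by auto
    then have xb\<Omega>: "xb \<in> \<Omega>" using e xbc by (auto simp: vnorm_def)
    \<comment> \<open>At the Slater point \<open>w . G\<close> is a sum of nonpositive terms, yet
      nonnegative by \<open>FJ\<close> with \<open>\<tau> = 0\<close>. So each term vanishes, and
      strict negativity removes the inequality part of \<open>w\<close>.\<close>
    have tm: "w $ c * G xb $ c \<le> 0" if "c < p + q" for c
      using that xb(2,3)[of c] wp by (cases "c < p") (auto simp: Kpol_def mult_nonneg_nonpos less_imp_le)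
    have hpos: "0 \<le> w \<bullet> G x" if "x \<in> \<Omega>" for x using FJ[OF that] \<tau> by simp
    have hxb: "w \<bullet> G xb = 0"
      using hpos[OF xb\<Omega>] tm dG[OF xbc] unfolding scalar_prod_lessThan by (intro antisym sum_nonpos) auto
    have "(\<Sum>c<p + q. - (w $ c * G xb $ c)) = 0" using hxb dG[OF xbc] by (simp add: scalar_prod_lessThan sum_negf)
    then have "\<forall>c<p + q. w $ c * G xb $ c = 0" using tm by (subst (asm) sum_nonneg_eq_0_iff) auto
    then have w0: "w $ c = 0" if "p \<le> c" "c < p + q" for c using xb(3)[OF that] that by fastforce
    \<comment> \<open>With only equality weights left, \<open>-w\<close> is in the cone as well and
      \<open>w . G\<close> becomes affine.\<close>
    have mw: "(-1) \<cdot>\<^sub>v w \<in> Kpol p q" using r2(2) w0 by (auto simp: Kpol_def)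
    have maff: "w \<bullet> G (t \<cdot>\<^sub>v x + (1 - t) \<cdot>\<^sub>v z) = t * (w \<bullet> G x) + (1 - t) * (w \<bullet> G z)"
      if "x \<in> carrier_vec d" "z \<in> carrier_vec d" "0 \<le> t" "t \<le> 1" for x z t
    proof -
      have zz: "t \<cdot>\<^sub>v x + (1 - t) \<cdot>\<^sub>v z \<in> carrier_vec d" using that by auto
      show ?thesis
        using K_convex_scalar_prod[OF G wp that] K_convex_scalar_prod[OF G mw that] r2(2) dG[OF that(1)] dG[OF that(2)] dG[OF zz]
        by (simp add: sp_simps)
    qed
    \<comment> \<open>An affine function that is nonnegative near \<open>xb\<close> and 0 at
      \<open>xb\<close> is 0 everywhere: \<open>z1\<close> and \<open>z2\<close> are reflections of
      each other in \<open>xb\<close>, both close enough to lie in \<open>\<Omega>\<close>.\<close>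
    have h0: "w \<bullet> G x = 0" if x: "x \<in> carrier_vec d" for x
    proof -
      define t where "t = min 1 (e / (2 * (1 + vnorm (x - xb))))"
      have t: "0 < t" "t \<le> 1" using e vnorm_nonneg[of "x - xb"] by (auto simp: t_def)
      have "t * vnorm (x - xb) \<le> e / (2 * (1 + vnorm (x - xb))) * vnorm (x - xb)"
        using vnorm_nonneg by (intro mult_right_mono) (auto simp: t_def)
      also have "\<dots> < e" using e vnorm_nonneg[of "x - xb"] by (simp add: field_simps add_pos_nonneg)
      finally have tn: "t * vnorm (x - xb) < e" .
      define z1 z2 where "z1 = t \<cdot>\<^sub>v x + (1 - t) \<cdot>\<^sub>v xb" and "z2 = xb + (- t) \<cdot>\<^sub>v (x - xb)"
      have zc: "z1 \<in> carrier_vec d" "z2 \<in> carrier_vec d" using x xbc by (auto simp: z1_def z2_def)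
      have "z1 - xb = t \<cdot>\<^sub>v (x - xb)" "z2 - xb = (- t) \<cdot>\<^sub>v (x - xb)"
        using x xbc by (auto simp: z1_def z2_def algebra_simps)
      then have "z1 \<in> \<Omega>" "z2 \<in> \<Omega>" using e(2) zc tn t by (auto simp: vnorm_smult)
      then have pos: "0 \<le> w \<bullet> G z1" "0 \<le> w \<bullet> G z2" using hpos by auto
      have "(1 / 2) \<cdot>\<^sub>v z1 + (1 - 1 / 2) \<cdot>\<^sub>v z2 = xb" using x xbc by (auto simp: z1_def z2_def algebra_simps)
      then have "w \<bullet> G z1 + w \<bullet> G z2 = 0" using maff[OF zc, of "1/2"] hxb by simp
      then have "w \<bullet> G z1 = 0" using pos by linarith
      then have "t * (w \<bullet> G x) = 0" using maff[OF x xbc, of t] t hxb by (simp add: z1_def)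
      then show ?thesis using t by simp
    qed
    \<comment> \<open>On the equality coordinates \<open>Y k\<close> is a multiple of
      \<open>G (X k)\<close>, so it is orthogonal to \<open>w\<close>. As a limit of multiples of
      such vectors, \<open>w\<close> would be 0, against \<open>|w| = 1\<close>.\<close>
    have "w \<bullet> Y k = 0" for k
    proof -
      have "w \<bullet> Y k = real (Suc k) * (w \<bullet> G (X k))"
        using w0 dG[OF Xc, of k] unfolding scalar_prod_lessThan sum_distrib_left
        by (intro sum.cong) (auto simp: Y_def W_def projK_def)
      then show ?thesis using h0[OF Xc] by simp
    qed
    then have "(\<lambda>k. w \<bullet> (wk \<circ> r2) k) = (\<lambda>k. 0)" by (simp add: wk_def sp_simps)
    moreover have "(\<lambda>k. w \<bullet> (wk \<circ> r2) k) \<longlonglongrightarrow> w \<bullet> w" by (intro vconv_scalar_prod vconv_const r2) simp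
    ultimately have "w \<bullet> w = 0" using LIMSEQ_unique tendsto_const by metis
    then show False using \<tau> by (simp add: \<tau>_def vnorm_def)
  qed
  then have \<tau>p: "\<tau> > 0" using \<tau>0 by simp
  have "(1 / \<tau>) \<cdot>\<^sub>v w \<in> Kpol p q" using wp \<tau>p by (auto simp: Kpol_def)
  moreover have "F xs \<le> F x + ((1 / \<tau>) \<cdot>\<^sub>v w) \<bullet> G x" if "x \<in> \<Omega>" for x
  proof -
    have "((1 / \<tau>) \<cdot>\<^sub>v w) \<bullet> G x = (1 / \<tau>) * (w \<bullet> G x)" using r2(2) dG[OF \<Omega>c[OF that]] by (simp add: sp_simps)
    then have "\<tau> * F xs \<le> \<tau> * (F x + ((1 / \<tau>) \<cdot>\<^sub>v w) \<bullet> G x)"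
      using FJ[OF that] \<tau>p by (simp add: distrib_left)
    then show ?thesis using \<tau>p by simp
  qed
  ultimately show ?thesis by blast
qed

section \<open>Block vectors and block matrices\<close>

lemma offs_Suc: "offs ds (Suc i) = offs ds i + ds i"
  by (simp add: offs_def)

lemma offs_0 [simp]: "offs ds 0 = 0"
  by (simp add: offs_def)

lemma offs_const: "offs (\<lambda>_. d) i = i * d"
  by (simp add: offs_def)

lemma offs_le: "i < m \<Longrightarrow> offs ds i + ds i \<le> offs ds m"
  by (induction m) (auto simp: offs_Suc less_Suc_eq)

lemma offs_less: "i < m \<Longrightarrow> j < ds i \<Longrightarrow> offs ds i + j < offs ds m"
  using offs_le[of i m ds] by simp

lemma dim_blk [simp]: "dim_vec (blk ds i x) = ds i"
  by (simp add: blk_def)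

lemma index_blk [simp]: "j < ds i \<Longrightarrow> blk ds i x $ j = x $ (offs ds i + j)"
  by (simp add: blk_def)

lemma blk_carrier [simp]: "blk ds i x \<in> carrier_vec (ds i)"
  by (simp add: carrier_vecI)

lemma blk_add: "dim_vec y = offs ds m \<Longrightarrow> i < m \<Longrightarrow> blk ds i (x + y) = blk ds i x + blk ds i y"
  by (auto simp: offs_less)

lemma blk_minus: "dim_vec y = offs ds m \<Longrightarrow> i < m \<Longrightarrow> blk ds i (x - y) = blk ds i x - blk ds i y"
  by (auto simp: offs_less)

lemma blk_smult: "dim_vec y = offs ds m \<Longrightarrow> i < m \<Longrightarrow> blk ds i (a \<cdot>\<^sub>v y) = a \<cdot>\<^sub>v blk ds i y"
  by (auto simp: offs_less)

lemma dim_stack: "dim_vec (stack m vs) = (\<Sum>i<m. dim_vec (vs i))"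
  by (induction m) auto

lemma dim_stack_offs: "(\<And>i. i < m \<Longrightarrow> dim_vec (vs i) = ds i) \<Longrightarrow> dim_vec (stack m vs) = offs ds m"
  by (simp add: dim_stack offs_def)

lemma blk_stack: "(\<And>i. i < m \<Longrightarrow> dim_vec (vs i) = ds i) \<Longrightarrow> i < m \<Longrightarrow> blk ds i (stack m vs) = vs i"
proof (induction m)
  case (Suc m)
  have d: "dim_vec (stack m vs) = offs ds m" using Suc.prems by (intro dim_stack_offs) auto
  show ?case
  proof (cases "i = m")
    case True
    then show ?thesis using Suc.prems d by auto
  next
    case False
    then have "blk ds i (stack (Suc m) vs) = blk ds i (stack m vs)"
      using Suc.prems d offs_less[of i m _ ds] by (intro eq_vecI) (auto simp: trans_less_add1)
    then show ?thesis using Suc False by auto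
  qed
qed simp

lemma stack_blk_vec: "stack m (\<lambda>i. blk ds i x) = vec (offs ds m) (\<lambda>k. x $ k)"
  by (induction m) (auto simp: offs_Suc)

lemma stack_blk: "dim_vec x = offs ds m \<Longrightarrow> stack m (\<lambda>i. blk ds i x) = x"
  by (auto simp: stack_blk_vec)

lemma stack_cong: "(\<And>i. i < m \<Longrightarrow> vs i = ws i) \<Longrightarrow> stack m vs = stack m ws"
  by (induction m) auto

lemma vec_eq_blkI:
  assumes "dim_vec x = offs ds m" "dim_vec y = offs ds m" "\<And>i. i < m \<Longrightarrow> blk ds i x = blk ds i y"
  shows "x = y"
  using stack_cong[of m "\<lambda>i. blk ds i x" "\<lambda>i. blk ds i y"] assms by (simp add: stack_blk)

lemma sum_lessThan_add:
  fixes h :: "nat \<Rightarrow> 'a :: comm_monoid_add"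
  shows "(\<Sum>k<a + b. h k) = (\<Sum>k<a. h k) + (\<Sum>k<b. h (a + k))"
  by (induction b) (auto simp: ac_simps)

lemma sum_lessThan_offs:
  fixes h :: "nat \<Rightarrow> 'a :: comm_monoid_add"
  shows "(\<Sum>k<offs ds m. h k) = (\<Sum>i<m. \<Sum>j<ds i. h (offs ds i + j))"
  by (induction m) (auto simp: offs_Suc sum_lessThan_add)

lemma sp_blocks: "dim_vec y = offs ds m \<Longrightarrow> x \<bullet> y = (\<Sum>i<m. blk ds i x \<bullet> blk ds i y)"
  by (simp add: scalar_prod_lessThan sum_lessThan_offs)

lemma vconv_blk:
  assumes "vconv s x" "dim_vec x = offs ds m" "i < m"
  shows "vconv (\<lambda>k. blk ds i (s k)) (blk ds i x)"
  using assms by (auto simp: vconv_iff offs_less)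

section \<open>Block-diagonal matrices, inverses and Kronecker products with an identity\<close>

lemma mat_eq_if_mult_vec_eq:
  fixes A B :: "real mat"
  assumes "A \<in> carrier_mat n k" "B \<in> carrier_mat n k" "\<And>v. v \<in> carrier_vec k \<Longrightarrow> A *\<^sub>v v = B *\<^sub>v v"
  shows "A = B"
proof (rule eq_matI)
  fix i j assume ij: "i < dim_row B" "j < dim_col B"
  have "(C *\<^sub>v unit_vec k j) $ i = C $$ (i, j)" if "C \<in> carrier_mat n k" for C :: "real mat"
    using that ij assms by (simp add: scalar_prod_right_unit)
  then show "A $$ (i, j) = B $$ (i, j)" using assms by (metis unit_vec_carrier)
qed (use assms in auto)

lemma bdiag_carrier [simp]: "bdiag m ds cs \<in> carrier_mat (offs ds m) (offs ds m)"
proof -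
  have "sum_list (map ds [0..<m]) = offs ds m"
    by (simp add: offs_def sum_list_sum_nth atLeast0LessThan)
  then show ?thesis by (auto simp: bdiag_def dim_diag_block_mat o_def)
qed

lemma bdiag_Suc:
  "bdiag (Suc m) ds cs = four_block_mat (bdiag m ds cs) (0\<^sub>m (offs ds m) (ds m)) (0\<^sub>m (ds m) (offs ds m)) (cs m \<cdot>\<^sub>m 1\<^sub>m (ds m))"
  using bdiag_carrier[of m ds cs] unfolding bdiag_def by (simp add: diag_block_mat_last Let_def)

lemma smult_one_mult_vec: "v \<in> carrier_vec n \<Longrightarrow> (a \<cdot>\<^sub>m 1\<^sub>m n) *\<^sub>v v = a \<cdot>\<^sub>v (v :: real vec)"
  by (auto simp: scalar_prod_left_unit)

lemma bdiag_mult_vec: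
  "x \<in> carrier_vec (offs ds m) \<Longrightarrow> bdiag m ds cs *\<^sub>v x = stack m (\<lambda>i. cs i \<cdot>\<^sub>v blk ds i x)"
proof (induction m arbitrary: x)
  case 0
  then show ?case using bdiag_carrier[of 0 ds cs] by auto
next
  case (Suc m)
  define x1 where "x1 = vec_first x (offs ds m)"
  have x: "x = x1 @\<^sub>v blk ds m x"
    using Suc.prems by (auto simp: x1_def vec_first_def offs_Suc)
  have x1: "x1 \<in> carrier_vec (offs ds m)" by (simp add: x1_def)
  have "blk ds i x = blk ds i x1" if "i < m" for i
    using that offs_less[of i m _ ds] by (auto simp: x1_def vec_first_def)
  then have "stack m (\<lambda>i. cs i \<cdot>\<^sub>v blk ds i x1) = stack m (\<lambda>i. cs i \<cdot>\<^sub>v blk ds i x)"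
    by (intro stack_cong) auto
  moreover have "bdiag (Suc m) ds cs *\<^sub>v x = (bdiag m ds cs *\<^sub>v x1) @\<^sub>v (cs m \<cdot>\<^sub>v blk ds m x)"
    by (subst x, unfold bdiag_Suc, subst mult_mat_vec_split[of _ "offs ds m" _ "ds m"])
      (auto simp: x1 smult_one_mult_vec)
  ultimately show ?case using Suc.IH[OF x1] by simp
qed

lemma dim_bdiag [simp]: "dim_row (bdiag m ds cs) = offs ds m" "dim_col (bdiag m ds cs) = offs ds m"
  using bdiag_carrier by (rule carrier_matD)+

lemma blk_bdiag:
  assumes "dim_vec x = offs ds m" "i < m"
  shows "blk ds i (bdiag m ds cs *\<^sub>v x) = cs i \<cdot>\<^sub>v blk ds i x"
  unfolding bdiag_mult_vec[OF carrier_vecI[OF assms(1)]] using assms(2) by (intro blk_stack) auto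

lemma bdiag_bdiag_inverse:
  assumes "x \<in> carrier_vec (offs ds m)" "\<And>i. i < m \<Longrightarrow> cs i * cs' i = 1"
  shows "bdiag m ds cs *\<^sub>v (bdiag m ds cs' *\<^sub>v x) = x"
proof (rule vec_eq_blkI[of _ ds m])
  fix i assume "i < m"
  then show "blk ds i (bdiag m ds cs *\<^sub>v (bdiag m ds cs' *\<^sub>v x)) = blk ds i x"
    using assms by (simp add: blk_bdiag smult_smult_assoc)
qed (use assms in auto)

lemma bdiag_inverse:
  assumes "\<And>i. i < m \<Longrightarrow> cs i \<noteq> 0"
  shows "bdiag m ds cs * bdiag m ds (\<lambda>i. 1 / cs i) = 1\<^sub>m (offs ds m)"
proof (rule mat_eq_if_mult_vec_eq)
  fix v :: "real vec" assume v: "v \<in> carrier_vec (offs ds m)"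
  then show "bdiag m ds cs * bdiag m ds (\<lambda>i. 1 / cs i) *\<^sub>v v = 1\<^sub>m (offs ds m) *\<^sub>v v"
    using bdiag_bdiag_inverse[OF v, of cs "\<lambda>i. 1 / cs i"] assms
    by (simp add: assoc_mult_mat_vec[OF bdiag_carrier bdiag_carrier])
qed (auto intro: mult_carrier_mat)

text \<open>A right inverse of a square matrix is also a left inverse, and inverses are unique; this
  lets the definite description in \<open>minv\<close> be evaluated from one product.\<close>

lemma minv_eqI:
  fixes A B :: "real mat"
  assumes A: "A \<in> carrier_mat n n" and B: "B \<in> carrier_mat n n" and AB: "A * B = 1\<^sub>m n"
  shows "minv A = B"
  unfolding minv_def
proof (rule the_equality)
  have "B * A = 1\<^sub>m n" by (rule mat_mult_left_right_inverse[OF A B AB])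
  then show "B \<in> carrier_mat (dim_row A) (dim_row A) \<and> inverts_mat A B \<and> inverts_mat B A"
    using A B AB by (auto simp: inverts_mat_def)
  fix C assume "C \<in> carrier_mat (dim_row A) (dim_row A) \<and> inverts_mat A C \<and> inverts_mat C A"
  then have C: "C \<in> carrier_mat n n" "C * A = 1\<^sub>m n" using A by (auto simp: inverts_mat_def)
  have "C = C * (A * B)" using C AB by simp
  also have "\<dots> = B" using C A B by (simp flip: assoc_mult_mat[OF C(1) A B])
  finally show "C = B" .
qed

lemma minv_bdiag:
  "(\<And>i. i < m \<Longrightarrow> cs i \<noteq> 0) \<Longrightarrow> minv (bdiag m ds cs) = bdiag m ds (\<lambda>i. 1 / cs i)"
  using bdiag_inverse by (intro minv_eqI[of _ "offs ds m"]) auto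

lemma kron_one_carrier [simp]: "V \<in> carrier_mat a b \<Longrightarrow> kron V (1\<^sub>m d) \<in> carrier_mat (a * d) (b * d)"
  by (auto simp: kron_def)

lemma block_index_less: "(j::nat) < a \<Longrightarrow> c < d \<Longrightarrow> j * d + c < a * d"
  using offs_less[of j a c "\<lambda>_. d"] by (simp add: offs_const)

lemma kron_one_index:
  assumes "V \<in> carrier_mat a b" "j < a" "i < b" "c < d" "e < d"
  shows "kron V (1\<^sub>m d) $$ (j * d + c, i * d + e) = (if c = e then V $$ (j, i) else 0)"
  using assms block_index_less[of j a c d] block_index_less[of i b e d] by (auto simp: kron_def)

lemma transpose_kron_one:
  assumes V: "V \<in> carrier_mat a b"
  shows "(kron V (1\<^sub>m d))\<^sup>T = kron (V\<^sup>T) (1\<^sub>m d)"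
proof (rule eq_matI)
  fix i j assume "i < dim_row (kron V\<^sup>T (1\<^sub>m d))" "j < dim_col (kron V\<^sup>T (1\<^sub>m d))"
  then have "i < b * d" "j < a * d" using V by (auto simp: kron_def)
  then have "i div d < b" "j div d < a" "i mod d < d" "j mod d < d"
    by (auto simp: less_mult_imp_div_less) (metis less_nat_zero_code mod_less_divisor mult_0_right neq0_conv)+
  then show "(kron V (1\<^sub>m d))\<^sup>T $$ (i, j) = kron V\<^sup>T (1\<^sub>m d) $$ (i, j)"
    using V \<open>i < b * d\<close> \<open>j < a * d\<close> by (auto simp: kron_def)
qed (use V in \<open>auto simp: kron_def\<close>)

text \<open>Index \<open>j * d + c\<close> addresses component \<open>c\<close> of block
  \<open>j\<close>; the identity factor leaves only the summands with equal component.\<close>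

lemma blk_kron_one:
  assumes V: "V \<in> carrier_mat a b" and y: "dim_vec y = b * d" and j: "j < a" and c: "c < d"
  shows "blk (\<lambda>_. d) j (kron V (1\<^sub>m d) *\<^sub>v y) $ c = (\<Sum>i<b. V $$ (j, i) * blk (\<lambda>_. d) i y $ c)"
proof -
  have jc: "j * d + c < a * d" using block_index_less[OF j c] .
  have "blk (\<lambda>_. d) j (kron V (1\<^sub>m d) *\<^sub>v y) $ c = row (kron V (1\<^sub>m d)) (j * d + c) \<bullet> y"
    using c jc kron_one_carrier[OF V, of d] by (simp add: offs_const)
  also have "\<dots> = (\<Sum>i<b. \<Sum>e<d. kron V (1\<^sub>m d) $$ (j * d + c, i * d + e) * y $ (i * d + e))"
    using jc y kron_one_carrier[OF V, of d] block_index_less[of _ b _ d]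
    by (subst sp_blocks[of _ "\<lambda>_. d" b]) (auto simp: offs_const scalar_prod_lessThan)
  also have "\<dots> = (\<Sum>i<b. \<Sum>e<d. if c = e then V $$ (j, i) * y $ (i * d + e) else 0)"
    using V j c by (intro sum.cong) (auto simp: kron_one_index)
  also have "\<dots> = (\<Sum>i<b. V $$ (j, i) * blk (\<lambda>_. d) i y $ c)" using c by (simp add: offs_const)
  finally show ?thesis .
qed

section \<open>Spectral bound, range and kernel of U\<close>

lemma finite_eigenvalues:
  assumes "(A :: real mat) \<in> carrier_mat n n"
  shows "finite {c. eigenvalue A c}"
proof -
  \<comment> \<open>\<open>lam_max\<close> is a \<open>Max\<close>, so bounding an eigenvalue by it
    requires a finite set; here it is the root set of a nonzero polynomial.\<close>
  have "char_poly A \<noteq> 0" using degree_monic_char_poly[OF assms] by auto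
  then show ?thesis unfolding eigenvalue_root_char_poly[OF assms] by (rule poly_roots_finite)
qed

lemma sp_transpose:
  assumes "(A :: real mat) \<in> carrier_mat n k" "x \<in> carrier_vec k" "y \<in> carrier_vec n"
  shows "y \<bullet> (A *\<^sub>v x) = (A\<^sup>T *\<^sub>v y) \<bullet> x"
  using transpose_vec_mult_scalar[OF assms] by simp

lemma vconv_mult_mat_vec:
  assumes "(A :: real mat) \<in> carrier_mat n k" "vconv s x" "x \<in> carrier_vec k"
  shows "vconv (\<lambda>i. A *\<^sub>v s i) (A *\<^sub>v x)"
  using assms by (auto simp: vconv_iff scalar_prod_lessThan intro!: tendsto_sum tendsto_mult)

text \<open>A maximiser of the Rayleigh quotient is an eigenvector.\<close>

lemma rayleigh_le_lam_max:
  assumes L: "L \<in> carrier_mat n n" and sym: "L\<^sup>T = L" and x: "x \<in> carrier_vec n"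
  shows "x \<bullet> (L *\<^sub>v x) \<le> lam_max L * (x \<bullet> x)"
proof (cases "x \<bullet> x = 0")
  case True
  then have "x = 0\<^sub>v n" using sp_self_eq_0 x by fastforce
  then show ?thesis using L by (simp add: scalar_prod_left_zero[OF mult_mat_vec_carrier[OF L]])
next
  case False
  then have xp: "x \<bullet> x > 0" using sp_self_nonneg[of x] by linarith
  define S where "S = {v \<in> carrier_vec n. vnorm v = 1}"
  have norm1: "(1 / vnorm v) \<cdot>\<^sub>v v \<in> S" if "v \<in> carrier_vec n" "v \<bullet> v > 0" for v
    using that by (simp add: S_def vnorm_def sp_simps real_sqrt_divide flip: power2_eq_square)
  have "vclosed n S" unfolding vclosed_def
  proof (intro conjI allI impI)
    fix s l assume s: "\<forall>k. s k \<in> S" "vconv s l"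
    have "l \<in> carrier_vec n" using s by (metis (mono_tags, lifting) S_def carrier_vecD carrier_vecI mem_Collect_eq vconv_def)
    moreover have "(\<lambda>k. vnorm (s k)) \<longlonglongrightarrow> vnorm l" using s by (intro vconv_vnorm)
    then have "vnorm l = 1" using s by (simp add: S_def LIMSEQ_const_iff)
    ultimately show "l \<in> S" by (simp add: S_def)
  qed (auto simp: S_def)
  moreover have "liminf_ge (\<lambda>k. - (s k \<bullet> (L *\<^sub>v s k))) (- (v \<bullet> (L *\<^sub>v v)))" if "\<And>k. s k \<in> S" "v \<in> S" "vconv s v" for s v
    using that L by (intro liminf_ge_tendsto tendsto_minus vconv_scalar_prod vconv_mult_mat_vec[of _ n n]) (auto simp: S_def)
  ultimately obtain e where e: "e \<in> S" "\<And>v. v \<in> S \<Longrightarrow> - (e \<bullet> (L *\<^sub>v e)) \<le> - (v \<bullet> (L *\<^sub>v v))"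
    using lsc_attains_min[OF norm1[OF x xp], of n 1 "\<lambda>v. - (v \<bullet> (L *\<^sub>v v))"] by (auto simp: S_def)
  define \<mu> where "\<mu> = e \<bullet> (L *\<^sub>v e)"
  have ec: "e \<in> carrier_vec n" and ee: "e \<bullet> e = 1" using e vnorm_sq[of e] by (auto simp: S_def)
  have Lc: "L *\<^sub>v v \<in> carrier_vec n" if "v \<in> carrier_vec n" for v using L that by simp
  have ray: "v \<bullet> (L *\<^sub>v v) \<le> \<mu> * (v \<bullet> v)" if v: "v \<in> carrier_vec n" for v
  proof (cases "v \<bullet> v = 0")
    case True
    then have "v = 0\<^sub>v n" using sp_self_eq_0 v by fastforce
    then show ?thesis using L by (simp add: scalar_prod_left_zero[OF mult_mat_vec_carrier[OF L]])
  next
    case False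
    then have vp: "v \<bullet> v > 0" using sp_self_nonneg[of v] by linarith
    have "((1 / vnorm v) \<cdot>\<^sub>v v) \<bullet> (L *\<^sub>v ((1 / vnorm v) \<cdot>\<^sub>v v)) \<le> \<mu>"
      using e(2)[OF norm1[OF v vp]] by (simp add: \<mu>_def)
    moreover have "((1 / vnorm v) \<cdot>\<^sub>v v) \<bullet> (L *\<^sub>v ((1 / vnorm v) \<cdot>\<^sub>v v)) = (v \<bullet> (L *\<^sub>v v)) / (v \<bullet> v)"
      using Lc[OF v] v L by (simp add: mult_mat_vec[OF L v] sp_simps flip: vnorm_sq) (simp add: power2_eq_square)
    ultimately show ?thesis using vp by (simp add: field_simps)
  qed
  have "\<mu> \<cdot>\<^sub>v e = L *\<^sub>v e"
  proof -
    \<comment> \<open>\<open>v\<close> is the eigenvector residual. Perturbing \<open>e\<close>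
      along it changes the Rayleigh inequality at first order by \<open>2 t (v . v)\<close>, so
      \<open>v\<close> must vanish.\<close>
    define v where "v = L *\<^sub>v e - \<mu> \<cdot>\<^sub>v e"
    have v: "v \<in> carrier_vec n" using Lc[OF ec] ec by (simp add: v_def)
    have "t * (2 * (v \<bullet> v)) \<le> t * 0 + t\<^sup>2 * (\<mu> * (v \<bullet> v) - v \<bullet> (L *\<^sub>v v))" for t
    proof -
      define w where "w = e + t \<cdot>\<^sub>v v"
      have w: "w \<in> carrier_vec n" using ec v by (simp add: w_def)
      have "L *\<^sub>v w = L *\<^sub>v e + t \<cdot>\<^sub>v (L *\<^sub>v v)"
        unfolding w_def using ec v by (simp add: mult_add_distrib_mat_vec[OF L] mult_mat_vec[OF L])
      moreover have "e \<bullet> (L *\<^sub>v v) = v \<bullet> (L *\<^sub>v e)"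
        using sp_transpose[OF L v ec] sym sp_comm[of "L *\<^sub>v e" v] L v by simp
      ultimately have "w \<bullet> (L *\<^sub>v w) = \<mu> + 2 * t * (v \<bullet> (L *\<^sub>v e)) + t\<^sup>2 * (v \<bullet> (L *\<^sub>v v))"
        using ec v L by (simp add: w_def sp_simps \<mu>_def power2_eq_square algebra_simps)
      moreover have "w \<bullet> w = 1 + 2 * t * (v \<bullet> e) + t\<^sup>2 * (v \<bullet> v)"
        using ec v by (simp add: w_def sp_simps ee sp_comm[of e v] power2_eq_square algebra_simps)
      moreover have "v \<bullet> (L *\<^sub>v e) = v \<bullet> v + \<mu> * (v \<bullet> e)"
      proof -
        have "L *\<^sub>v e = v + \<mu> \<cdot>\<^sub>v e" using L ec by (intro eq_vecI) (auto simp: v_def)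
        then show ?thesis using v ec by (simp add: sp_simps)
      qed
      ultimately show ?thesis using ray[OF w] by (simp add: algebra_simps)
    qed
    then have "2 * (v \<bullet> v) \<le> 0" by (rule linear_le_if_quadratic)
    then have "v \<bullet> v = 0" using sp_self_nonneg[of v] by linarith
    then have "v = 0\<^sub>v n" using sp_self_eq_0 v by fastforce
    then have "L *\<^sub>v e - \<mu> \<cdot>\<^sub>v e = 0\<^sub>v n" by (simp add: v_def)
    then have "L *\<^sub>v e = \<mu> \<cdot>\<^sub>v e" by (rule vec_eq_if_minus_zero[OF Lc[OF ec] smult_carrier_vec[THEN iffD2, OF ec]])
    then show ?thesis by simp
  qed
  moreover have "e \<noteq> 0\<^sub>v n" using ee by auto
  ultimately have "eigenvalue L \<mu>" using L ec unfolding eigenvalue_def eigenvector_def by auto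
  then have "\<mu> \<le> lam_max L" unfolding lam_max_def using finite_eigenvalues[OF L] by (intro Max_ge) auto
  then show ?thesis using ray[OF x] xp by (smt (verit) mult_right_mono)
qed

lemma full_row_rank_transpose_inj:
  assumes U: "U \<in> carrier_mat r m" "full_row_rank U" and z: "z \<in> carrier_vec r" "U\<^sup>T *\<^sub>v z = 0\<^sub>v m"
  shows "z = 0\<^sub>v r"
proof -
  have "(\<Sum>i<r. z $ i * U $$ (i, j)) = 0" if "j < m" for j
  proof -
    have "(U\<^sup>T *\<^sub>v z) $ j = (\<Sum>i<r. z $ i * U $$ (i, j))"
      using that U(1) z(1) by (simp add: scalar_prod_lessThan mult.commute)
    then show ?thesis using z(2) that by simp
  qed
  then show ?thesis using U z(1) unfolding full_row_rank_def by auto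
qed

text \<open>\<open>U U^T\<close> is invertible by full row rank, so \<open>u\<close> can be
  projected orthogonally onto the range of \<open>U^T\<close>. The residual lies in the kernel of
  \<open>U\<close>, so it is a multiple of the all-ones vector, but it is orthogonal to that vector
  because both \<open>u\<close> and the range are.\<close>

lemma transpose_range:
  assumes U: "U \<in> carrier_mat r m" "full_row_rank U"
    and null: "\<And>v. v \<in> carrier_vec m \<Longrightarrow> U *\<^sub>v v = 0\<^sub>v r \<Longrightarrow> \<exists>c. v = c \<cdot>\<^sub>v vec m (\<lambda>_. 1)"
    and one: "U *\<^sub>v vec m (\<lambda>_. 1) = 0\<^sub>v r"
    and m: "m > 0" and u: "u \<in> carrier_vec m" "(\<Sum>i<m. u $ i) = 0"
  shows "\<exists>z\<in>carrier_vec r. U\<^sup>T *\<^sub>v z = u"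
proof -
  have UT: "U\<^sup>T \<in> carrier_mat m r" using U by simp
  define S where "S = U * U\<^sup>T"
  have S: "S \<in> carrier_mat r r" using U UT by (simp add: S_def)
  have "z = 0\<^sub>v r" if z: "z \<in> carrier_vec r" "S *\<^sub>v z = 0\<^sub>v r" for z
  proof -
    have "U *\<^sub>v (U\<^sup>T *\<^sub>v z) = 0\<^sub>v r" using z assoc_mult_mat_vec[OF U(1) UT z(1)] by (simp add: S_def)
    then have "(U\<^sup>T *\<^sub>v z) \<bullet> (U\<^sup>T *\<^sub>v z) = 0"
      using sp_transpose[OF U(1) _ z(1), of "U\<^sup>T *\<^sub>v z"] UT z(1) by (metis mult_mat_vec_carrier scalar_prod_right_zero)
    then have "U\<^sup>T *\<^sub>v z = 0\<^sub>v m" using sp_self_eq_0[of "U\<^sup>T *\<^sub>v z"] U by simp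
    then show ?thesis using full_row_rank_transpose_inj[OF U z(1)] by simp
  qed
  then have "det S \<noteq> 0" unfolding det_0_iff_vec_prod_zero_field[OF S] by blast
  then have "S \<in> Units (ring_mat TYPE(real) r ())" by (rule det_non_zero_imp_unit[OF S])
  then obtain B where B: "B \<in> carrier_mat r r" "S * B = 1\<^sub>m r" by (auto simp: Units_def ring_mat_def)
  have Uu: "U *\<^sub>v u \<in> carrier_vec r" using U u by simp
  \<comment> \<open>Normal equations, with \<open>B\<close> the inverse of
    \<open>U U^T\<close>.\<close>
  define z where "z = B *\<^sub>v (U *\<^sub>v u)"
  have z: "z \<in> carrier_vec r" using B U u by (simp add: z_def)
  have UTz: "U\<^sup>T *\<^sub>v z \<in> carrier_vec m" using UT z by simp
  have "U *\<^sub>v (U\<^sup>T *\<^sub>v z) = S *\<^sub>v z" unfolding S_def using assoc_mult_mat_vec[OF U(1) UT z] by simp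
  also have "\<dots> = (S * B) *\<^sub>v (U *\<^sub>v u)" unfolding z_def using assoc_mult_mat_vec[OF S B(1) Uu] by simp
  also have "\<dots> = U *\<^sub>v u" using B(2) Uu by simp
  finally have "U *\<^sub>v (u - U\<^sup>T *\<^sub>v z) = 0\<^sub>v r"
    using mult_minus_distrib_mat_vec[OF U(1) u(1) UTz] Uu by simp
  then obtain c where c: "u - U\<^sup>T *\<^sub>v z = c \<cdot>\<^sub>v vec m (\<lambda>_. 1)" using null u UTz by (metis minus_carrier_vec)
  let ?o = "vec m (\<lambda>_. 1) :: real vec"
  have o: "?o \<in> carrier_vec m" by simp
  have "?o \<bullet> (U\<^sup>T *\<^sub>v z) = (U *\<^sub>v ?o) \<bullet> z" using sp_transpose[OF UT z o] by simp
  then have "?o \<bullet> (U\<^sup>T *\<^sub>v z) = 0" using one z by simp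
  moreover have "?o \<bullet> u = 0" using u by (simp add: scalar_prod_lessThan)
  moreover have "?o \<bullet> (u - U\<^sup>T *\<^sub>v z) = ?o \<bullet> u - ?o \<bullet> (U\<^sup>T *\<^sub>v z)" using u U by (intro sp_minus_right) auto
  ultimately have "?o \<bullet> (c \<cdot>\<^sub>v ?o) = 0" using c by simp
  then have "c = 0" using m by (simp add: scalar_prod_lessThan)
  then have "u - U\<^sup>T *\<^sub>v z = 0\<^sub>v m" unfolding c by auto
  then have "u = U\<^sup>T *\<^sub>v z" by (rule vec_eq_if_minus_zero[OF u(1) UTz])
  then show ?thesis using z by blast
qed

text \<open>\<open>V \<otimes> I\<close> acts on \<open>y\<close> as \<open>V\<close> acts on each of the component vectors \<open>comp_vec d n y c\<close>.\<close>

definition comp_vec :: "nat \<Rightarrow> nat \<Rightarrow> real vec \<Rightarrow> nat \<Rightarrow> real vec" where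
  "comp_vec d n y c = vec n (\<lambda>i. blk (\<lambda>_. d) i y $ c)"

lemma comp_vec_kron_one:
  assumes "V \<in> carrier_mat a b" "dim_vec y = b * d" "c < d"
  shows "comp_vec d a (kron V (1\<^sub>m d) *\<^sub>v y) c = V *\<^sub>v comp_vec d b y c"
proof (rule eq_vecI)
  fix j assume "j < dim_vec (V *\<^sub>v comp_vec d b y c)"
  then have "j < a" using assms by simp
  then show "comp_vec d a (kron V (1\<^sub>m d) *\<^sub>v y) c $ j = (V *\<^sub>v comp_vec d b y c) $ j"
    using assms blk_kron_one[OF assms(1,2) _ assms(3), of j] by (simp add: comp_vec_def scalar_prod_lessThan)
qed (use assms in \<open>simp add: comp_vec_def\<close>)

lemma comp_vec_carrier [simp]: "comp_vec d n y c \<in> carrier_vec n"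
  by (simp add: comp_vec_def)

lemma vec_eq_compI:
  assumes "dim_vec x = n * d" "dim_vec y = n * d" "\<And>c. c < d \<Longrightarrow> comp_vec d n x c = comp_vec d n y c"
  shows "x = y"
proof (rule vec_eq_blkI[of _ "\<lambda>_. d" n])
  fix i assume i: "i < n"
  show "blk (\<lambda>_. d) i x = blk (\<lambda>_. d) i y"
  proof (rule eq_vecI)
    fix c assume "c < dim_vec (blk (\<lambda>_. d) i y)"
    then have "c < d" by simp
    then show "blk (\<lambda>_. d) i x $ c = blk (\<lambda>_. d) i y $ c"
      using arg_cong[OF assms(3)[of c], of "\<lambda>v. v $ i"] i unfolding comp_vec_def by simp
  qed simp
qed (use assms in \<open>auto simp: offs_const\<close>)

lemma sp_comp_vec:
  assumes "dim_vec y = n * d"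
  shows "x \<bullet> y = (\<Sum>c<d. comp_vec d n x c \<bullet> comp_vec d n y c)"
proof -
  have "x \<bullet> y = (\<Sum>i<n. \<Sum>c<d. blk (\<lambda>_. d) i x $ c * blk (\<lambda>_. d) i y $ c)"
    using assms by (subst sp_blocks[of _ "\<lambda>_. d" n]) (auto simp: offs_const scalar_prod_lessThan)
  also have "\<dots> = (\<Sum>c<d. comp_vec d n x c \<bullet> comp_vec d n y c)"
    by (subst sum.swap) (simp add: comp_vec_def scalar_prod_lessThan)
  finally show ?thesis .
qed

lemma comp_vec_zero: "c < d \<Longrightarrow> comp_vec d n (0\<^sub>v (n * d)) c = 0\<^sub>v n"
  by (auto simp: comp_vec_def offs_const block_index_less)

text \<open>Injectivity makes the vector \<open>Z\<close> with \<open>\<Lambda> = U^T Z\<close>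
  unique, as its definite description requires.\<close>

lemma kron_transpose_inj:
  assumes U: "U \<in> carrier_mat r m" "full_row_rank U"
    and z: "z \<in> carrier_vec (r * d)" "z' \<in> carrier_vec (r * d)"
      "kron U\<^sup>T (1\<^sub>m d) *\<^sub>v z = kron U\<^sup>T (1\<^sub>m d) *\<^sub>v z'"
  shows "z = z'"
proof (rule vec_eq_compI[of _ r d])
  fix c assume c: "c < d"
  have UT: "U\<^sup>T \<in> carrier_mat m r" using U by simp
  define u where "u = comp_vec d r z c"
  define v where "v = comp_vec d r z' c"
  have uv: "u \<in> carrier_vec r" "v \<in> carrier_vec r" by (auto simp: u_def v_def)
  have "U\<^sup>T *\<^sub>v u = U\<^sup>T *\<^sub>v v"
    using comp_vec_kron_one[OF UT _ c, of z] comp_vec_kron_one[OF UT _ c, of z'] z by (simp add: u_def v_def)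
  then have "U\<^sup>T *\<^sub>v (u - v) = 0\<^sub>v m"
    using mult_minus_distrib_mat_vec[OF UT uv] mult_mat_vec_carrier[OF UT uv(2)] by simp
  then have uv0: "u - v = 0\<^sub>v r" using full_row_rank_transpose_inj[OF U, of "u - v"] uv by simp
  then have "u = v" by (rule vec_eq_if_minus_zero[OF uv])
  then show "comp_vec d r z c = comp_vec d r z' c" by (simp add: u_def v_def)
qed (use z in auto)

text \<open>Solved componentwise by \<open>transpose_range\<close> and reassembled into blocks; it
  provides the consensus multiplier of a zero.\<close>

lemma kron_transpose_range:
  assumes U: "U \<in> carrier_mat r m" "full_row_rank U"
    and null: "\<And>v. v \<in> carrier_vec m \<Longrightarrow> U *\<^sub>v v = 0\<^sub>v r \<Longrightarrow> \<exists>c. v = c \<cdot>\<^sub>v vec m (\<lambda>_. 1)"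
    and one: "U *\<^sub>v vec m (\<lambda>_. 1) = 0\<^sub>v r"
    and m: "m > 0" and u: "u \<in> carrier_vec (m * d)" "\<And>c. c < d \<Longrightarrow> (\<Sum>i<m. blk (\<lambda>_. d) i u $ c) = 0"
  shows "\<exists>z\<in>carrier_vec (r * d). kron U\<^sup>T (1\<^sub>m d) *\<^sub>v z = u"
proof -
  have UT: "U\<^sup>T \<in> carrier_mat m r" using U by simp
  have "\<exists>z\<in>carrier_vec r. U\<^sup>T *\<^sub>v z = comp_vec d m u c" if "c < d" for c
    using transpose_range[OF U null one m, of "comp_vec d m u c"] u(2)[OF that] by (simp add: comp_vec_def)
  then obtain zc where zc: "\<And>c. c < d \<Longrightarrow> zc c \<in> carrier_vec r" "\<And>c. c < d \<Longrightarrow> U\<^sup>T *\<^sub>v zc c = comp_vec d m u c"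
    by metis
  define z where "z = stack r (\<lambda>j. vec d (\<lambda>c. zc c $ j))"
  have dz: "dim_vec z = r * d"
    using dim_stack_offs[of r "\<lambda>j. vec d (\<lambda>c. zc c $ j)" "\<lambda>_. d"] by (simp add: z_def offs_const)
  have bz: "blk (\<lambda>_. d) j z = vec d (\<lambda>c. zc c $ j)" if "j < r" for j
    unfolding z_def using that by (intro blk_stack) auto
  have cz: "comp_vec d r z c = zc c" if "c < d" for c
  proof (rule eq_vecI)
    fix j assume "j < dim_vec (zc c)"
    then have "j < r" using zc(1)[OF that] by simp
    then show "comp_vec d r z c $ j = zc c $ j" using bz that by (simp add: comp_vec_def del: index_blk)
  qed (use zc(1)[OF that] in \<open>simp add: comp_vec_def\<close>)
  have "kron U\<^sup>T (1\<^sub>m d) *\<^sub>v z = u"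
  proof (rule vec_eq_compI[of _ m d])
    fix c assume c: "c < d"
    show "comp_vec d m (kron U\<^sup>T (1\<^sub>m d) *\<^sub>v z) c = comp_vec d m u c"
      unfolding comp_vec_kron_one[OF UT dz c] cz[OF c] zc(2)[OF c] ..
  qed (use kron_one_carrier[OF UT, of d] u in auto)
  then show ?thesis using dz carrier_vecI by blast
qed

text \<open>Consensus: each component vector is in the kernel of \<open>U\<close>, hence constant
  over the agents.\<close>

lemma kron_null:
  assumes U: "U \<in> carrier_mat r m"
    and null: "\<And>v. v \<in> carrier_vec m \<Longrightarrow> U *\<^sub>v v = 0\<^sub>v r \<Longrightarrow> \<exists>c. v = c \<cdot>\<^sub>v vec m (\<lambda>_. 1)"
    and y: "y \<in> carrier_vec (m * d)" "kron U (1\<^sub>m d) *\<^sub>v y = 0\<^sub>v (r * d)"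
  shows "\<exists>y0\<in>carrier_vec d. \<forall>i<m. blk (\<lambda>_. d) i y = y0"
proof -
  have "\<exists>a. comp_vec d m y c = a \<cdot>\<^sub>v vec m (\<lambda>_. 1)" if c: "c < d" for c
    using comp_vec_kron_one[OF U _ c, of y] y comp_vec_zero[OF c, of r] null[of "comp_vec d m y c"] by auto
  then obtain a where a: "\<And>c. c < d \<Longrightarrow> comp_vec d m y c = a c \<cdot>\<^sub>v vec m (\<lambda>_. 1)" by metis
  have "blk (\<lambda>_. d) i y = vec d a" if i: "i < m" for i
  proof (rule eq_vecI)
    fix c assume "c < dim_vec (vec d a)"
    then have c: "c < d" by simp
    have "blk (\<lambda>_. d) i y $ c = comp_vec d m y c $ i" using i by (simp add: comp_vec_def)
    then show "blk (\<lambda>_. d) i y $ c = vec d a $ c" using a[OF c] i c by simp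
  qed simp
  then show ?thesis by (meson vec_carrier)
qed

text \<open>The bound concerns \<open>U U^T\<close>, while \<open>lam_max\<close> belongs to
  \<open>U^T U\<close>. With \<open>w = U^T z\<close> one has \<open>|w|^2 = z . (U w)\<close> and
  \<open>|U w|^2 <= lam_max L |w|^2\<close>; Cauchy-Schwarz and cancelling one factor
  \<open>|w|^2\<close> transfer it.\<close>

lemma transpose_sq_le_lam_max:
  assumes U: "U \<in> carrier_mat r m" and L: "L = U\<^sup>T * U" and z: "z \<in> carrier_vec r" and lam: "0 \<le> lam_max L"
  shows "(U\<^sup>T *\<^sub>v z) \<bullet> (U\<^sup>T *\<^sub>v z) \<le> lam_max L * (z \<bullet> z)"
proof -
  have UT: "U\<^sup>T \<in> carrier_mat m r" using U by simp
  have Lc: "L \<in> carrier_mat m m" using U UT L by simp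
  have Ls: "L\<^sup>T = L" unfolding L using transpose_mult[OF UT U] by simp
  define w where "w = U\<^sup>T *\<^sub>v z"
  have w: "w \<in> carrier_vec m" using UT z by (simp add: w_def)
  have Uw: "U *\<^sub>v w \<in> carrier_vec r" using U w by simp
  have "(U *\<^sub>v w) \<bullet> (U *\<^sub>v w) = w \<bullet> (L *\<^sub>v w)"
    unfolding L assoc_mult_mat_vec[OF UT U w] using sp_transpose[OF UT Uw w] by simp
  also have "\<dots> \<le> lam_max L * (w \<bullet> w)" by (rule rayleigh_le_lam_max[OF Lc Ls w])
  finally have 1: "(vnorm (U *\<^sub>v w))\<^sup>2 \<le> lam_max L * (vnorm w)\<^sup>2" by (simp add: vnorm_sq)
  have "(vnorm w)\<^sup>2 = z \<bullet> (U *\<^sub>v w)"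
    using sp_transpose[OF U w z] by (simp add: vnorm_sq w_def)
  also have "\<dots> \<le> vnorm z * vnorm (U *\<^sub>v w)" using cauchy_schwarz_vec[of z "U *\<^sub>v w"] z U by simp
  finally have "((vnorm w)\<^sup>2)\<^sup>2 \<le> (vnorm z * vnorm (U *\<^sub>v w))\<^sup>2"
    by (intro power_mono) (auto simp: vnorm_sq sp_self_nonneg)
  also have "\<dots> \<le> (vnorm z)\<^sup>2 * (lam_max L * (vnorm w)\<^sup>2)"
    unfolding power_mult_distrib using 1 by (intro mult_left_mono) auto
  finally have 2: "(vnorm w)\<^sup>2 * (vnorm w)\<^sup>2 \<le> (lam_max L * (vnorm z)\<^sup>2) * (vnorm w)\<^sup>2"
    by (simp add: power2_eq_square algebra_simps)
  have "(vnorm w)\<^sup>2 \<le> lam_max L * (vnorm z)\<^sup>2"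
  proof (cases "vnorm w = 0")
    case False
    then have "0 < (vnorm w)\<^sup>2" by simp
    then show ?thesis using 2 mult_right_le_imp_le by blast
  qed (simp add: lam)
  then show ?thesis by (simp add: vnorm_sq w_def)
qed

lemma kron_transpose_sq_le_lam_max:
  assumes U: "U \<in> carrier_mat r m" and L: "L = U\<^sup>T * U" and z: "z \<in> carrier_vec (r * d)" and lam: "0 \<le> lam_max L"
  shows "(kron U\<^sup>T (1\<^sub>m d) *\<^sub>v z) \<bullet> (kron U\<^sup>T (1\<^sub>m d) *\<^sub>v z) \<le> lam_max L * (z \<bullet> z)"
proof -
  have UT: "U\<^sup>T \<in> carrier_mat m r" using U by simp
  have dz: "dim_vec z = r * d" using z by simp
  have dk: "dim_vec (kron U\<^sup>T (1\<^sub>m d) *\<^sub>v z) = m * d" using kron_one_carrier[OF UT, of d] by auto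
  have "(kron U\<^sup>T (1\<^sub>m d) *\<^sub>v z) \<bullet> (kron U\<^sup>T (1\<^sub>m d) *\<^sub>v z)
      = (\<Sum>c<d. (U\<^sup>T *\<^sub>v comp_vec d r z c) \<bullet> (U\<^sup>T *\<^sub>v comp_vec d r z c))"
    unfolding sp_comp_vec[OF dk] by (intro sum.cong) (simp_all add: comp_vec_kron_one[OF UT dz])
  also have "\<dots> \<le> (\<Sum>c<d. lam_max L * (comp_vec d r z c \<bullet> comp_vec d r z c))"
    by (intro sum_mono transpose_sq_le_lam_max[OF U L _ lam]) simp
  also have "\<dots> = lam_max L * (z \<bullet> z)" unfolding sp_comp_vec[OF dz] by (simp add: sum_distrib_left)
  finally show ?thesis .
qed

section \<open>Separable sums and stacked triples\<close>

lemma vsum_index [simp]: "c < d \<Longrightarrow> vsum d m F $ c = (\<Sum>i<m. F i $ c)"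
  by (simp add: vsum_def)

lemma dim_vsum [simp]: "dim_vec (vsum d m F) = d"
  by (simp add: vsum_def)

lemma sp_vsum_right: "y \<bullet> vsum d m F = (\<Sum>i<m. \<Sum>c<d. y $ c * F i $ c)"
  by (simp add: scalar_prod_lessThan sum_distrib_left sum.swap[of _ "{..<m}"])

lemma blk_convex_comb:
  assumes "x \<in> carrier_vec (offs ds m)" "y \<in> carrier_vec (offs ds m)" "i < m"
  shows "blk ds i (s \<cdot>\<^sub>v x + t \<cdot>\<^sub>v y) = s \<cdot>\<^sub>v blk ds i x + t \<cdot>\<^sub>v blk ds i y"
  using assms by (simp add: blk_add[of _ _ m] blk_smult[of _ _ m])

text \<open>Turns the separable data into one objective and one constraint map on the stacked space,
  where the multiplier lemma is applied.\<close>

lemma proper_closed_convex_sum_blk: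
  assumes "\<And>i. i < m \<Longrightarrow> proper_closed_convex (ds i) (h i)"
  shows "proper_closed_convex (offs ds m) (\<lambda>x. \<Sum>i<m. h i (blk ds i x))"
  unfolding proper_closed_convex_def
proof
  show "vconvex_fun (offs ds m) (\<lambda>x. \<Sum>i<m. h i (blk ds i x))"
    unfolding vconvex_fun_def
  proof (intro ballI allI impI)
    fix x y :: "real vec" and t :: real
    assume xy: "x \<in> carrier_vec (offs ds m)" "y \<in> carrier_vec (offs ds m)" and t: "0 \<le> t \<and> t \<le> 1"
    have "h i (blk ds i (t \<cdot>\<^sub>v x + (1 - t) \<cdot>\<^sub>v y)) \<le> t * h i (blk ds i x) + (1 - t) * h i (blk ds i y)" if "i < m" for i
      unfolding blk_convex_comb[OF xy that]
      using assms[OF that] t by (intro vconvex_funD[of "ds i"]) (auto simp: proper_closed_convex_def)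
    then have "(\<Sum>i<m. h i (blk ds i (t \<cdot>\<^sub>v x + (1 - t) \<cdot>\<^sub>v y)))
        \<le> (\<Sum>i<m. t * h i (blk ds i x) + (1 - t) * h i (blk ds i y))" by (intro sum_mono) auto
    then show "(\<Sum>i<m. h i (blk ds i (t \<cdot>\<^sub>v x + (1 - t) \<cdot>\<^sub>v y)))
        \<le> t * (\<Sum>i<m. h i (blk ds i x)) + (1 - t) * (\<Sum>i<m. h i (blk ds i y))"
      by (simp add: sum.distrib sum_distrib_left)
  qed
  show "vlsc (offs ds m) (\<lambda>x. \<Sum>i<m. h i (blk ds i x))"
  proof (rule vlscI)
    fix s x assume s: "\<And>k. s k \<in> carrier_vec (offs ds m)" "x \<in> carrier_vec (offs ds m)" "vconv s x"
    have "liminf_ge (\<lambda>k. h i (blk ds i (s k))) (h i (blk ds i x))" if "i < m" for i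
      using assms[OF that] s that
      by (intro vlscD[of "ds i"] vconv_blk[of _ _ _ m]) (auto simp: proper_closed_convex_def)
    then show "liminf_ge (\<lambda>k. \<Sum>i<m. h i (blk ds i (s k))) (\<Sum>i<m. h i (blk ds i x))"
      by (intro liminf_ge_sum) auto
  qed
qed

lemma vec_split3:
  assumes "x \<in> carrier_vec n1" "y \<in> carrier_vec n2" "z \<in> carrier_vec n3"
  shows "vec_first (x @\<^sub>v y @\<^sub>v z) n1 = x"
    "vec_first (vec_last (x @\<^sub>v y @\<^sub>v z) (n2 + n3)) n2 = y"
    "vec_last (x @\<^sub>v y @\<^sub>v z) n3 = z"
  using assms by (auto simp: vec_first_def vec_last_def)

lemma vec_split3_obtain:
  assumes "v \<in> carrier_vec (n1 + n2 + n3)"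
  obtains x y z where "x \<in> carrier_vec n1" "y \<in> carrier_vec n2" "z \<in> carrier_vec n3" "v = x @\<^sub>v y @\<^sub>v z"
proof
  have "vec_last v (n2 + n3) = vec_first (vec_last v (n2 + n3)) n2 @\<^sub>v vec_last (vec_last v (n2 + n3)) n3"
    by simp
  then show "v = vec_first v n1 @\<^sub>v vec_first (vec_last v (n2 + n3)) n2 @\<^sub>v vec_last (vec_last v (n2 + n3)) n3"
    using assms vec_first_last_append[of v n1 "n2 + n3"] by (simp add: add.assoc)
qed auto

lemma vclosedD: "vclosed d S \<Longrightarrow> vconv s l \<Longrightarrow> \<forall>k. s k \<in> S \<Longrightarrow> l \<in> S"
  by (simp add: vclosed_def)

lemma vnorm_blk_le:
  assumes "dim_vec x = offs ds m" "i < m"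
  shows "vnorm (blk ds i x) \<le> vnorm x"
proof -
  have "blk ds i x \<bullet> blk ds i x \<le> (\<Sum>i<m. blk ds i x \<bullet> blk ds i x)"
    using assms by (intro member_le_sum) (auto simp: sp_self_nonneg)
  then show ?thesis using sp_blocks[OF assms(1), of x] by (simp add: vnorm_def)
qed

section \<open>Zeros of the saddle operator\<close>

locale dpmm_problem =
  fixes m p q r :: nat
    and nd :: "nat \<Rightarrow> nat"
    and f :: "nat \<Rightarrow> real vec \<Rightarrow> real"
    and A :: "nat \<Rightarrow> real mat" and b :: "nat \<Rightarrow> real vec"
    and g :: "nat \<Rightarrow> real vec \<Rightarrow> real vec"
    and \<Omega> :: "nat \<Rightarrow> real vec set"
    and L U :: "real mat"
  assumes m2: "m \<ge> 2"
    and A_dim: "\<forall>i<m. A i \<in> carrier_mat p (nd i)"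
    and b_dim: "\<forall>i<m. b i \<in> carrier_vec p"
    and g_dim: "\<forall>i<m. \<forall>x\<in>carrier_vec (nd i). g i x \<in> carrier_vec q"
    and L_null: "{v \<in> carrier_vec m. L *\<^sub>v v = 0\<^sub>v m} = {c \<cdot>\<^sub>v vec m (\<lambda>_. 1) | c. True}"
    and U_dim: "U \<in> carrier_mat r m"
    and L_UU: "L = U\<^sup>T * U"
    and U_rank: "full_row_rank U"
    and U_one: "U *\<^sub>v vec m (\<lambda>_. 1) = 0\<^sub>v r"
    and f_cvx: "\<forall>i<m. proper_closed_convex (nd i) (f i)"
    and g_cvx: "\<forall>i<m. \<forall>c<q. proper_closed_convex (nd i) (\<lambda>x. g i x $ c)"
    and \<Omega>_closed: "\<forall>i<m. vclosed (nd i) (\<Omega> i)"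
    and \<Omega>_cvx: "\<forall>i<m. vconvex_set (nd i) (\<Omega> i)"
begin

abbreviation "G \<equiv> Gfun A b g"
abbreviation "pq \<equiv> p + q"
abbreviation "N \<equiv> offs nd m"
abbreviation "blx \<equiv> blk nd"
abbreviation "bly \<equiv> blk (\<lambda>_. pq)"
abbreviation "bU \<equiv> kron U (1\<^sub>m pq)"
abbreviation "bUT \<equiv> kron U\<^sup>T (1\<^sub>m pq)"

lemma UT_dim: "U\<^sup>T \<in> carrier_mat m r"
  using U_dim by simp

lemma bU_carrier: "bU \<in> carrier_mat (r * pq) (m * pq)"
  using U_dim by (rule kron_one_carrier)

lemma bUT_carrier: "bUT \<in> carrier_mat (m * pq) (r * pq)"
  using UT_dim by (rule kron_one_carrier)

lemma bU_transpose: "bU\<^sup>T = bUT"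
  using U_dim by (rule transpose_kron_one)

text \<open>\<open>L v = U^T (U v)\<close>, so the kernel of \<open>U\<close> lies in that of
  \<open>L\<close>.\<close>

lemma U_null: "v \<in> carrier_vec m \<Longrightarrow> U *\<^sub>v v = 0\<^sub>v r \<Longrightarrow> \<exists>c. v = c \<cdot>\<^sub>v vec m (\<lambda>_. 1)"
proof -
  assume v: "v \<in> carrier_vec m" "U *\<^sub>v v = 0\<^sub>v r"
  have "U\<^sup>T *\<^sub>v 0\<^sub>v r = 0\<^sub>v m" using U_dim by (intro eq_vecI) (auto simp: scalar_prod_right_zero)
  then have "L *\<^sub>v v = 0\<^sub>v m" unfolding L_UU assoc_mult_mat_vec[OF UT_dim U_dim v(1)] v(2) .
  then show ?thesis using L_null v by blast
qed

lemma \<Omega>_carrier: "i < m \<Longrightarrow> x \<in> \<Omega> i \<Longrightarrow> x \<in> carrier_vec (nd i)"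
  using \<Omega>_closed by (auto simp: vclosed_def)

lemma G_index_less: "i < m \<Longrightarrow> c < p \<Longrightarrow> G i x $ c = (A i *\<^sub>v x - b i) $ c"
  using b_dim by (auto simp: Gfun_def)

lemma G_index_ge:
  assumes "i < m" "x \<in> carrier_vec (nd i)" "p \<le> c" "c < pq"
  shows "G i x $ c = g i x $ (c - p)"
proof -
  have "dim_vec (b i) = p" "dim_vec (g i x) = q" using assms b_dim g_dim by (meson carrier_vecD)+
  then show ?thesis using assms by (simp add: Gfun_def)
qed

text \<open>The affine block gives equality and continuity, hence both signs of convexity and
  semicontinuity on the first \<open>p\<close> coordinates; the others inherit the hypotheses on
  \<open>g\<close>.\<close>

lemma G_K_convex:
  assumes i: "i < m"
  shows "K_convex p q (nd i) (G i)"
proof -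
  have Ai: "A i \<in> carrier_mat p (nd i)" and bi: "b i \<in> carrier_vec p" using A_dim b_dim i by auto
  have lo: "G i x $ c = row (A i) c \<bullet> x - b i $ c" if "c < p" for x c
    using that Ai bi by (simp add: G_index_less[OF i])
  have hi: "G i x $ c = g i x $ (c - p)" if "p \<le> c" "c < pq" "x \<in> carrier_vec (nd i)" for x c
    using that by (intro G_index_ge[OF i])
  have aff: "G i (t \<cdot>\<^sub>v x + (1 - t) \<cdot>\<^sub>v y) $ c = t * G i x $ c + (1 - t) * G i y $ c"
    if "c < p" "x \<in> carrier_vec (nd i)" "y \<in> carrier_vec (nd i)" for c x y t
    unfolding lo[OF that(1)] using that by (simp add: sp_simps algebra_simps)
  have lim: "(\<lambda>k. G i (s k) $ c) \<longlonglongrightarrow> G i x $ c"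
    if "c < p" "x \<in> carrier_vec (nd i)" "vconv s x" for c x s
    unfolding lo[OF that(1)] using that Ai by (intro tendsto_intros vconv_scalar_prod vconv_const) auto
  have "proper_closed_convex (nd i) (\<lambda>x. G i x $ c)" "proper_closed_convex (nd i) (\<lambda>x. - (G i x $ c))" if "c < p" for c
    using aff[OF that] lim[OF that] unfolding proper_closed_convex_def vconvex_fun_def
    by (auto intro!: vlscI liminf_ge_tendsto tendsto_minus simp: algebra_simps)
  moreover have "proper_closed_convex (nd i) (\<lambda>x. G i x $ c)" if c: "p \<le> c" "c < pq" for c
  proof -
    have "proper_closed_convex (nd i) (\<lambda>x. g i x $ (c - p))" using g_cvx i c by auto
    then have g: "vconvex_fun (nd i) (\<lambda>x. g i x $ (c - p))" "vlsc (nd i) (\<lambda>x. g i x $ (c - p))"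
      by (auto simp: proper_closed_convex_def)
    have "vconvex_fun (nd i) (\<lambda>x. G i x $ c)"
      using g(1) unfolding vconvex_fun_def by (simp add: hi[OF c])
    moreover have "vlsc (nd i) (\<lambda>x. G i x $ c)"
    proof (rule vlscI)
      fix s x assume "\<And>k. s k \<in> carrier_vec (nd i)" "x \<in> carrier_vec (nd i)" "vconv s x"
      then show "liminf_ge (\<lambda>k. G i (s k) $ c) (G i x $ c)"
        using vlscD[OF g(2), of s x] by (simp add: hi[OF c])
    qed
    ultimately show ?thesis by (simp add: proper_closed_convex_def)
  qed
  moreover have "G i x \<in> carrier_vec pq" if "x \<in> carrier_vec (nd i)" for x
    unfolding Gfun_def using that Ai bi g_dim i by (intro append_carrier_vec) auto
  ultimately show ?thesis unfolding K_convex_def by (meson not_less)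
qed

lemma G_carrier: "i < m \<Longrightarrow> x \<in> carrier_vec (nd i) \<Longrightarrow> G i x \<in> carrier_vec pq"
  using G_K_convex by (auto simp: K_convex_def)

section \<open>The saddle function on the extended reals\<close>

abbreviation "lag \<equiv> Lag m nd f A b g \<Omega> p q"
abbreviation "Phi0 \<equiv> PhiZero m nd f A b g \<Omega> p q U"

lemma ell_in: "x \<in> \<Omega> i \<Longrightarrow> y \<in> Kpol p q \<Longrightarrow> ell f A b g \<Omega> p q i x y = ereal (f i x + y \<bullet> G i x)"
  by (simp add: ell_def ind_def)

text \<open>In \<open>ereal\<close>, infinity minus infinity is infinity: leaving
  \<open>\<Omega> i\<close> dominates leaving the dual cone, whatever \<open>y\<close> is.\<close>

lemma ell_out_x: "x \<notin> \<Omega> i \<Longrightarrow> ell f A b g \<Omega> p q i x y = \<infinity>"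
  by (simp add: ell_def ind_def)

lemma ell_out_y: "x \<in> \<Omega> i \<Longrightarrow> y \<notin> Kpol p q \<Longrightarrow> ell f A b g \<Omega> p q i x y = - \<infinity>"
  by (simp add: ell_def ind_def)

lemma lag_in:
  assumes "\<forall>i<m. blx i x \<in> \<Omega> i \<and> bly i Y \<in> Kpol p q"
  shows "lag x Y = ereal (\<Sum>i<m. f i (blx i x) + bly i Y \<bullet> G i (blx i x))"
  using assms by (simp add: Lag_def ell_in)

lemma lag_out_x:
  assumes "i < m" "blx i x \<notin> \<Omega> i"
  shows "lag x Y = \<infinity>"
  using assms ell_out_x[of "blx i x" i "bly i Y"] by (auto simp: Lag_def sum_Pinfty)

lemma lag_out_y:
  assumes x: "\<forall>i<m. blx i x \<in> \<Omega> i" and i: "i < m" "bly i Y \<notin> Kpol p q"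
  shows "lag x Y = - \<infinity>"
proof -
  define t where "t j = ell f A b g \<Omega> p q j (blx j x) (bly j Y)" for j
  have "t j \<noteq> \<infinity>" if "j < m" for j
    using that x ell_in[of "blx j x" j "bly j Y"] ell_out_y[of "blx j x" j "bly j Y"] unfolding t_def by fastforce
  then have "(\<Sum>j\<in>{..<m} - {i}. t j) \<noteq> \<infinity>" by (auto simp: sum_Pinfty)
  moreover have "t i = - \<infinity>" using x i by (simp add: t_def ell_out_y)
  ultimately have "(\<Sum>j<m. t j) = - \<infinity>" using i(1) by (subst sum.remove[of _ i]) auto
  then show ?thesis by (simp add: Lag_def t_def)
qed

text \<open>\<open>esubdiff\<close> is empty where the function is infinite, so this is how
  membership in a subdifferential carries the constraints on both variables.\<close>

lemma lag_finite_iff: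
  "(lag x Y \<noteq> \<infinity> \<and> lag x Y \<noteq> - \<infinity>) \<longleftrightarrow> (\<forall>i<m. blx i x \<in> \<Omega> i \<and> bly i Y \<in> Kpol p q)"
proof (cases "\<forall>i<m. blx i x \<in> \<Omega> i")
  case True
  show ?thesis
  proof (cases "\<forall>i<m. bly i Y \<in> Kpol p q")
    case True
    then show ?thesis using \<open>\<forall>i<m. blx i x \<in> \<Omega> i\<close> lag_in[of x Y] by simp
  next
    case False
    then show ?thesis using \<open>\<forall>i<m. blx i x \<in> \<Omega> i\<close> lag_out_y[of x _ Y] by auto
  qed
next
  case False
  then show ?thesis using lag_out_x[of _ x Y] by auto
qed

text \<open>The saddle function is a sum over agents, so minimality may be tested one block at a
  time.\<close>

lemma zero_in_subdiff_x_iff: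
  assumes x: "x \<in> carrier_vec N"
  shows "0\<^sub>v N \<in> esubdiff N (\<lambda>x'. lag x' Y) x \<longleftrightarrow>
    (\<forall>i<m. blx i x \<in> \<Omega> i \<and> bly i Y \<in> Kpol p q \<and>
      (\<forall>x'\<in>\<Omega> i. f i (blx i x) + bly i Y \<bullet> G i (blx i x) \<le> f i x' + bly i Y \<bullet> G i x'))" (is "?L \<longleftrightarrow> ?R")
proof
  assume L: ?L
  then have feas: "\<forall>i<m. blx i x \<in> \<Omega> i \<and> bly i Y \<in> Kpol p q"
    unfolding esubdiff_def lag_finite_iff[symmetric] by blast
  have le: "lag x Y \<le> lag x' Y" if "x' \<in> carrier_vec N" for x'
  proof -
    have "0\<^sub>v N \<bullet> (x' - x) = 0" using that x by (intro scalar_prod_left_zero) auto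
    then show ?thesis using L that unfolding esubdiff_def by force
  qed
  have "f i (blx i x) + bly i Y \<bullet> G i (blx i x) \<le> f i x' + bly i Y \<bullet> G i x'" if i: "i < m" and x': "x' \<in> \<Omega> i" for i x'
  proof -
    define w where "w = stack m (\<lambda>j. if j = i then x' else blx j x)"
    have dims: "dim_vec (if j = i then x' else blx j x) = nd j" if "j < m" for j
      using that \<Omega>_carrier[OF i x'] by auto
    have w: "w \<in> carrier_vec N" unfolding w_def by (intro carrier_vecI dim_stack_offs dims)
    have bw: "blx j w = (if j = i then x' else blx j x)" if "j < m" for j
      unfolding w_def using that by (intro blk_stack dims)
    have "\<forall>j<m. blx j w \<in> \<Omega> j \<and> bly j Y \<in> Kpol p q" using feas bw x' by auto
    then have "(\<Sum>j<m. f j (blx j x) + bly j Y \<bullet> G j (blx j x)) \<le> (\<Sum>j<m. f j (blx j w) + bly j Y \<bullet> G j (blx j w))"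
      using le[OF w] lag_in feas by simp
    also have "\<dots> = (f i x' + bly i Y \<bullet> G i x') + (\<Sum>j\<in>{..<m} - {i}. f j (blx j x) + bly j Y \<bullet> G j (blx j x))"
      using i bw by (subst sum.remove[of _ i]) (auto intro!: sum.cong)
    finally show ?thesis using i by (subst (asm) sum.remove[of _ i]) auto
  qed
  then show ?R using feas by blast
next
  assume R: ?R
  then have feas: "\<forall>i<m. blx i x \<in> \<Omega> i \<and> bly i Y \<in> Kpol p q" by blast
  have "lag x Y + ereal (0\<^sub>v N \<bullet> (x' - x)) \<le> lag x' Y" if x': "x' \<in> carrier_vec N" for x'
  proof -
    have z: "0\<^sub>v N \<bullet> (x' - x) = 0" using that x by (intro scalar_prod_left_zero) auto
    show ?thesis
    proof (cases "\<forall>i<m. blx i x' \<in> \<Omega> i")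
      case True
      then show ?thesis using R lag_in[OF feas] lag_in[of x' Y] z by (auto intro!: sum_mono)
    next
      case False
      then show ?thesis using lag_out_x by auto
    qed
  qed
  then show ?L using x feas lag_finite_iff[of x Y] unfolding esubdiff_def by auto
qed

text \<open>For fixed feasible \<open>x\<close>, \<open>-lag\<close> is affine in \<open>Y\<close>
  on the product of the cones, with gradient \<open>-G\<close>. A subgradient \<open>s\<close> is
  therefore one for which \<open>G + s\<close> lies in the normal cone of each block.\<close>

lemma in_subdiff_Y_iff:
  assumes x: "x \<in> carrier_vec N" and Y: "Y \<in> carrier_vec (m * pq)" and s: "s \<in> carrier_vec (m * pq)"
  shows "s \<in> esubdiff (m * pq) (\<lambda>Y'. - lag x Y') Y \<longleftrightarrow>
    (\<forall>i<m. blx i x \<in> \<Omega> i \<and> bly i Y \<in> Kpol p q \<and>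
      (\<forall>y'\<in>Kpol p q. (y' - bly i Y) \<bullet> (G i (blx i x) + bly i s) \<le> 0))" (is "?L \<longleftrightarrow> ?R")
proof -
  have fin: "(- lag x Y \<noteq> \<infinity> \<and> - lag x Y \<noteq> - \<infinity>) \<longleftrightarrow> (\<forall>i<m. blx i x \<in> \<Omega> i \<and> bly i Y \<in> Kpol p q)"
    unfolding lag_finite_iff[symmetric] by (auto simp: ereal_uminus_eq_reorder)
  have sb: "s \<bullet> (Y' - Y) = (\<Sum>i<m. bly i s \<bullet> (bly i Y' - bly i Y))" if "Y' \<in> carrier_vec (m * pq)" for Y'
    using that Y s
    by (subst sp_blocks[of _ "\<lambda>_. pq" m]) (auto simp: blk_minus[of _ _ m] offs_const intro!: sum.cong)
  have key: "(- lag x Y + ereal (s \<bullet> (Y' - Y)) \<le> - lag x Y') \<longleftrightarrow>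
      (\<Sum>i<m. (bly i Y' - bly i Y) \<bullet> (G i (blx i x) + bly i s)) \<le> 0"
    if feas: "\<forall>i<m. blx i x \<in> \<Omega> i \<and> bly i Y \<in> Kpol p q" and Y': "Y' \<in> carrier_vec (m * pq)" "\<forall>i<m. bly i Y' \<in> Kpol p q" for Y'
  proof -
    have t: "(bly i Y' - bly i Y) \<bullet> (G i (blx i x) + bly i s) =
        (f i (blx i x) + bly i Y' \<bullet> G i (blx i x)) - (f i (blx i x) + bly i Y \<bullet> G i (blx i x)) + bly i s \<bullet> (bly i Y' - bly i Y)" if i: "i < m" for i
    proof -
      have dG: "dim_vec (G i (blx i x)) = pq" using G_carrier[OF i, of "blx i x"] by auto
      show ?thesis using sp_comm[of "bly i s" "bly i Y'"] sp_comm[of "bly i s" "bly i Y"] dG by (simp add: sp_simps)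
    qed
    have "(\<Sum>i<m. (bly i Y' - bly i Y) \<bullet> (G i (blx i x) + bly i s)) =
       (\<Sum>i<m. f i (blx i x) + bly i Y' \<bullet> G i (blx i x)) - (\<Sum>i<m. f i (blx i x) + bly i Y \<bullet> G i (blx i x)) + s \<bullet> (Y' - Y)"
      unfolding sb[OF Y'(1)] by (simp add: t sum.distrib sum_subtractf)
    then show ?thesis using lag_in[OF feas] lag_in[of x Y'] feas Y'(2) by auto
  qed
  show ?thesis
  proof
    assume L: ?L
    then have feas: "\<forall>i<m. blx i x \<in> \<Omega> i \<and> bly i Y \<in> Kpol p q"
      unfolding esubdiff_def fin[symmetric] by blast
    have "(y' - bly i Y) \<bullet> (G i (blx i x) + bly i s) \<le> 0" if i: "i < m" and y': "y' \<in> Kpol p q" for i y'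
    proof -
      define w where "w = stack m (\<lambda>j. if j = i then y' else bly j Y)"
      have dims: "dim_vec (if j = i then y' else bly j Y) = pq" if "j < m" for j
        using that dim_Kpol[OF y'] by auto
      have w: "w \<in> carrier_vec (m * pq)"
        unfolding w_def offs_const[symmetric] by (intro carrier_vecI dim_stack_offs dims)
      have bw: "bly j w = (if j = i then y' else bly j Y)" if "j < m" for j
        unfolding w_def using that by (intro blk_stack dims)
      have "\<forall>j<m. bly j w \<in> Kpol p q" using feas bw y' by auto
      then have "(\<Sum>j<m. (bly j w - bly j Y) \<bullet> (G j (blx j x) + bly j s)) \<le> 0"
        using key[OF feas w] L w unfolding esubdiff_def by blast
      moreover have "(\<Sum>j<m. (bly j w - bly j Y) \<bullet> (G j (blx j x) + bly j s)) = (y' - bly i Y) \<bullet> (G i (blx i x) + bly i s)"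
      proof -
        have "(bly j w - bly j Y) \<bullet> (G j (blx j x) + bly j s) = 0" if "j \<in> {..<m} - {i}" for j
          using that bw[of j] by (simp add: scalar_prod_lessThan)
        then show ?thesis using i bw[OF i] by (subst sum.remove[of _ i]) auto
      qed
      ultimately show ?thesis by simp
    qed
    then show ?R using feas by blast
  next
    assume R: ?R
    then have feas: "\<forall>i<m. blx i x \<in> \<Omega> i \<and> bly i Y \<in> Kpol p q" by blast
    have "- lag x Y + ereal (s \<bullet> (Y' - Y)) \<le> - lag x Y'" if Y': "Y' \<in> carrier_vec (m * pq)" for Y'
    proof (cases "\<forall>i<m. bly i Y' \<in> Kpol p q")
      case True
      then show ?thesis using R unfolding key[OF feas Y' True] by (intro sum_nonpos) auto
    next
      case False
      then have "lag x Y' = - \<infinity>" using lag_out_y feas by blast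
      then show ?thesis by simp
    qed
    then show ?L using Y s feas fin unfolding esubdiff_def by auto
  qed
qed

text \<open>The two negations of the Y-subdifferential cancel, so its condition says that
  \<open>-U^T Z\<close> is a subgradient of \<open>-lag\<close>. From here on zeros are handled
  through this agentwise system of inequalities.\<close>

lemma PhiZero_iff:
  assumes x: "x \<in> carrier_vec N" and Y: "Y \<in> carrier_vec (m * pq)" and Z: "Z \<in> carrier_vec (r * pq)"
  shows "x @\<^sub>v Y @\<^sub>v Z \<in> Phi0 \<longleftrightarrow>
    (\<forall>i<m. blx i x \<in> \<Omega> i \<and> bly i Y \<in> Kpol p q \<and>
      (\<forall>x'\<in>\<Omega> i. f i (blx i x) + bly i Y \<bullet> G i (blx i x) \<le> f i x' + bly i Y \<bullet> G i x') \<and>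
      (\<forall>y'\<in>Kpol p q. (y' - bly i Y) \<bullet> (G i (blx i x) - bly i (bUT *\<^sub>v Z)) \<le> 0)) \<and>
    bU *\<^sub>v Y = 0\<^sub>v (r * pq)" (is "?L \<longleftrightarrow> ?R")
proof -
  define \<Lambda> where "\<Lambda> = bUT *\<^sub>v Z"
  have \<Lambda>: "\<Lambda> \<in> carrier_vec (m * pq)" unfolding \<Lambda>_def using bUT_carrier Z by simp
  have m\<Lambda>: "- \<Lambda> \<in> carrier_vec (m * pq)" using \<Lambda> by simp
  have dr: "dim_row U = r" using U_dim by simp
  have carr: "x @\<^sub>v Y @\<^sub>v Z \<in> carrier_vec (N + m * pq + r * pq)"
    using append_carrier_vec[OF x append_carrier_vec[OF Y Z]] by (simp add: add.assoc)
  have one: "(0\<^sub>v (m * pq) \<in> (\<lambda>s. s + \<Lambda>) ` ((\<lambda>s. - s) ` ((\<lambda>s. - s) ` S))) \<longleftrightarrow> - \<Lambda> \<in> S"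
    if "S \<subseteq> carrier_vec (m * pq)" for S
  proof
    assume "0\<^sub>v (m * pq) \<in> (\<lambda>s. s + \<Lambda>) ` ((\<lambda>s. - s) ` ((\<lambda>s. - s) ` S))"
    then obtain s where s: "s \<in> S" "0\<^sub>v (m * pq) = s + \<Lambda>" by auto
    have sc: "s \<in> carrier_vec (m * pq)" using s that by auto
    have "s = - \<Lambda>"
    proof (rule eq_vecI)
      fix c assume "c < dim_vec (- \<Lambda>)"
      then have c: "c < m * pq" using \<Lambda> by simp
      have "(s + \<Lambda>) $ c = 0" unfolding s(2)[symmetric] using c by simp
      then show "s $ c = (- \<Lambda>) $ c" using c \<Lambda> by simp
    qed (use sc \<Lambda> in simp)
    then show "- \<Lambda> \<in> S" using s by simp
  next
    assume "- \<Lambda> \<in> S"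
    then show "0\<^sub>v (m * pq) \<in> (\<lambda>s. s + \<Lambda>) ` ((\<lambda>s. - s) ` ((\<lambda>s. - s) ` S))"
      using \<Lambda> by (intro image_eqI[of _ _ "- \<Lambda>"] image_eqI[of _ _ "\<Lambda>"]) auto
  qed
  have sub: "esubdiff (m * pq) F Y \<subseteq> carrier_vec (m * pq)" for F by (auto simp: esubdiff_def)
  have neg: "bly i (- \<Lambda>) = - bly i \<Lambda>" if "i < m" for i
    using that \<Lambda> offs_less[of i m _ "\<lambda>_. pq"] by (auto simp: offs_const)
  have last: "0\<^sub>v (r * pq) = - (bU *\<^sub>v Y) \<longleftrightarrow> bU *\<^sub>v Y = 0\<^sub>v (r * pq)"
  proof -
    have "bU *\<^sub>v Y \<in> carrier_vec (r * pq)" using bU_carrier Y by simp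
    then show ?thesis by (metis uminus_uminus_vec uminus_zero_vec)
  qed
  have Gm: "G i (blx i x) + bly i (- \<Lambda>) = G i (blx i x) - bly i \<Lambda>" if "i < m" for i
    unfolding neg[OF that] using G_carrier[OF that, of "blx i x"] by (intro eq_vecI) auto
  have "?L \<longleftrightarrow> 0\<^sub>v N \<in> esubdiff N (\<lambda>x'. lag x' Y) x \<and>
      - \<Lambda> \<in> esubdiff (m * pq) (\<lambda>Y'. - lag x Y') Y \<and> bU *\<^sub>v Y = 0\<^sub>v (r * pq)"
    unfolding PhiZero_def Let_def dr offs_def[of nd m, symmetric] mem_Collect_eq vec_split3[OF x Y Z] bU_transpose \<Lambda>_def[symmetric]
      one[OF sub] last using carr by simp
  also have "\<dots> \<longleftrightarrow> ?R"
    unfolding zero_in_subdiff_x_iff[OF x] in_subdiff_Y_iff[OF x Y m\<Lambda>] \<Lambda>_def[symmetric] using Gm by auto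
  finally show ?thesis .
qed


text \<open>The range of \<open>U^T\<close> is orthogonal to the kernel of \<open>U\<close>, which
  contains the all-ones vector.\<close>

lemma sum_bly_bUT:
  assumes Z: "Z \<in> carrier_vec (r * pq)" and c: "c < pq"
  shows "(\<Sum>i<m. bly i (bUT *\<^sub>v Z) $ c) = 0"
proof -
  have dZ: "dim_vec Z = r * pq" using Z by simp
  let ?o = "vec m (\<lambda>_. 1) :: real vec"
  have "(\<Sum>i<m. bly i (bUT *\<^sub>v Z) $ c) = ?o \<bullet> comp_vec pq m (bUT *\<^sub>v Z) c"
    by (simp add: comp_vec_def scalar_prod_lessThan)
  also have "\<dots> = ?o \<bullet> (U\<^sup>T *\<^sub>v comp_vec pq r Z c)" unfolding comp_vec_kron_one[OF UT_dim dZ c] ..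
  also have "\<dots> = (U *\<^sub>v ?o) \<bullet> comp_vec pq r Z c" using sp_transpose[OF UT_dim, of "comp_vec pq r Z c" ?o] by simp
  also have "\<dots> = 0" unfolding U_one by (intro scalar_prod_left_zero) simp
  finally show ?thesis .
qed

text \<open>Consensus makes all blocks of \<open>Y\<close> equal, and summing the agentwise
  conditions cancels the blocks of \<open>\<Lambda>\<close>; what is left is the KKT system of (P),
  from which both optimalities follow by weak duality.\<close>

lemma PhiZero_optimal:
  assumes x: "x \<in> carrier_vec N" and Y: "Y \<in> carrier_vec (m * pq)" and Z: "Z \<in> carrier_vec (r * pq)"
    and zero: "x @\<^sub>v Y @\<^sub>v Z \<in> Phi0"
  shows "optimalP m nd f A b g \<Omega> p q x"
    "\<exists>y. Y = stack m (\<lambda>_. y) \<and> optimalD m nd f A b g \<Omega> p q y"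
proof -
  define \<Lambda> where "\<Lambda> = bUT *\<^sub>v Z"
  have \<Phi>: "\<And>i. i < m \<Longrightarrow> blx i x \<in> \<Omega> i" "\<And>i. i < m \<Longrightarrow> bly i Y \<in> Kpol p q"
    "\<And>i x'. i < m \<Longrightarrow> x' \<in> \<Omega> i \<Longrightarrow> f i (blx i x) + bly i Y \<bullet> G i (blx i x) \<le> f i x' + bly i Y \<bullet> G i x'"
    "\<And>i y'. i < m \<Longrightarrow> y' \<in> Kpol p q \<Longrightarrow> (y' - bly i Y) \<bullet> (G i (blx i x) - bly i \<Lambda>) \<le> 0"
    and UY: "bU *\<^sub>v Y = 0\<^sub>v (r * pq)"
    using zero unfolding PhiZero_iff[OF x Y Z] \<Lambda>_def by blast+
  obtain y where y: "y \<in> carrier_vec pq" "\<And>i. i < m \<Longrightarrow> bly i Y = y"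
    using kron_null[OF U_dim U_null Y UY] by blast
  have m0: "0 < m" using m2 by simp
  have yK: "y \<in> Kpol p q" using \<Phi>(2)[OF m0] y(2)[OF m0] by simp
  have Ys: "Y = stack m (\<lambda>_. y)"
    using stack_blk[of Y "\<lambda>_. pq" m] stack_cong[of m "\<lambda>i. bly i Y" "\<lambda>_. y"] y(2) Y by (simp add: offs_const)
  define S where "S = vsum pq m (\<lambda>i. G i (blx i x))"
  have S: "S \<in> carrier_vec pq" by (rule carrier_vecI) (simp add: S_def)
  have sumG: "(\<Sum>i<m. w \<bullet> G i (blx i x')) = w \<bullet> vsum pq m (\<lambda>i. G i (blx i x'))" for w x'
    unfolding sp_vsum_right by (intro sum.cong) (auto simp: scalar_prod_lessThan carrier_vecD[OF G_carrier])
  have comp: "(y' - y) \<bullet> S \<le> 0" if y': "y' \<in> Kpol p q" for y'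
  proof -
    have "(\<Sum>i<m. (y' - y) \<bullet> bly i \<Lambda>) = (y' - y) \<bullet> vsum pq m (\<lambda>i. bly i \<Lambda>)"
      unfolding sp_vsum_right by (simp add: scalar_prod_lessThan)
    also have "vsum pq m (\<lambda>i. bly i \<Lambda>) = 0\<^sub>v pq" using sum_bly_bUT[OF Z] by (intro eq_vecI) (auto simp: \<Lambda>_def)
    also have "(y' - y) \<bullet> 0\<^sub>v pq = 0" using y y' by (intro scalar_prod_right_zero) (auto simp: Kpol_def)
    finally have "(\<Sum>i<m. (y' - y) \<bullet> bly i \<Lambda>) = 0" .
    moreover have "(y' - y) \<bullet> (G i (blx i x) - bly i \<Lambda>) = (y' - y) \<bullet> G i (blx i x) - (y' - y) \<bullet> bly i \<Lambda>" if "i < m" for i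
      using G_carrier[OF that, of "blx i x"] by (intro sp_minus_right) auto
    then have "(\<Sum>i<m. (y' - y) \<bullet> (G i (blx i x) - bly i \<Lambda>)) = (\<Sum>i<m. (y' - y) \<bullet> G i (blx i x)) - (\<Sum>i<m. (y' - y) \<bullet> bly i \<Lambda>)"
      by (simp add: sum_subtractf)
    ultimately have "(y' - y) \<bullet> S = (\<Sum>i<m. (y' - y) \<bullet> (G i (blx i x) - bly i \<Lambda>))" by (simp add: sumG S_def)
    also have "\<dots> \<le> 0" using \<Phi>(4)[OF _ y'] y(2) by (intro sum_nonpos) auto
    finally show ?thesis .
  qed
  have dS: "dim_vec S = pq" "dim_vec y = pq" using S y by auto
  have SK: "S \<in> Kcone p q"
  proof (rule Kcone_if_polar[OF S])
    fix w assume w: "w \<in> Kpol p q"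
    \<comment> \<open>In a cone \<open>y + w\<close> is an admissible test, which turns the
      variational inequality into polarity; the test 0 further down gives complementarity.\<close>
    then have "y + w \<in> Kpol p q" using yK by (auto simp: Kpol_def)
    from comp[OF this] show "w \<bullet> S \<le> 0" using w dim_Kpol[OF w] dS by (simp add: sp_simps)
  qed
  have "0\<^sub>v pq \<in> Kpol p q" by (auto simp: Kpol_def)
  from comp[OF this] have "0 \<le> y \<bullet> S" using dS scalar_prod_left_zero[OF S] by (simp add: sp_simps)
  then have yS: "y \<bullet> S = 0" using Kpol_Kcone_nonpos[OF yK SK] by simp
  have feas: "feasibleP m nd A b g \<Omega> p q x"
    unfolding feasibleP_def offs_def[symmetric] using x \<Phi>(1) SK by (simp add: S_def)
  have val: "(\<Sum>i<m. f i (blx i x) + y \<bullet> G i (blx i x)) = (\<Sum>i<m. f i (blx i x))"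
    using yS by (simp add: sum.distrib sumG S_def)
  have min: "(\<Sum>i<m. f i (blx i x)) \<le> (\<Sum>i<m. f i (w i) + y \<bullet> G i (w i))" if "\<And>i. i < m \<Longrightarrow> w i \<in> \<Omega> i" for w
    unfolding val[symmetric] using \<Phi>(3) y(2) that by (intro sum_mono) fastforce
  show "optimalP m nd f A b g \<Omega> p q x"
    unfolding optimalP_def
  proof (intro conjI allI impI feas)
    fix x' assume "feasibleP m nd A b g \<Omega> p q x'"
    then have x': "vsum pq m (\<lambda>i. G i (blx i x')) \<in> Kcone p q" "\<And>i. i < m \<Longrightarrow> blx i x' \<in> \<Omega> i"
      by (auto simp: feasibleP_def)
    have "(\<Sum>i<m. f i (blx i x)) \<le> (\<Sum>i<m. f i (blx i x') + y \<bullet> G i (blx i x'))" using x'(2) by (rule min)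
    also have "\<dots> \<le> (\<Sum>i<m. f i (blx i x'))" using Kpol_Kcone_nonpos[OF yK x'(1)] by (simp add: sum.distrib sumG)
    finally show "(\<Sum>i<m. f i (blx i x)) \<le> (\<Sum>i<m. f i (blx i x'))" .
  qed
  have "optimalD m nd f A b g \<Omega> p q y"
    unfolding optimalD_def
  proof (intro conjI ballI y(1))
    \<comment> \<open>The dual value at \<open>y'\<close> is at most the saddle value at
      \<open>x\<close>, this at most the primal value, and this at most the dual value at
      \<open>y\<close>.\<close>
    fix y' :: "real vec" assume y': "y' \<in> carrier_vec pq"
    let ?e = "ell f A b g \<Omega> p q"
    have "ereal (\<Sum>i<m. f i (blx i x)) = (\<Sum>i<m. ereal (f i (blx i x) + y \<bullet> G i (blx i x)))" using val by simp
    also have "\<dots> \<le> dualfun m nd f A b g \<Omega> p q y"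
      unfolding dualfun_def
    proof (intro sum_mono INF_greatest)
      fix i xi assume "i \<in> {..<m}"
      then have i: "i < m" by simp
      show "ereal (f i (blx i x) + y \<bullet> G i (blx i x)) \<le> ?e i xi y"
      proof (cases "xi \<in> \<Omega> i")
        case True
        then show ?thesis using \<Phi>(3)[OF i True] y(2)[OF i] yK by (simp add: ell_in)
      qed (simp add: ell_out_x)
    qed
    finally have lower: "ereal (\<Sum>i<m. f i (blx i x)) \<le> dualfun m nd f A b g \<Omega> p q y" .
    have "dualfun m nd f A b g \<Omega> p q y' \<le> lag x (stack m (\<lambda>_. y'))"
    proof -
      have "bly i (stack m (\<lambda>_. y')) = y'" if "i < m" for i using that y' by (intro blk_stack) auto
      then show ?thesis unfolding dualfun_def Lag_def by (auto intro!: sum_mono INF_lower)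
    qed
    also have "\<dots> \<le> ereal (\<Sum>i<m. f i (blx i x))"
    proof (cases "y' \<in> Kpol p q")
      case True
      have b: "bly i (stack m (\<lambda>_. y')) = y'" if "i < m" for i using that y' by (intro blk_stack) auto
      have "lag x (stack m (\<lambda>_. y')) = ereal (\<Sum>i<m. f i (blx i x) + y' \<bullet> G i (blx i x))"
        using True \<Phi>(1) b lag_in[of x "stack m (\<lambda>_. y')"] by simp
      then show ?thesis using Kpol_Kcone_nonpos[OF True SK] by (simp add: sum.distrib sumG S_def)
    next
      case False
      have b: "bly 0 (stack m (\<lambda>_. y')) = y'" using m0 y' by (intro blk_stack) auto
      \<comment> \<open>One agent with an inadmissible multiplier already gives minus infinity;
        agent 0 exists because \<open>m >= 2\<close>.\<close>
      show ?thesis using lag_out_y[of x 0 "stack m (\<lambda>_. y')"] False b m0 \<Phi>(1) by simp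
    qed
    finally show "dualfun m nd f A b g \<Omega> p q y' \<le> dualfun m nd f A b g \<Omega> p q y" using lower by (rule order_trans)
  qed
  then show "\<exists>y. Y = stack m (\<lambda>_. y) \<and> optimalD m nd f A b g \<Omega> p q y" using Ys by blast
qed

text \<open>Solvability and Slater's condition enter through \<open>slater_multiplier\<close>,
  applied to the aggregate problem on the stacked space; the multiplier is then copied to all
  agents.\<close>

lemma PhiZero_nonempty:
  assumes solvable: "\<exists>x. optimalP m nd f A b g \<Omega> p q x"
    and slater: "\<exists>xb. (\<forall>i<m. xb i \<in> vinterior (nd i) (\<Omega> i)) \<and>
                   vsum p m (\<lambda>i. A i *\<^sub>v xb i - b i) = 0\<^sub>v p \<and>
                   (\<forall>c<q. (\<Sum>i<m. g i (xb i) $ c) < 0)"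
  shows "\<exists>x\<in>carrier_vec N. \<exists>Y\<in>carrier_vec (m * pq). \<exists>Z\<in>carrier_vec (r * pq). x @\<^sub>v Y @\<^sub>v Z \<in> Phi0"
proof -
  obtain x where opt: "optimalP m nd f A b g \<Omega> p q x" using solvable by blast
  obtain xb where xb: "\<And>i. i < m \<Longrightarrow> xb i \<in> vinterior (nd i) (\<Omega> i)"
    "vsum p m (\<lambda>i. A i *\<^sub>v xb i - b i) = 0\<^sub>v p" "\<And>c. c < q \<Longrightarrow> (\<Sum>i<m. g i (xb i) $ c) < 0" using slater by blast
  have m0: "0 < m" using m2 by simp
  define F where "F w = (\<Sum>i<m. f i (blx i w))" for w
  define GG where "GG w = vsum pq m (\<lambda>i. G i (blx i w))" for w
  define C where "C = {w \<in> carrier_vec N. \<forall>i<m. blx i w \<in> \<Omega> i}"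
  have x: "x \<in> carrier_vec N" "x \<in> C" "GG x \<in> Kcone p q"
    using opt by (auto simp: optimalP_def feasibleP_def offs_def C_def GG_def)
  have Ocl: "vclosed N C" unfolding vclosed_def
  proof (intro conjI allI impI)
    fix s l assume s: "\<forall>k. s k \<in> C" "vconv s l"
    have l: "l \<in> carrier_vec N" using s unfolding C_def vconv_def by (metis (mono_tags, lifting) carrier_vecD carrier_vecI mem_Collect_eq)
    have "blx i l \<in> \<Omega> i" if i: "i < m" for i
    proof -
      have "vconv (\<lambda>k. blx i (s k)) (blx i l)" using s(2) l i by (intro vconv_blk) auto
      moreover have "\<forall>k. blx i (s k) \<in> \<Omega> i" using s i by (auto simp: C_def)
      ultimately show ?thesis by (rule vclosedD[OF \<Omega>_closed[rule_format, OF i]])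
    qed
    then show "l \<in> C" using l by (simp add: C_def)
  qed (auto simp: C_def)
  have Ocv: "vconvex_set N C" unfolding vconvex_set_def
  proof (intro conjI ballI allI impI)
    fix u v and t :: real assume uv: "u \<in> C" "v \<in> C" and t: "0 \<le> t \<and> t \<le> 1"
    have c: "u \<in> carrier_vec N" "v \<in> carrier_vec N" using uv by (auto simp: C_def)
    have "blx i (t \<cdot>\<^sub>v u + (1 - t) \<cdot>\<^sub>v v) \<in> \<Omega> i" if i: "i < m" for i
      unfolding blk_convex_comb[OF c i] using \<Omega>_cvx i uv t by (auto simp: C_def vconvex_set_def)
    then show "t \<cdot>\<^sub>v u + (1 - t) \<cdot>\<^sub>v v \<in> C" using c by (simp add: C_def)
  qed (auto simp: C_def)
  have Fc: "proper_closed_convex N F"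
    unfolding F_def using f_cvx by (intro proper_closed_convex_sum_blk) auto
  have GGc: "K_convex p q N GG"
    unfolding K_convex_def
  proof (intro conjI ballI allI impI)
    show "GG w \<in> carrier_vec pq" for w by (rule carrier_vecI) (simp add: GG_def)
    fix c assume c: "c < pq"
    have "proper_closed_convex N (\<lambda>w. \<Sum>i<m. G i (blx i w) $ c)"
      using c G_K_convex unfolding K_convex_def
      by (intro proper_closed_convex_sum_blk[where h = "\<lambda>i x. G i x $ c"]) auto
    then show "proper_closed_convex N (\<lambda>w. GG w $ c)" using c by (simp add: GG_def)
  next
    fix c assume c: "c < p"
    have "proper_closed_convex N (\<lambda>w. \<Sum>i<m. - (G i (blx i w) $ c))"
      using c G_K_convex unfolding K_convex_def
      by (intro proper_closed_convex_sum_blk[where h = "\<lambda>i x. - (G i x $ c)"]) auto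
    then show "proper_closed_convex N (\<lambda>w. - (GG w $ c))" using c by (simp add: GG_def sum_negf)
  qed
  define xs where "xs = stack m xb"
  have xbc: "xb i \<in> carrier_vec (nd i)" if "i < m" for i using xb(1)[OF that] by (simp add: vinterior_def)
  have dxb: "dim_vec (xb i) = nd i" if "i < m" for i using xbc[OF that] by simp
  have xsc: "xs \<in> carrier_vec N" unfolding xs_def by (intro carrier_vecI dim_stack_offs dxb)
  have bxs: "blx i xs = xb i" if "i < m" for i unfolding xs_def using that by (intro blk_stack dxb)
  have xsi: "xs \<in> vinterior N C"
  proof -
    have "\<exists>e>0. \<forall>w\<in>carrier_vec (nd i). vnorm (w - xb i) < e \<longrightarrow> w \<in> \<Omega> i" if "i < m" for i
      using xb(1)[OF that] by (auto simp: vinterior_def)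
    then obtain e where e: "\<And>i. i < m \<Longrightarrow> 0 < e i"
      "\<And>i w. i < m \<Longrightarrow> w \<in> carrier_vec (nd i) \<Longrightarrow> vnorm (w - xb i) < e i \<Longrightarrow> w \<in> \<Omega> i" by metis
    \<comment> \<open>A ball around the stacked point projects into a ball of the same radius in
      each block, so the least of the radii works.\<close>
    define E where "E = Min (e ` {..<m})"
    have E: "0 < E" unfolding E_def using m0 e(1) by (subst Min_gr_iff) auto
    have Ei: "E \<le> e i" if "i < m" for i unfolding E_def using that by (intro Min_le) auto
    have "w \<in> C" if w: "w \<in> carrier_vec N" "vnorm (w - xs) < E" for w
    proof -
      have "blx i w \<in> \<Omega> i" if i: "i < m" for i
      proof (rule e(2)[OF i])
        have "vnorm (blx i w - xb i) = vnorm (blx i (w - xs))"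
          using bxs[OF i] blk_minus[of xs nd m i w] xsc i by simp
        also have "\<dots> \<le> vnorm (w - xs)" using xsc i by (intro vnorm_blk_le) auto
        finally show "vnorm (blx i w - xb i) < e i" using w(2) Ei[OF i] by simp
      qed simp
      then show ?thesis using w by (simp add: C_def)
    qed
    then show ?thesis using xsc E unfolding vinterior_def by blast
  qed
  have "\<exists>y\<in>Kpol p q. \<forall>w\<in>C. F x \<le> F w + y \<bullet> GG w"
  proof (rule slater_multiplier[OF Ocl Ocv Fc GGc x(2,3) _ xsi])
    fix w assume "w \<in> C" "GG w \<in> Kcone p q"
    then have "feasibleP m nd A b g \<Omega> p q w" by (simp add: feasibleP_def C_def GG_def offs_def)
    then show "F x \<le> F w" using opt by (simp add: optimalP_def F_def)
  next
    fix c assume c: "c < p"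
    have "GG xs $ c = vsum p m (\<lambda>i. A i *\<^sub>v xb i - b i) $ c"
      using c bxs G_index_less by (simp add: GG_def del: index_minus_vec)
    then show "GG xs $ c = 0" using xb(2) c by simp
  next
    fix c assume c: "p \<le> c" "c < pq"
    have "GG xs $ c = (\<Sum>i<m. g i (xb i) $ (c - p))" using c bxs G_index_ge xbc by (simp add: GG_def)
    then show "GG xs $ c < 0" using xb(3)[of "c - p"] c by simp
  qed
  then obtain y where yK: "y \<in> Kpol p q" and y: "\<And>w. w \<in> C \<Longrightarrow> F x \<le> F w + y \<bullet> GG w" by blast
  have yS: "y \<bullet> GG x = 0" using y[OF x(2)] Kpol_Kcone_nonpos[OF yK x(3)] by simp
  have dy: "dim_vec y = pq" using dim_Kpol[OF yK] .
  have sumG: "(\<Sum>i<m. y \<bullet> G i (blx i w)) = y \<bullet> GG w" for w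
    unfolding GG_def sp_vsum_right by (intro sum.cong) (auto simp: scalar_prod_lessThan carrier_vecD[OF G_carrier])
  define Y where "Y = stack m (\<lambda>_. y)"
  have Y: "Y \<in> carrier_vec (m * pq)" unfolding Y_def offs_const[symmetric] by (intro carrier_vecI dim_stack_offs dy)
  have bY: "bly i Y = y" if "i < m" for i unfolding Y_def using that dy by (intro blk_stack) auto
  \<comment> \<open>With the mean subtracted, the blocks of \<open>\<Lambda>\<close> sum to 0, hence
    \<open>\<Lambda>\<close> lies in the range of \<open>U^T\<close>; and every agent keeps the same
    residual \<open>S\<close>, which is in \<open>Kcone\<close> and orthogonal to \<open>y\<close>,
    as the normal-cone inequality needs.\<close>
  define S where "S = (1 / real m) \<cdot>\<^sub>v GG x"
  have S: "S \<in> Kcone p q" "S \<in> carrier_vec pq" "y \<bullet> S = 0"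
    using x(3) yS m0 by (auto simp: S_def Kcone_def sp_smult_right divide_nonpos_nonneg)
  define \<Lambda> where "\<Lambda> = stack m (\<lambda>i. G i (blx i x) - S)"
  have d\<Lambda>: "dim_vec (G i (blx i x) - S) = pq" if "i < m" for i using S by simp
  have \<Lambda>: "\<Lambda> \<in> carrier_vec (m * pq)" unfolding \<Lambda>_def offs_const[symmetric] by (intro carrier_vecI dim_stack_offs d\<Lambda>)
  have b\<Lambda>: "bly i \<Lambda> = G i (blx i x) - S" if "i < m" for i unfolding \<Lambda>_def using that by (intro blk_stack d\<Lambda>)
  have "(\<Sum>i<m. bly i \<Lambda> $ c) = 0" if c: "c < pq" for c
  proof -
    have "(\<Sum>i<m. bly i \<Lambda> $ c) = (\<Sum>i<m. G i (blx i x) $ c - S $ c)"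
      using b\<Lambda> c S by (intro sum.cong) (auto simp del: index_blk)
    also have "\<dots> = GG x $ c - real m * S $ c" using c by (simp add: GG_def sum_subtractf)
    also have "\<dots> = 0" using m0 c by (simp add: S_def GG_def)
    finally show ?thesis .
  qed
  then obtain Z where Z: "Z \<in> carrier_vec (r * pq)" "bUT *\<^sub>v Z = \<Lambda>"
    using kron_transpose_range[OF U_dim U_rank U_null U_one m0 \<Lambda>] by blast
  have "x @\<^sub>v Y @\<^sub>v Z \<in> Phi0"
    unfolding PhiZero_iff[OF x(1) Y Z(1)] Z(2)
  proof (intro conjI allI impI ballI)
    fix i assume i: "i < m"
    show "blx i x \<in> \<Omega> i" using x(2) i by (simp add: C_def)
    show "bly i Y \<in> Kpol p q" using bY[OF i] yK by simp
    show "f i (blx i x) + bly i Y \<bullet> G i (blx i x) \<le> f i x' + bly i Y \<bullet> G i x'" if x': "x' \<in> \<Omega> i" for x'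
    proof -
      define w where "w = stack m (\<lambda>j. if j = i then x' else blx j x)"
      have dims: "dim_vec (if j = i then x' else blx j x) = nd j" if "j < m" for j
        using that \<Omega>_carrier[OF i x'] by auto
      have w: "w \<in> carrier_vec N" unfolding w_def by (intro carrier_vecI dim_stack_offs dims)
      have bw: "blx j w = (if j = i then x' else blx j x)" if "j < m" for j
        unfolding w_def using that by (intro blk_stack dims)
      have "w \<in> C" using w bw x(2) x' by (auto simp: C_def)
      \<comment> \<open>Complementarity turns the multiplier inequality into minimality of the
        Lagrangian, which is then localised to block \<open>i\<close>.\<close>
      from y[OF this] have "F x + y \<bullet> GG x \<le> F w + y \<bullet> GG w" using yS by simp
      then have "(\<Sum>j<m. f j (blx j x) + y \<bullet> G j (blx j x)) \<le> (\<Sum>j<m. f j (blx j w) + y \<bullet> G j (blx j w))"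
        by (simp add: F_def sum.distrib sumG)
      also have "\<dots> = (f i x' + y \<bullet> G i x') + (\<Sum>j\<in>{..<m} - {i}. f j (blx j x) + y \<bullet> G j (blx j x))"
        using i bw by (subst sum.remove[of _ i]) (auto intro!: sum.cong)
      finally show ?thesis using i bY by (subst (asm) sum.remove[of _ i]) auto
    qed
    show "(y' - bly i Y) \<bullet> (G i (blx i x) - bly i \<Lambda>) \<le> 0" if y': "y' \<in> Kpol p q" for y'
    proof -
      have "G i (blx i x) - bly i \<Lambda> = S"
        unfolding b\<Lambda>[OF i] using S(2) G_carrier[OF i, of "blx i x"] by (intro eq_vecI) auto
      then have "(y' - bly i Y) \<bullet> (G i (blx i x) - bly i \<Lambda>) = y' \<bullet> S - y \<bullet> S"
        using bY[OF i] S(2) dy by (simp add: sp_minus_left)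
      then show ?thesis using S(3) Kpol_Kcone_nonpos[OF y' S(1)] by simp
    qed
  next
    show "bU *\<^sub>v Y = 0\<^sub>v (r * pq)"
    proof (rule vec_eq_compI[of _ r pq])
      fix c assume c: "c < pq"
      have "comp_vec pq m Y c = (y $ c) \<cdot>\<^sub>v vec m (\<lambda>_. 1)"
        using bY c by (auto simp: comp_vec_def simp del: index_blk)
      moreover have "U *\<^sub>v ((y $ c) \<cdot>\<^sub>v vec m (\<lambda>_. 1)) = 0\<^sub>v r"
        using mult_mat_vec[OF U_dim, of "vec m (\<lambda>_. 1)" "y $ c"] U_one by auto
      ultimately show "comp_vec pq r (bU *\<^sub>v Y) c = comp_vec pq r (0\<^sub>v (r * pq)) c"
        using comp_vec_kron_one[OF U_dim _ c, of Y] Y comp_vec_zero[OF c, of r] by simp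
    qed (use bU_carrier in auto)
  qed
  then show ?thesis using x(1) Y Z(1) by blast
qed

end

lemma append_vec_minus:
  assumes "x \<in> carrier_vec n" "x' \<in> carrier_vec n" "y \<in> carrier_vec k" "y' \<in> carrier_vec k"
  shows "(x @\<^sub>v y) - (x' @\<^sub>v y') = (x - x') @\<^sub>v (y - (y' :: real vec))"
  using assms by (intro eq_vecI) auto

lemma vconv_append:
  assumes "vconv (\<lambda>k. s k @\<^sub>v t k) (x @\<^sub>v y)" "\<And>k. dim_vec (s k) = dim_vec x" "\<And>k. dim_vec (t k) = dim_vec y"
  shows "vconv s x" "vconv t y"
proof -
  have *: "(\<lambda>k. (s k @\<^sub>v t k) $ c) \<longlonglongrightarrow> (x @\<^sub>v y) $ c" if "c < dim_vec x + dim_vec y" for c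
    using that by (intro vconv_index[OF assms(1)]) simp
  show "vconv s x" unfolding vconv_iff
  proof (intro conjI allI impI assms)
    fix c assume "c < dim_vec x"
    then show "(\<lambda>k. s k $ c) \<longlonglongrightarrow> x $ c" using *[of c] assms by simp
  qed
  show "vconv t y" unfolding vconv_iff
  proof (intro conjI allI impI assms)
    fix c assume "c < dim_vec y"
    then show "(\<lambda>k. t k $ c) \<longlonglongrightarrow> y $ c" using *[of "dim_vec x + c"] assms by simp
  qed
qed

text \<open>Subtracting the partial sums of the errors leaves a decreasing sequence, bounded below
  by minus the total error.\<close>

lemma quasi_Fejer_convergent:
  fixes a e :: "nat \<Rightarrow> real"
  assumes a: "\<And>k. 0 \<le> a k" "\<And>k. a (Suc k) \<le> a k + e k" and e: "\<And>k. 0 \<le> e k" "summable e"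
  shows "convergent a"
proof -
  define s where "s k = (\<Sum>j<k. e j)" for k
  have s: "convergent s" unfolding s_def using e(2) by (simp add: summable_iff_convergent)
  have "decseq (\<lambda>k. a k - s k)" unfolding decseq_Suc_iff using a(2) by (simp add: s_def algebra_simps)
  moreover have "\<forall>k. - suminf e \<le> a k - s k"
  proof
    fix k
    have "s k \<le> suminf e" unfolding s_def using e by (intro sum_le_suminf) auto
    then show "- suminf e \<le> a k - s k" using a(1)[of k] by linarith
  qed
  ultimately have "convergent (\<lambda>k. a k - s k)" using decseq_convergent convergent_def by blast
  then have "convergent (\<lambda>k. (a k - s k) + s k)" using s by (rule convergent_add)
  then show ?thesis by simp
qed

lemma vec_add_minus_cancel: "x \<in> carrier_vec n \<Longrightarrow> w \<in> carrier_vec n \<Longrightarrow> x + w - w = (x :: real vec)"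
  by auto

lemma sp_bdiag:
  assumes "dim_vec x = offs ds m" "dim_vec y = offs ds m"
  shows "x \<bullet> (bdiag m ds cs *\<^sub>v y) = (\<Sum>i<m. cs i * (blk ds i x \<bullet> blk ds i y))"
  using assms by (subst sp_blocks[of _ ds m]) (auto simp: blk_bdiag sp_smult_right intro!: sum.cong)

lemma four_block_upper_mult_vec:
  fixes a d :: "real vec"
  assumes "A \<in> carrier_mat n1 n1" "B \<in> carrier_mat n1 n2" "D \<in> carrier_mat n2 n2" "a \<in> carrier_vec n1" "d \<in> carrier_vec n2"
  shows "four_block_mat A B (0\<^sub>m n2 n1) D *\<^sub>v (a @\<^sub>v d) = (A *\<^sub>v a + B *\<^sub>v d) @\<^sub>v (D *\<^sub>v d)"
  using assms by (subst four_block_mat_mult_vec[of _ n1 n1 _ n2 _ n2]) auto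

section \<open>The metric matrices\<close>

locale dpmm_parameters = dpmm_problem +
  fixes \<theta> \<alpha> \<gamma> :: "nat \<Rightarrow> real" and \<beta> :: real
  assumes \<theta>_rng: "\<forall>i<m. 0 < \<theta> i \<and> \<theta> i < 2"
    and \<alpha>_pos: "\<forall>i<m. 0 < \<alpha> i"
    and \<gamma>_pos: "\<forall>i<m. 0 < \<gamma> i"
    and \<beta>_pos: "0 < \<beta>"
    and \<gamma>\<beta>: "\<forall>i<m. 0 < \<gamma> i * \<beta> \<and> \<gamma> i * \<beta> < 1 / lam_max L"
begin

abbreviation "MY \<equiv> m * pq"
abbreviation "RZ \<equiv> r * pq"
abbreviation "T \<equiv> N + (MY + RZ)"
abbreviation "by_diag \<equiv> bdiag m (\<lambda>_. pq)"

definition "Q = four_block_mat (minv (bdiag m nd \<alpha>)) (0\<^sub>m N (MY + RZ)) (0\<^sub>m (MY + RZ) N)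
  (four_block_mat (minv (by_diag \<gamma>)) (- bU\<^sup>T) (0\<^sub>m RZ MY) ((1 / \<beta>) \<cdot>\<^sub>m 1\<^sub>m RZ))"

definition "M = four_block_mat (bdiag m nd \<theta>) (0\<^sub>m N (MY + RZ)) (0\<^sub>m (MY + RZ) N)
  (four_block_mat (1\<^sub>m MY) (- (by_diag \<gamma> * bU\<^sup>T)) (0\<^sub>m RZ MY) (1\<^sub>m RZ))"

definition "H = Q * minv M"

definition "D = Q\<^sup>T + Q - M\<^sup>T * H * M"

text \<open>The inverse of \<open>M\<close>: diagonal in the \<open>x\<close> block and unit upper
  triangular in the other two, so there only the off-diagonal block changes sign.\<close>

definition "Mi = four_block_mat (bdiag m nd (\<lambda>i. 1 / \<theta> i)) (0\<^sub>m N (MY + RZ)) (0\<^sub>m (MY + RZ) N)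
  (four_block_mat (1\<^sub>m MY) (by_diag \<gamma> * bUT) (0\<^sub>m RZ MY) (1\<^sub>m RZ))"

lemma by_diag_carrier: "by_diag cs \<in> carrier_mat MY MY"
  using bdiag_carrier[of m "\<lambda>_. pq" cs] by (simp add: offs_const)

lemma bdiag_mult_carrier:
  "v \<in> carrier_vec MY \<Longrightarrow> by_diag cs *\<^sub>v v \<in> carrier_vec MY"
  "w \<in> carrier_vec N \<Longrightarrow> bdiag m nd cs *\<^sub>v w \<in> carrier_vec N"
  by (rule mult_mat_vec_carrier[OF by_diag_carrier], assumption)
    (rule mult_mat_vec_carrier[OF bdiag_carrier], assumption)

lemma Gam_carrier: "by_diag \<gamma> * bUT \<in> carrier_mat MY RZ"
  by (rule mult_carrier_mat[OF by_diag_carrier bUT_carrier])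

lemma minv_blocks:
  "minv (bdiag m nd \<alpha>) = bdiag m nd (\<lambda>i. 1 / \<alpha> i)" "minv (by_diag \<gamma>) = by_diag (\<lambda>i. 1 / \<gamma> i)"
  using \<alpha>_pos \<gamma>_pos by (auto intro!: minv_bdiag)

lemma Q_carrier: "Q \<in> carrier_mat T T"
  unfolding Q_def minv_blocks bU_transpose using by_diag_carrier bUT_carrier
  by (intro four_block_carrier_mat) auto

lemma M_carrier: "M \<in> carrier_mat T T"
  unfolding M_def bU_transpose using by_diag_carrier bUT_carrier
  by (intro four_block_carrier_mat) auto

lemma Mi_carrier: "Mi \<in> carrier_mat T T"
  unfolding Mi_def using by_diag_carrier bUT_carrier
  by (intro four_block_carrier_mat) auto

context
  fixes a u c :: "real vec"
  assumes a: "a \<in> carrier_vec N" and u: "u \<in> carrier_vec MY" and c: "c \<in> carrier_vec RZ"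
begin

lemma bUT_c: "bUT *\<^sub>v c \<in> carrier_vec MY"
  using bUT_carrier c by simp

lemma Q_mult: "Q *\<^sub>v (a @\<^sub>v u @\<^sub>v c) =
  (bdiag m nd (\<lambda>i. 1 / \<alpha> i) *\<^sub>v a) @\<^sub>v (by_diag (\<lambda>i. 1 / \<gamma> i) *\<^sub>v u - bUT *\<^sub>v c) @\<^sub>v ((1 / \<beta>) \<cdot>\<^sub>v c)"
proof -
  have "by_diag (\<lambda>i. 1 / \<gamma> i) *\<^sub>v u + (- bUT) *\<^sub>v c = by_diag (\<lambda>i. 1 / \<gamma> i) *\<^sub>v u - bUT *\<^sub>v c"
    using bUT_carrier c u by_diag_carrier[of "\<lambda>i. 1 / \<gamma> i"] by (intro eq_vecI) auto
  moreover have "four_block_mat (by_diag (\<lambda>i. 1 / \<gamma> i)) (- bUT) (0\<^sub>m RZ MY) ((1 / \<beta>) \<cdot>\<^sub>m 1\<^sub>m RZ) *\<^sub>v (u @\<^sub>v c)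
      = (by_diag (\<lambda>i. 1 / \<gamma> i) *\<^sub>v u + (- bUT) *\<^sub>v c) @\<^sub>v ((1 / \<beta>) \<cdot>\<^sub>v c)"
    using by_diag_carrier bUT_carrier u c by (subst four_block_upper_mult_vec[of _ MY _ RZ]) (auto simp: smult_one_mult_vec)
  moreover have "Q *\<^sub>v (a @\<^sub>v u @\<^sub>v c) = (bdiag m nd (\<lambda>i. 1 / \<alpha> i) *\<^sub>v a) @\<^sub>v
      (four_block_mat (by_diag (\<lambda>i. 1 / \<gamma> i)) (- bUT) (0\<^sub>m RZ MY) ((1 / \<beta>) \<cdot>\<^sub>m 1\<^sub>m RZ) *\<^sub>v (u @\<^sub>v c))"
    unfolding Q_def minv_blocks bU_transpose using by_diag_carrier bUT_carrier a u c
    by (intro mult_mat_vec_split four_block_carrier_mat) auto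
  ultimately show ?thesis by simp
qed

lemma M_mult: "M *\<^sub>v (a @\<^sub>v u @\<^sub>v c) = (bdiag m nd \<theta> *\<^sub>v a) @\<^sub>v (u - by_diag \<gamma> *\<^sub>v (bUT *\<^sub>v c)) @\<^sub>v c"
proof -
  have "1\<^sub>m MY *\<^sub>v u + (- (by_diag \<gamma> * bUT)) *\<^sub>v c = u - by_diag \<gamma> *\<^sub>v (bUT *\<^sub>v c)"
    unfolding assoc_mult_mat_vec[OF by_diag_carrier bUT_carrier c, symmetric]
    using Gam_carrier c u by (intro eq_vecI) auto
  moreover have "four_block_mat (1\<^sub>m MY) (- (by_diag \<gamma> * bUT)) (0\<^sub>m RZ MY) (1\<^sub>m RZ) *\<^sub>v (u @\<^sub>v c)
      = (1\<^sub>m MY *\<^sub>v u + (- (by_diag \<gamma> * bUT)) *\<^sub>v c) @\<^sub>v (1\<^sub>m RZ *\<^sub>v c)"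
    using Gam_carrier u c by (subst four_block_upper_mult_vec[of _ MY _ RZ]) auto
  moreover have "M *\<^sub>v (a @\<^sub>v u @\<^sub>v c) = (bdiag m nd \<theta> *\<^sub>v a) @\<^sub>v
      (four_block_mat (1\<^sub>m MY) (- (by_diag \<gamma> * bUT)) (0\<^sub>m RZ MY) (1\<^sub>m RZ) *\<^sub>v (u @\<^sub>v c))"
    unfolding M_def bU_transpose using Gam_carrier a u c
    by (intro mult_mat_vec_split four_block_carrier_mat) auto
  ultimately show ?thesis using c by simp
qed

lemma Mi_mult: "Mi *\<^sub>v (a @\<^sub>v u @\<^sub>v c) =
  (bdiag m nd (\<lambda>i. 1 / \<theta> i) *\<^sub>v a) @\<^sub>v (u + by_diag \<gamma> *\<^sub>v (bUT *\<^sub>v c)) @\<^sub>v c"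
proof -
  have "1\<^sub>m MY *\<^sub>v u + (by_diag \<gamma> * bUT) *\<^sub>v c = u + by_diag \<gamma> *\<^sub>v (bUT *\<^sub>v c)"
    unfolding assoc_mult_mat_vec[OF by_diag_carrier bUT_carrier c] using u by simp
  moreover have "four_block_mat (1\<^sub>m MY) (by_diag \<gamma> * bUT) (0\<^sub>m RZ MY) (1\<^sub>m RZ) *\<^sub>v (u @\<^sub>v c)
      = (1\<^sub>m MY *\<^sub>v u + (by_diag \<gamma> * bUT) *\<^sub>v c) @\<^sub>v (1\<^sub>m RZ *\<^sub>v c)"
    using Gam_carrier u c by (subst four_block_upper_mult_vec[of _ MY _ RZ]) auto
  moreover have "Mi *\<^sub>v (a @\<^sub>v u @\<^sub>v c) = (bdiag m nd (\<lambda>i. 1 / \<theta> i) *\<^sub>v a) @\<^sub>v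
      (four_block_mat (1\<^sub>m MY) (by_diag \<gamma> * bUT) (0\<^sub>m RZ MY) (1\<^sub>m RZ) *\<^sub>v (u @\<^sub>v c))"
    unfolding Mi_def using Gam_carrier a u c
    by (intro mult_mat_vec_split four_block_carrier_mat) auto
  ultimately show ?thesis using c by simp
qed

end

lemma split_T:
  assumes "v \<in> carrier_vec T"
  obtains a u c where "a \<in> carrier_vec N" "u \<in> carrier_vec MY" "c \<in> carrier_vec RZ" "v = a @\<^sub>v u @\<^sub>v c"
  using assms by (auto simp: add.assoc[symmetric] elim: vec_split3_obtain)

lemma M_Mi: "M * Mi = 1\<^sub>m T"
proof (rule mat_eq_if_mult_vec_eq[OF mult_carrier_mat[OF M_carrier Mi_carrier] one_carrier_mat])
  fix v :: "real vec" assume v: "v \<in> carrier_vec T"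
  then obtain a u c where auc: "a \<in> carrier_vec N" "u \<in> carrier_vec MY" "c \<in> carrier_vec RZ" "v = a @\<^sub>v u @\<^sub>v c"
    by (rule split_T)
  define w where "w = by_diag \<gamma> *\<^sub>v (bUT *\<^sub>v c)"
  have w: "w \<in> carrier_vec MY" unfolding w_def by (rule mult_mat_vec_carrier[OF by_diag_carrier bUT_c[OF auc(1-3)]])
  have "M *\<^sub>v (Mi *\<^sub>v v) = bdiag m nd \<theta> *\<^sub>v (bdiag m nd (\<lambda>i. 1 / \<theta> i) *\<^sub>v a) @\<^sub>v (u + w - w) @\<^sub>v c"
    unfolding auc(4) Mi_mult[OF auc(1-3)] w_def[symmetric]
    by (subst M_mult) (use auc w in \<open>auto simp: w_def bdiag_mult_carrier\<close>)
  also have "bdiag m nd \<theta> *\<^sub>v (bdiag m nd (\<lambda>i. 1 / \<theta> i) *\<^sub>v a) = a"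
    using \<theta>_rng auc by (intro bdiag_bdiag_inverse) fastforce+
  also have "u + w - w = u" using auc w by auto
  finally show "M * Mi *\<^sub>v v = 1\<^sub>m T *\<^sub>v v"
    using v auc(4) assoc_mult_mat_vec[OF M_carrier Mi_carrier v] by simp
qed

lemma minv_M: "minv M = Mi"
  by (rule minv_eqI[OF M_carrier Mi_carrier M_Mi])

lemma H_carrier: "H \<in> carrier_mat T T"
  unfolding H_def minv_M by (rule mult_carrier_mat[OF Q_carrier Mi_carrier])

text \<open>The descent computation rests on this identity and the symmetry of
  \<open>H\<close>.\<close>

lemma H_M: "H * M = Q"
proof -
  have "Mi * M = 1\<^sub>m T" by (rule mat_mult_left_right_inverse[OF M_carrier Mi_carrier M_Mi])
  then show ?thesis unfolding H_def minv_M assoc_mult_mat[OF Q_carrier Mi_carrier M_carrier] using Q_carrier by simp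
qed

text \<open>The block \<open>\<Gamma> U^T\<close> of the inverse of \<open>M\<close>, scaled by the
  \<open>1 / \<gamma>\<close> block of \<open>Q\<close>, cancels the block \<open>-U^T\<close> of
  \<open>Q\<close>. That cancellation is why \<open>H\<close> is diagonal, hence symmetric and
  positive.\<close>

lemma H_mult:
  assumes auc: "a \<in> carrier_vec N" "u \<in> carrier_vec MY" "c \<in> carrier_vec RZ"
  shows "H *\<^sub>v (a @\<^sub>v u @\<^sub>v c) =
    (bdiag m nd (\<lambda>i. 1 / (\<alpha> i * \<theta> i)) *\<^sub>v a) @\<^sub>v (by_diag (\<lambda>i. 1 / \<gamma> i) *\<^sub>v u) @\<^sub>v ((1 / \<beta>) \<cdot>\<^sub>v c)"
proof -
  define w where "w = bUT *\<^sub>v c"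
  have w: "w \<in> carrier_vec MY" unfolding w_def by (rule bUT_c[OF auc])
  have gw: "by_diag \<gamma> *\<^sub>v w \<in> carrier_vec MY" using w by (rule bdiag_mult_carrier)
  have v: "a @\<^sub>v u @\<^sub>v c \<in> carrier_vec T" using auc by (intro append_carrier_vec)
  have "H *\<^sub>v (a @\<^sub>v u @\<^sub>v c) = Q *\<^sub>v (Mi *\<^sub>v (a @\<^sub>v u @\<^sub>v c))"
    unfolding H_def minv_M by (rule assoc_mult_mat_vec[OF Q_carrier Mi_carrier v])
  also have "\<dots> = (bdiag m nd (\<lambda>i. 1 / \<alpha> i) *\<^sub>v (bdiag m nd (\<lambda>i. 1 / \<theta> i) *\<^sub>v a)) @\<^sub>v
      (by_diag (\<lambda>i. 1 / \<gamma> i) *\<^sub>v (u + by_diag \<gamma> *\<^sub>v w) - w) @\<^sub>v ((1 / \<beta>) \<cdot>\<^sub>v c)"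
    unfolding Mi_mult[OF auc] w_def[symmetric] by (subst Q_mult) (use auc gw in \<open>auto simp: w_def bdiag_mult_carrier\<close>)
  also have "by_diag (\<lambda>i. 1 / \<gamma> i) *\<^sub>v (u + by_diag \<gamma> *\<^sub>v w) - w = by_diag (\<lambda>i. 1 / \<gamma> i) *\<^sub>v u"
  proof -
    have "by_diag (\<lambda>i. 1 / \<gamma> i) *\<^sub>v (by_diag \<gamma> *\<^sub>v w) = w"
      using \<gamma>_pos w by (intro bdiag_bdiag_inverse) (auto simp: offs_const less_imp_neq[symmetric])
    then show ?thesis unfolding mult_add_distrib_mat_vec[OF by_diag_carrier auc(2) gw]
      using vec_add_minus_cancel[OF bdiag_mult_carrier(1)[OF auc(2)] w] by simp
  qed
  also have "bdiag m nd (\<lambda>i. 1 / \<alpha> i) *\<^sub>v (bdiag m nd (\<lambda>i. 1 / \<theta> i) *\<^sub>v a) = bdiag m nd (\<lambda>i. 1 / (\<alpha> i * \<theta> i)) *\<^sub>v a"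
  proof (rule vec_eq_blkI[of _ nd m])
    fix i assume "i < m"
    then show "blx i (bdiag m nd (\<lambda>i. 1 / \<alpha> i) *\<^sub>v (bdiag m nd (\<lambda>i. 1 / \<theta> i) *\<^sub>v a)) =
        blx i (bdiag m nd (\<lambda>i. 1 / (\<alpha> i * \<theta> i)) *\<^sub>v a)"
      using auc by (simp add: blk_bdiag smult_smult_assoc)
  qed auto
  finally show ?thesis .
qed

lemma sp_split:
  assumes "a \<in> carrier_vec N" "u \<in> carrier_vec MY" "c \<in> carrier_vec RZ"
    "a' \<in> carrier_vec N" "u' \<in> carrier_vec MY" "c' \<in> carrier_vec RZ"
  shows "(a @\<^sub>v u @\<^sub>v c) \<bullet> (a' @\<^sub>v u' @\<^sub>v c') = a \<bullet> a' + u \<bullet> u' + c \<bullet> c'"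
proof -
  have "(a @\<^sub>v u @\<^sub>v c) \<bullet> (a' @\<^sub>v u' @\<^sub>v c') = a \<bullet> a' + (u @\<^sub>v c) \<bullet> (u' @\<^sub>v c')"
    by (rule scalar_prod_append[OF assms(1) append_carrier_vec[OF assms(2,3)] assms(4) append_carrier_vec[OF assms(5,6)]])
  also have "(u @\<^sub>v c) \<bullet> (u' @\<^sub>v c') = u \<bullet> u' + c \<bullet> c'" by (rule scalar_prod_append[OF assms(2,3,5,6)])
  finally show ?thesis by (simp only: add.assoc)
qed

lemma sp_H:
  assumes "a \<in> carrier_vec N" "u \<in> carrier_vec MY" "c \<in> carrier_vec RZ"
    "a' \<in> carrier_vec N" "u' \<in> carrier_vec MY" "c' \<in> carrier_vec RZ"
  shows "(a @\<^sub>v u @\<^sub>v c) \<bullet> (H *\<^sub>v (a' @\<^sub>v u' @\<^sub>v c')) =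
    (\<Sum>i<m. 1 / (\<alpha> i * \<theta> i) * (blx i a \<bullet> blx i a')) + (\<Sum>i<m. 1 / \<gamma> i * (bly i u \<bullet> bly i u')) + 1 / \<beta> * (c \<bullet> c')"
proof -
  have u': "by_diag (\<lambda>i. 1 / \<gamma> i) *\<^sub>v u' \<in> carrier_vec MY" using assms by (intro bdiag_mult_carrier)
  show ?thesis
    unfolding H_mult[OF assms(4-6)] using assms u'
    by (subst sp_split) (auto simp: sp_bdiag offs_const sp_smult_right bdiag_mult_carrier)
qed

lemma H_sym:
  assumes "v \<in> carrier_vec T" "w \<in> carrier_vec T"
  shows "v \<bullet> (H *\<^sub>v w) = w \<bullet> (H *\<^sub>v v)"
proof -
  obtain a u c where v: "a \<in> carrier_vec N" "u \<in> carrier_vec MY" "c \<in> carrier_vec RZ" "v = a @\<^sub>v u @\<^sub>v c"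
    using assms(1) by (rule split_T)
  obtain a' u' c' where w: "a' \<in> carrier_vec N" "u' \<in> carrier_vec MY" "c' \<in> carrier_vec RZ" "w = a' @\<^sub>v u' @\<^sub>v c'"
    using assms(2) by (rule split_T)
  show ?thesis unfolding v(4) w(4) sp_H[OF v(1-3) w(1-3)] sp_H[OF w(1-3) v(1-3)]
    using v w by (simp add: sp_comm[of c c'] sp_comm[of "blx _ a" "blx _ a'"] sp_comm[of "bly _ u" "bly _ u'"])
qed

text \<open>\<open>M^T H M\<close> is \<open>M^T Q\<close>, so the form is computed from the actions
  of \<open>M\<close> and \<open>Q\<close> alone.\<close>

lemma qn_D:
  assumes v: "v \<in> carrier_vec T"
  shows "qn D v = 2 * (v \<bullet> (Q *\<^sub>v v)) - (M *\<^sub>v v) \<bullet> (Q *\<^sub>v v)"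
proof -
  have MT: "M\<^sup>T \<in> carrier_mat T T" and QT: "Q\<^sup>T \<in> carrier_mat T T" using M_carrier Q_carrier by auto
  have "M\<^sup>T * H * M = M\<^sup>T * Q" unfolding assoc_mult_mat[OF MT H_carrier M_carrier] H_M ..
  then have "D *\<^sub>v v = Q\<^sup>T *\<^sub>v v + Q *\<^sub>v v - M\<^sup>T *\<^sub>v (Q *\<^sub>v v)"
    unfolding D_def
    using minus_mult_distrib_mat_vec[OF add_carrier_mat[OF Q_carrier] mult_carrier_mat[OF MT Q_carrier] v]
      add_mult_distrib_mat_vec[OF QT Q_carrier v] assoc_mult_mat_vec[OF MT Q_carrier v] by simp
  moreover have "v \<bullet> (Q\<^sup>T *\<^sub>v v) = v \<bullet> (Q *\<^sub>v v)"
    using sp_transpose[OF Q_carrier v v] sp_comm[of v "Q\<^sup>T *\<^sub>v v"] Q_carrier v by simp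
  moreover have "v \<bullet> (M\<^sup>T *\<^sub>v (Q *\<^sub>v v)) = (M *\<^sub>v v) \<bullet> (Q *\<^sub>v v)"
    using sp_transpose[OF MT mult_mat_vec_carrier[OF Q_carrier v] v] by simp
  ultimately show ?thesis using Q_carrier M_carrier v unfolding qn_def by (simp add: sp_simps)
qed

text \<open>With \<open>e\<close> the current error and \<open>d\<close> the step, the two cross
  terms agree by symmetry of \<open>H\<close> and \<open>H M = Q\<close>; the quadratic term
  \<open>(M d) . (Q d)\<close> is what \<open>D\<close> was designed to absorb.\<close>

lemma relaxation_identity:
  assumes e: "e \<in> carrier_vec T" and d: "d \<in> carrier_vec T"
  shows "qn H (e - M *\<^sub>v d) = qn H e - qn D d - 2 * ((e - d) \<bullet> (Q *\<^sub>v d))"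
proof -
  have Md: "M *\<^sub>v d \<in> carrier_vec T" using M_carrier d by simp
  have Qd: "H *\<^sub>v (M *\<^sub>v d) = Q *\<^sub>v d" using assoc_mult_mat_vec[OF H_carrier M_carrier d] H_M by simp
  have c: "Q *\<^sub>v d \<in> carrier_vec T" "H *\<^sub>v e \<in> carrier_vec T" using Q_carrier H_carrier d e by auto
  have "H *\<^sub>v (e - M *\<^sub>v d) = H *\<^sub>v e - Q *\<^sub>v d" unfolding mult_minus_distrib_mat_vec[OF H_carrier e Md] Qd ..
  then have "qn H (e - M *\<^sub>v d) = (e - M *\<^sub>v d) \<bullet> (H *\<^sub>v e - Q *\<^sub>v d)" by (simp add: qn_def)
  also have "\<dots> = e \<bullet> (H *\<^sub>v e) - e \<bullet> (Q *\<^sub>v d) - (M *\<^sub>v d) \<bullet> (H *\<^sub>v e) + (M *\<^sub>v d) \<bullet> (Q *\<^sub>v d)"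
    using carrier_vecD[OF Md] carrier_vecD[OF c(1)] carrier_vecD[OF c(2)] e d
    by (simp add: sp_simps del: dim_mult_mat_vec)
  also have "(M *\<^sub>v d) \<bullet> (H *\<^sub>v e) = e \<bullet> (Q *\<^sub>v d)" using H_sym[OF Md e] Qd by simp
  finally show ?thesis unfolding qn_D[OF d] using e d carrier_vecD[OF c(1)]
    by (simp add: qn_def sp_minus_left del: dim_mult_mat_vec)
qed

text \<open>The coupling \<open>u . (U^T c)\<close> enters the two contributions of \<open>D\<close>
  with opposite signs and cancels. The last, subtracted sum is what the condition on
  \<open>\<gamma> \<beta>\<close> has to control.\<close>

lemma qn_D_split:
  assumes auc: "a \<in> carrier_vec N" "u \<in> carrier_vec MY" "c \<in> carrier_vec RZ"
  shows "qn D (a @\<^sub>v u @\<^sub>v c) = (\<Sum>i<m. (2 - \<theta> i) / \<alpha> i * (blx i a \<bullet> blx i a)) + (\<Sum>i<m. 1 / \<gamma> i * (bly i u \<bullet> bly i u))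
    + 1 / \<beta> * (c \<bullet> c) - (\<Sum>i<m. \<gamma> i * (bly i (bUT *\<^sub>v c) \<bullet> bly i (bUT *\<^sub>v c)))"
proof -
  define w where "w = bUT *\<^sub>v c"
  have w: "w \<in> carrier_vec MY" unfolding w_def by (rule bUT_c[OF auc])
  have gw: "by_diag \<gamma> *\<^sub>v w \<in> carrier_vec MY" and gu: "by_diag (\<lambda>i. 1 / \<gamma> i) *\<^sub>v u \<in> carrier_vec MY"
    using w auc by (auto intro: bdiag_mult_carrier)
  have v: "a @\<^sub>v u @\<^sub>v c \<in> carrier_vec T" using auc by (intro append_carrier_vec)
  have dims: "dim_vec a = N" "dim_vec u = MY" "dim_vec c = RZ" "dim_vec w = MY"
    "dim_vec (by_diag \<gamma> *\<^sub>v w) = MY" "dim_vec (by_diag (\<lambda>i. 1 / \<gamma> i) *\<^sub>v u) = MY"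
    using auc w gw gu carrier_vecD by blast+
  have 1: "(a @\<^sub>v u @\<^sub>v c) \<bullet> (Q *\<^sub>v (a @\<^sub>v u @\<^sub>v c)) = (\<Sum>i<m. 1 / \<alpha> i * (blx i a \<bullet> blx i a))
      + ((\<Sum>i<m. 1 / \<gamma> i * (bly i u \<bullet> bly i u)) - u \<bullet> w) + 1 / \<beta> * (c \<bullet> c)"
    unfolding Q_mult[OF auc] w_def[symmetric] using auc w gu dims
    by (subst sp_split) (auto simp: sp_bdiag offs_const sp_smult_right sp_minus_right bdiag_mult_carrier)
  have 2: "(M *\<^sub>v (a @\<^sub>v u @\<^sub>v c)) \<bullet> (Q *\<^sub>v (a @\<^sub>v u @\<^sub>v c)) = (bdiag m nd \<theta> *\<^sub>v a) \<bullet> (bdiag m nd (\<lambda>i. 1 / \<alpha> i) *\<^sub>v a)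
      + (u - by_diag \<gamma> *\<^sub>v w) \<bullet> (by_diag (\<lambda>i. 1 / \<gamma> i) *\<^sub>v u - w) + 1 / \<beta> * (c \<bullet> c)"
    unfolding Q_mult[OF auc] M_mult[OF auc] w_def[symmetric] using auc w gu gw
    by (subst sp_split) (auto simp: sp_smult_right bdiag_mult_carrier)
  have 3: "(bdiag m nd \<theta> *\<^sub>v a) \<bullet> (bdiag m nd (\<lambda>i. 1 / \<alpha> i) *\<^sub>v a) = (\<Sum>i<m. \<theta> i / \<alpha> i * (blx i a \<bullet> blx i a))"
    using dims by (subst sp_bdiag) (auto simp: blk_bdiag sp_smult_left intro!: sum.cong)
  have "(u - by_diag \<gamma> *\<^sub>v w) \<bullet> (by_diag (\<lambda>i. 1 / \<gamma> i) *\<^sub>v u - w)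
      = u \<bullet> (by_diag (\<lambda>i. 1 / \<gamma> i) *\<^sub>v u) - u \<bullet> w - (by_diag \<gamma> *\<^sub>v w) \<bullet> (by_diag (\<lambda>i. 1 / \<gamma> i) *\<^sub>v u) + (by_diag \<gamma> *\<^sub>v w) \<bullet> w"
    using dims by (simp add: sp_minus_left sp_minus_right del: dim_mult_mat_vec)
  also have "(by_diag \<gamma> *\<^sub>v w) \<bullet> (by_diag (\<lambda>i. 1 / \<gamma> i) *\<^sub>v u) = (\<Sum>i<m. bly i w \<bullet> bly i u)"
    using dims \<gamma>_pos by (subst sp_bdiag) (auto simp: offs_const blk_bdiag sp_smult_left simp del: dim_mult_mat_vec intro!: sum.cong)
  also have "\<dots> = u \<bullet> w" using dims by (subst sp_blocks[of w "\<lambda>_. pq" m]) (auto simp: offs_const sp_comm[of "bly _ u"])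
  also have "(by_diag \<gamma> *\<^sub>v w) \<bullet> w = (\<Sum>i<m. \<gamma> i * (bly i w \<bullet> bly i w))"
    using dims sp_comm[of "by_diag \<gamma> *\<^sub>v w" w] by (simp add: sp_bdiag offs_const)
  also have "u \<bullet> (by_diag (\<lambda>i. 1 / \<gamma> i) *\<^sub>v u) = (\<Sum>i<m. 1 / \<gamma> i * (bly i u \<bullet> bly i u))"
    using dims by (subst sp_bdiag) (auto simp: offs_const)
  finally have 4: "(u - by_diag \<gamma> *\<^sub>v w) \<bullet> (by_diag (\<lambda>i. 1 / \<gamma> i) *\<^sub>v u - w)
      = (\<Sum>i<m. 1 / \<gamma> i * (bly i u \<bullet> bly i u)) - 2 * (u \<bullet> w) + (\<Sum>i<m. \<gamma> i * (bly i w \<bullet> bly i w))" by simp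
  have 5: "(\<Sum>i<m. (2 - \<theta> i) / \<alpha> i * (blx i a \<bullet> blx i a))
      = 2 * (\<Sum>i<m. 1 / \<alpha> i * (blx i a \<bullet> blx i a)) - (\<Sum>i<m. \<theta> i / \<alpha> i * (blx i a \<bullet> blx i a))"
    by (simp add: sum_distrib_left diff_divide_distrib left_diff_distrib sum_subtractf)
  show ?thesis unfolding qn_D[OF v] 1 2 3 4 5 w_def[symmetric] by simp
qed

lemma qn_H_ge: "\<exists>\<kappa>>0. \<forall>v\<in>carrier_vec T. \<kappa> * (v \<bullet> v) \<le> qn H v"
proof -
  define W where "W = (\<lambda>i. 1 / (\<alpha> i * \<theta> i)) ` {..<m} \<union> (\<lambda>i. 1 / \<gamma> i) ` {..<m} \<union> {1 / \<beta>}"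
  define \<kappa> where "\<kappa> = Min W"
  have W: "finite W" "W \<noteq> {}" "\<And>x. x \<in> W \<Longrightarrow> 0 < x" using \<alpha>_pos \<theta>_rng \<gamma>_pos \<beta>_pos by (auto simp: W_def)
  have \<kappa>: "0 < \<kappa>" unfolding \<kappa>_def using W by simp
  have le: "\<kappa> \<le> x" if "x \<in> W" for x unfolding \<kappa>_def using W that by simp
  have "\<kappa> * (v \<bullet> v) \<le> qn H v" if v: "v \<in> carrier_vec T" for v
  proof -
    obtain a u c where auc: "a \<in> carrier_vec N" "u \<in> carrier_vec MY" "c \<in> carrier_vec RZ" and veq: "v = a @\<^sub>v u @\<^sub>v c"
      using v by (rule split_T)
    have "\<kappa> * (v \<bullet> v) = (\<Sum>i<m. \<kappa> * (blx i a \<bullet> blx i a)) + (\<Sum>i<m. \<kappa> * (bly i u \<bullet> bly i u)) + \<kappa> * (c \<bullet> c)"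
      unfolding veq sp_split[OF auc auc] using auc sp_blocks[of a nd m a] sp_blocks[of u "\<lambda>_. pq" m u]
      by (simp add: offs_const sum_distrib_left distrib_left)
    also have "\<dots> \<le> qn H v"
      unfolding qn_def veq sp_H[OF auc auc]
      by (intro add_mono sum_mono mult_right_mono le sp_self_nonneg) (auto simp: W_def)
    finally show ?thesis .
  qed
  then show ?thesis using \<kappa> by blast
qed

text \<open>Only the last block is not obviously positive: with \<open>gm\<close> the largest
  \<open>\<gamma> i\<close>, the subtracted sum is at most \<open>gm * lam_max L\<close> times
  \<open>c . c\<close>, and \<open>gm * lam_max L < 1 / \<beta>\<close>.\<close>

lemma qn_D_ge: "\<exists>\<kappa>>0. \<forall>v\<in>carrier_vec T. \<kappa> * (v \<bullet> v) \<le> qn D v"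
proof -
  define gm where "gm = Max (\<gamma> ` {..<m})"
  have m0: "0 < m" using m2 by simp
  then have "gm \<in> \<gamma> ` {..<m}" unfolding gm_def by (intro Max_in) auto
  then have gm: "0 < gm" "gm * \<beta> < 1 / lam_max L" "0 < gm * \<beta>" using \<gamma>_pos \<gamma>\<beta> by auto
  have gi: "\<gamma> i \<le> gm" if "i < m" for i unfolding gm_def using that by simp
  \<comment> \<open>The step-size hypothesis itself makes \<open>lam_max L\<close> positive, since
    its reciprocal exceeds a positive number.\<close>
  have "0 < 1 / lam_max L" using gm by linarith
  then have lam: "0 < lam_max L" by simp
  have gl: "gm * lam_max L < 1 / \<beta>" using gm lam \<beta>_pos by (simp add: field_simps)
  define W where "W = (\<lambda>i. (2 - \<theta> i) / \<alpha> i) ` {..<m} \<union> (\<lambda>i. 1 / \<gamma> i) ` {..<m} \<union> {1 / \<beta> - gm * lam_max L}"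
  define \<kappa> where "\<kappa> = Min W"
  have W: "finite W" "W \<noteq> {}" "\<And>x. x \<in> W \<Longrightarrow> 0 < x" using \<alpha>_pos \<theta>_rng \<gamma>_pos gl by (auto simp: W_def)
  have \<kappa>: "0 < \<kappa>" unfolding \<kappa>_def using W by simp
  have le: "\<kappa> \<le> x" if "x \<in> W" for x unfolding \<kappa>_def using W that by simp
  have "\<kappa> * (v \<bullet> v) \<le> qn D v" if v: "v \<in> carrier_vec T" for v
  proof -
    obtain a u c where auc: "a \<in> carrier_vec N" "u \<in> carrier_vec MY" "c \<in> carrier_vec RZ" and veq: "v = a @\<^sub>v u @\<^sub>v c"
      using v by (rule split_T)
    define w where "w = bUT *\<^sub>v c"
    have w: "w \<in> carrier_vec MY" unfolding w_def by (rule bUT_c[OF auc])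
    have "(\<Sum>i<m. \<gamma> i * (bly i w \<bullet> bly i w)) \<le> (\<Sum>i<m. gm * (bly i w \<bullet> bly i w))"
      using gi by (intro sum_mono mult_right_mono sp_self_nonneg) auto
    also have "\<dots> = gm * (w \<bullet> w)" using w sp_blocks[of w "\<lambda>_. pq" m w] by (simp add: offs_const sum_distrib_left)
    also have "\<dots> \<le> gm * (lam_max L * (c \<bullet> c))"
      unfolding w_def using gm kron_transpose_sq_le_lam_max[OF U_dim L_UU auc(3)] lam by (intro mult_left_mono) auto
    finally have U: "(\<Sum>i<m. \<gamma> i * (bly i w \<bullet> bly i w)) \<le> gm * lam_max L * (c \<bullet> c)" by simp
    have "\<kappa> * (v \<bullet> v) = (\<Sum>i<m. \<kappa> * (blx i a \<bullet> blx i a)) + (\<Sum>i<m. \<kappa> * (bly i u \<bullet> bly i u)) + \<kappa> * (c \<bullet> c)"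
      unfolding veq sp_split[OF auc auc] using auc sp_blocks[of a nd m a] sp_blocks[of u "\<lambda>_. pq" m u]
      by (simp add: offs_const sum_distrib_left distrib_left)
    also have "\<dots> \<le> (\<Sum>i<m. (2 - \<theta> i) / \<alpha> i * (blx i a \<bullet> blx i a)) + (\<Sum>i<m. 1 / \<gamma> i * (bly i u \<bullet> bly i u))
        + (1 / \<beta> - gm * lam_max L) * (c \<bullet> c)"
      by (intro add_mono sum_mono mult_right_mono le sp_self_nonneg) (auto simp: W_def)
    also have "\<dots> \<le> qn D v"
      unfolding veq qn_D_split[OF auc] w_def[symmetric] using U by (simp add: left_diff_distrib)
    finally show ?thesis .
  qed
  then show ?thesis using \<kappa> by blast
qed

end

section \<open>The iteration\<close>

lemma esubdiff_ind:
  assumes "v \<in> esubdiff d (\<lambda>x. ereal (h x) + ind S x) x"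
  shows "x \<in> S" "y \<in> S \<Longrightarrow> y \<in> carrier_vec d \<Longrightarrow> h x + v \<bullet> (y - x) \<le> h y"
proof -
  show x: "x \<in> S" using assms by (auto simp: esubdiff_def ind_def split: if_splits)
  assume "y \<in> S" "y \<in> carrier_vec d"
  then have "ereal (h x) + ind S x + ereal (v \<bullet> (y - x)) \<le> ereal (h y) + ind S y"
    using assms by (auto simp: esubdiff_def)
  then show "h x + v \<bullet> (y - x) \<le> h y" using x \<open>y \<in> S\<close> by (simp add: ind_def)
qed

locale dpmm_iteration = dpmm_parameters +
  fixes eps :: "nat \<Rightarrow> nat \<Rightarrow> real"
    and xk yk lk xh yh vk :: "nat \<Rightarrow> nat \<Rightarrow> real vec"
  assumes eps_nn: "\<forall>i<m. \<forall>k. 0 \<le> eps i k"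
    and eps_sum: "\<forall>i<m. summable (\<lambda>k. eps i k)"
    and init_x: "\<forall>i<m. xk 0 i \<in> \<Omega> i"
    and init_y: "\<forall>i<m. yk 0 i \<in> Kpol p q"
    and init_l: "\<forall>i<m. lk 0 i = 0\<^sub>v (p + q)"
    and step_v: "\<forall>k. \<forall>i<m. vk k i \<in> esubdiff (nd i) (\<lambda>x.
         ereal (f i x + 1 / (2 * \<gamma> i) *
                  (projK p q (yk k i - \<gamma> i \<cdot>\<^sub>v lk k i + \<gamma> i \<cdot>\<^sub>v Gfun A b g i x) \<bullet>
                   projK p q (yk k i - \<gamma> i \<cdot>\<^sub>v lk k i + \<gamma> i \<cdot>\<^sub>v Gfun A b g i x)
                   - (yk k i - \<gamma> i \<cdot>\<^sub>v lk k i) \<bullet> (yk k i - \<gamma> i \<cdot>\<^sub>v lk k i))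
                + 1 / (2 * \<alpha> i) * ((x - xk k i) \<bullet> (x - xk k i)))
         + ind (\<Omega> i) x) (xh k i) \<and> vnorm (vk k i) \<le> eps i k"
    and step_yh: "\<forall>k. \<forall>i<m. yh k i = projK p q (yk k i - \<gamma> i \<cdot>\<^sub>v lk k i + \<gamma> i \<cdot>\<^sub>v Gfun A b g i (xh k i))"
    and step_x: "\<forall>k. \<forall>i<m. xk (Suc k) i = (1 - \<theta> i) \<cdot>\<^sub>v xk k i + \<theta> i \<cdot>\<^sub>v xh k i"
    and step_l: "\<forall>k. \<forall>i<m. lk (Suc k) i = lk k i + \<beta> \<cdot>\<^sub>v vsum (p + q) m (\<lambda>j. L $$ (i, j) \<cdot>\<^sub>v yh k j)"
    and step_y: "\<forall>k. \<forall>i<m. yk (Suc k) i = yh k i + \<gamma> i \<cdot>\<^sub>v (lk k i - lk (Suc k) i)"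
begin

section \<open>Carriers of the iterates and the dual sequence Z\<close>

lemma yh_Kpol: "i < m \<Longrightarrow> yh k i \<in> Kpol p q"
  using step_yh projK_in_Kpol by simp

lemma yh_carrier: "i < m \<Longrightarrow> yh k i \<in> carrier_vec pq"
  using yh_Kpol by (auto simp: Kpol_def)

lemma vk_carrier: "i < m \<Longrightarrow> vk k i \<in> carrier_vec (nd i)"
  using step_v by (auto simp: esubdiff_def)

lemma xh_\<Omega>: "i < m \<Longrightarrow> xh k i \<in> \<Omega> i"
  using esubdiff_ind(1)[OF conjunct1[OF step_v[rule_format, of i k]]] .

lemma xh_carrier: "i < m \<Longrightarrow> xh k i \<in> carrier_vec (nd i)"
  using xh_\<Omega> \<Omega>_carrier by blast

lemma xk_carrier: "i < m \<Longrightarrow> xk k i \<in> carrier_vec (nd i)"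
  by (induction k) (use init_x \<Omega>_carrier step_x xh_carrier in auto)

lemma lk_carrier: "i < m \<Longrightarrow> lk k i \<in> carrier_vec pq"
proof (induction k)
  case (Suc k)
  have "vsum (p + q) m (\<lambda>j. L $$ (i, j) \<cdot>\<^sub>v yh k j) \<in> carrier_vec pq" by (rule carrier_vecI) simp
  then show ?case using Suc step_l by simp
qed (use init_l in simp)

lemma yk_carrier: "i < m \<Longrightarrow> yk k i \<in> carrier_vec pq"
  by (cases k) (use init_y lk_carrier yh_carrier step_y in \<open>auto simp: Kpol_def\<close>)

text \<open>Applying \<open>U^T\<close> to this recursion reproduces the update of
  \<open>\<lambda>\<close>, since \<open>U^T U = L\<close>; it makes explicit the vectors given only
  implicitly by \<open>\<Lambda> = U^T Z\<close>.\<close>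

primrec zk :: "nat \<Rightarrow> real vec" where
  "zk 0 = 0\<^sub>v RZ"
| "zk (Suc k) = zk k + \<beta> \<cdot>\<^sub>v (bU *\<^sub>v stack m (yh k))"

lemma stack_x: "(\<And>i. i < m \<Longrightarrow> w i \<in> carrier_vec (nd i)) \<Longrightarrow> stack m w \<in> carrier_vec N"
  by (rule carrier_vecI) (auto intro!: dim_stack_offs)

lemma stack_y: "(\<And>i. i < m \<Longrightarrow> w i \<in> carrier_vec pq) \<Longrightarrow> stack m w \<in> carrier_vec MY"
  unfolding offs_const[symmetric] by (rule carrier_vecI) (auto intro!: dim_stack_offs)

lemma blx_stack: "(\<And>i. i < m \<Longrightarrow> w i \<in> carrier_vec (nd i)) \<Longrightarrow> i < m \<Longrightarrow> blx i (stack m w) = w i"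
  by (rule blk_stack) auto

lemma bly_stack: "(\<And>i. i < m \<Longrightarrow> w i \<in> carrier_vec pq) \<Longrightarrow> i < m \<Longrightarrow> bly i (stack m w) = w i"
  by (rule blk_stack) auto

lemma zk_carrier: "zk k \<in> carrier_vec RZ"
  by (induction k) (use mult_mat_vec_carrier[OF bU_carrier stack_y[OF yh_carrier]] in auto)

lemma bUT_bU:
  assumes Y: "Y \<in> carrier_vec MY" and i: "i < m"
  shows "bly i (bUT *\<^sub>v (bU *\<^sub>v Y)) = vsum pq m (\<lambda>j. L $$ (i, j) \<cdot>\<^sub>v bly j Y)"
proof (rule eq_vecI)
  fix c assume "c < dim_vec (vsum pq m (\<lambda>j. L $$ (i, j) \<cdot>\<^sub>v bly j Y))"
  then have c: "c < pq" by simp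
  have Lc: "L \<in> carrier_mat m m" using L_UU U_dim UT_dim by simp
  have bUY: "dim_vec (bU *\<^sub>v Y) = RZ" using bU_carrier by simp
  have dY: "dim_vec Y = MY" using Y by simp
  have "comp_vec pq m (bUT *\<^sub>v (bU *\<^sub>v Y)) c = U\<^sup>T *\<^sub>v (U *\<^sub>v comp_vec pq m Y c)"
    unfolding comp_vec_kron_one[OF UT_dim bUY c] comp_vec_kron_one[OF U_dim dY c] ..
  also have "\<dots> = L *\<^sub>v comp_vec pq m Y c" unfolding L_UU assoc_mult_mat_vec[OF UT_dim U_dim comp_vec_carrier] ..
  finally have "comp_vec pq m (bUT *\<^sub>v (bU *\<^sub>v Y)) c $ i = (L *\<^sub>v comp_vec pq m Y c) $ i" by simp
  then have "bly i (bUT *\<^sub>v (bU *\<^sub>v Y)) $ c = (L *\<^sub>v comp_vec pq m Y c) $ i"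
    using i by (simp add: comp_vec_def del: index_blk)
  also have "\<dots> = vsum pq m (\<lambda>j. L $$ (i, j) \<cdot>\<^sub>v bly j Y) $ c"
    using i c Lc by (simp add: comp_vec_def scalar_prod_lessThan)
  finally show "bly i (bUT *\<^sub>v (bU *\<^sub>v Y)) $ c = vsum pq m (\<lambda>j. L $$ (i, j) \<cdot>\<^sub>v bly j Y) $ c" .
qed simp

lemma bUT_zk: "i < m \<Longrightarrow> bly i (bUT *\<^sub>v zk k) = lk k i"
proof (induction k)
  case 0
  have "bUT *\<^sub>v 0\<^sub>v RZ = 0\<^sub>v MY" using bUT_carrier by (intro eq_vecI) auto
  moreover have "bly i (0\<^sub>v MY) = 0\<^sub>v pq" using 0 offs_less[of i m _ "\<lambda>_. pq"] by (auto simp: offs_const)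
  ultimately show ?case using init_l 0 by simp
next
  case (Suc k)
  define Y where "Y = stack m (yh k)"
  have Y: "Y \<in> carrier_vec MY" unfolding Y_def by (rule stack_y[OF yh_carrier])
  have bY: "bU *\<^sub>v Y \<in> carrier_vec RZ" by (rule mult_mat_vec_carrier[OF bU_carrier Y])
  have "bUT *\<^sub>v zk (Suc k) = bUT *\<^sub>v zk k + \<beta> \<cdot>\<^sub>v (bUT *\<^sub>v (bU *\<^sub>v Y))"
    using mult_add_distrib_mat_vec[OF bUT_carrier zk_carrier, of "\<beta> \<cdot>\<^sub>v (bU *\<^sub>v Y)" k] mult_mat_vec[OF bUT_carrier bY] bY
    by (simp flip: Y_def)
  moreover have "dim_vec (bUT *\<^sub>v w) = offs (\<lambda>_. pq) m" for w using bUT_carrier by (simp add: offs_const)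
  ultimately have "bly i (bUT *\<^sub>v zk (Suc k)) = bly i (bUT *\<^sub>v zk k) + \<beta> \<cdot>\<^sub>v bly i (bUT *\<^sub>v (bU *\<^sub>v Y))"
    using Suc.prems by (simp add: blk_add[of _ _ m] blk_smult[of _ _ m] del: dim_mult_mat_vec)
  also have "\<dots> = lk k i + \<beta> \<cdot>\<^sub>v vsum pq m (\<lambda>j. L $$ (i, j) \<cdot>\<^sub>v bly j Y)"
    using Suc bUT_bU[OF Y] by simp
  also have "vsum pq m (\<lambda>j. L $$ (i, j) \<cdot>\<^sub>v bly j Y) = vsum pq m (\<lambda>j. L $$ (i, j) \<cdot>\<^sub>v yh k j)"
    using bly_stack[OF yh_carrier] by (simp add: vsum_def Y_def)
  finally show ?case using step_l Suc.prems by simp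
qed

lemma stack_lk: "stack m (lk k) = bUT *\<^sub>v zk k"
proof (rule vec_eq_blkI[of _ "\<lambda>_. pq" m])
  show "dim_vec (stack m (lk k)) = offs (\<lambda>_. pq) m" using stack_y[OF lk_carrier] by (simp add: offs_const)
  show "dim_vec (bUT *\<^sub>v zk k) = offs (\<lambda>_. pq) m" using bUT_carrier by (simp add: offs_const)
  show "bly i (stack m (lk k)) = bly i (bUT *\<^sub>v zk k)" if "i < m" for i
    unfolding bUT_zk[OF that] using that by (intro bly_stack lk_carrier)
qed

lemma the_zk: "(THE Z. Z \<in> carrier_vec RZ \<and> stack m (lk k) = bUT *\<^sub>v Z) = zk k"
  using stack_lk zk_carrier kron_transpose_inj[OF U_dim U_rank _ zk_carrier]
  by (intro the_equality) auto

text \<open>The stationarity lemma with \<open>yk - \<gamma> lk\<close> in place of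
  \<open>y\<close>: the projected multiplier it produces is exactly the \<open>yh\<close> of the
  algorithm, so the augmented term becomes the plain Lagrangian term \<open>yh . G\<close>.\<close>

lemma prox_x:
  assumes i: "i < m" and x: "x \<in> \<Omega> i"
  shows "f i (xh k i) + yh k i \<bullet> G i (xh k i) + (vk k i + (1 / \<alpha> i) \<cdot>\<^sub>v (xk k i - xh k i)) \<bullet> (x - xh k i)
    \<le> f i x + yh k i \<bullet> G i x"
  unfolding step_yh[rule_format, OF i]
proof (rule prox_step_stationary[where \<Omega> = "\<Omega> i" and d = "nd i"])
  show "vconvex_set (nd i) (\<Omega> i)" "vconvex_fun (nd i) (f i)" "K_convex p q (nd i) (G i)"
    using \<Omega>_cvx f_cvx i G_K_convex by (auto simp: proper_closed_convex_def)
  show "yk k i - \<gamma> i \<cdot>\<^sub>v lk k i \<in> carrier_vec pq" using lk_carrier[OF i] yk_carrier[OF i] by auto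
  fix w assume w: "w \<in> \<Omega> i"
  then show "f i (xh k i) + 1 / (2 * \<gamma> i) *
      (projK p q (yk k i - \<gamma> i \<cdot>\<^sub>v lk k i + \<gamma> i \<cdot>\<^sub>v G i (xh k i)) \<bullet> projK p q (yk k i - \<gamma> i \<cdot>\<^sub>v lk k i + \<gamma> i \<cdot>\<^sub>v G i (xh k i))
        - (yk k i - \<gamma> i \<cdot>\<^sub>v lk k i) \<bullet> (yk k i - \<gamma> i \<cdot>\<^sub>v lk k i))
      + 1 / (2 * \<alpha> i) * ((xh k i - xk k i) \<bullet> (xh k i - xk k i)) + vk k i \<bullet> (w - xh k i)
    \<le> f i w + 1 / (2 * \<gamma> i) *
      (projK p q (yk k i - \<gamma> i \<cdot>\<^sub>v lk k i + \<gamma> i \<cdot>\<^sub>v G i w) \<bullet> projK p q (yk k i - \<gamma> i \<cdot>\<^sub>v lk k i + \<gamma> i \<cdot>\<^sub>v G i w)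
        - (yk k i - \<gamma> i \<cdot>\<^sub>v lk k i) \<bullet> (yk k i - \<gamma> i \<cdot>\<^sub>v lk k i))
      + 1 / (2 * \<alpha> i) * ((w - xk k i) \<bullet> (w - xk k i))"
    using \<Omega>_carrier[OF i w] by (rule esubdiff_ind(2)[OF conjunct1[OF step_v[rule_format, OF i, of k]]])
qed (use i x \<alpha>_pos \<gamma>_pos xk_carrier vk_carrier xh_\<Omega> in auto)

text \<open>The projection inequality that characterises \<open>yh\<close>, divided by
  \<open>\<gamma> i\<close>. Together with \<open>prox_x\<close> it expresses the first two blocks
  of the inclusion of \<open>Q d + V\<close> in variational form.\<close>

lemma prox_y:
  assumes i: "i < m" and y: "y \<in> Kpol p q"
  shows "(y - yh k i) \<bullet> ((1 / \<gamma> i) \<cdot>\<^sub>v (yk k i - yh k i) - lk k i + G i (xh k i)) \<le> 0"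
proof -
  have \<gamma>: "0 < \<gamma> i" using \<gamma>_pos i by simp
  define w where "w = yk k i - \<gamma> i \<cdot>\<^sub>v lk k i + \<gamma> i \<cdot>\<^sub>v G i (xh k i)"
  have G: "G i (xh k i) \<in> carrier_vec pq" by (rule G_carrier[OF i xh_carrier[OF i]])
  note c = yk_carrier[OF i, of k] lk_carrier[OF i, of k] G yh_carrier[OF i, of k]
  have w: "w \<in> carrier_vec pq" using c by (simp add: w_def)
  have "w - yh k i = \<gamma> i \<cdot>\<^sub>v ((1 / \<gamma> i) \<cdot>\<^sub>v (yk k i - yh k i) - lk k i + G i (xh k i))"
    using c \<gamma> by (intro eq_vecI) (auto simp: w_def field_simps)
  moreover have "(w - yh k i) \<bullet> (y - yh k i) \<le> 0"
    using projK_variational[OF w y] step_yh i by (simp add: w_def)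
  ultimately have "\<gamma> i * (((1 / \<gamma> i) \<cdot>\<^sub>v (yk k i - yh k i) - lk k i + G i (xh k i)) \<bullet> (y - yh k i)) \<le> 0"
    using c dim_Kpol[OF y] by (simp add: sp_smult_left)
  then have "((1 / \<gamma> i) \<cdot>\<^sub>v (yk k i - yh k i) - lk k i + G i (xh k i)) \<bullet> (y - yh k i) \<le> 0"
    using \<gamma> by (simp add: mult_le_0_iff)
  then show ?thesis using c dim_Kpol[OF y]
    by (subst sp_comm) auto
qed

lemma blk_stacks:
  assumes "i < m"
  shows "blx i (stack m (xk k)) = xk k i" "blx i (stack m (xh k)) = xh k i" "blx i (stack m (vk k)) = vk k i"
    "bly i (stack m (yk k)) = yk k i" "bly i (stack m (yh k)) = yh k i"
  using assms by (auto intro!: blx_stack bly_stack xk_carrier xh_carrier vk_carrier yk_carrier yh_carrier simp del: index_blk)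

section \<open>The relaxed step and the descent inequality\<close>

abbreviation "\<xi> k \<equiv> stack m (xk k) @\<^sub>v stack m (yk k) @\<^sub>v zk k"
abbreviation "\<xi>h k \<equiv> stack m (xh k) @\<^sub>v stack m (yh k) @\<^sub>v zk (Suc k)"
abbreviation "V k \<equiv> stack m (vk k) @\<^sub>v 0\<^sub>v MY @\<^sub>v 0\<^sub>v RZ"

lemma stack_carriers:
  "stack m (xk k) \<in> carrier_vec N" "stack m (xh k) \<in> carrier_vec N" "stack m (vk k) \<in> carrier_vec N"
  "stack m (yk k) \<in> carrier_vec MY" "stack m (yh k) \<in> carrier_vec MY"
  by (auto intro: stack_x stack_y xk_carrier xh_carrier vk_carrier yk_carrier yh_carrier)

lemma \<xi>_carrier: "\<xi> k \<in> carrier_vec T"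
  by (intro append_carrier_vec stack_carriers zk_carrier)

lemma \<xi>h_carrier: "\<xi>h k \<in> carrier_vec T"
  by (rule append_carrier_vec[OF stack_carriers(2) append_carrier_vec[OF stack_carriers(5) zk_carrier]])

lemma append3_minus:
  fixes a u c :: "real vec"
  assumes "a \<in> carrier_vec N" "u \<in> carrier_vec MY" "c \<in> carrier_vec RZ"
    "a' \<in> carrier_vec N" "u' \<in> carrier_vec MY" "c' \<in> carrier_vec RZ"
  shows "(a @\<^sub>v u @\<^sub>v c) - (a' @\<^sub>v u' @\<^sub>v c') = (a - a') @\<^sub>v (u - u') @\<^sub>v (c - c')"
  using append_vec_minus[OF assms(1,4) append_carrier_vec[OF assms(2,3)] append_carrier_vec[OF assms(5,6)]]
    append_vec_minus[OF assms(2,5,3,6)] by simp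

lemma \<xi>_diff: "\<xi> k - \<xi>h k = (stack m (xk k) - stack m (xh k)) @\<^sub>v (stack m (yk k) - stack m (yh k)) @\<^sub>v (zk k - zk (Suc k))"
  by (rule append3_minus[OF stack_carriers(1) stack_carriers(4) zk_carrier stack_carriers(2) stack_carriers(5) zk_carrier])

lemma bly_bUT_minus:
  assumes "z \<in> carrier_vec RZ" "z' \<in> carrier_vec RZ" "i < m"
  shows "bly i (bUT *\<^sub>v (z - z')) = bly i (bUT *\<^sub>v z) - bly i (bUT *\<^sub>v z')"
  unfolding mult_minus_distrib_mat_vec[OF bUT_carrier assms(1,2)]
  using bUT_carrier assms by (intro blk_minus[of _ _ m]) (auto simp: offs_const)

text \<open>The block \<open>-\<Gamma> U^T\<close> of \<open>M\<close>, applied to the change of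
  \<open>Z\<close>, is the correction of \<open>y\<close> by the change of \<open>\<lambda>\<close>;
  the \<open>x\<close> block is the relaxation by \<open>\<theta>\<close>.\<close>

lemma relaxation_step: "\<xi> (Suc k) = \<xi> k - M *\<^sub>v (\<xi> k - \<xi>h k)"
proof -
  note sc = stack_carriers(1)[of k] stack_carriers(2)[of k] stack_carriers(4)[of k] stack_carriers(5)[of k]
    stack_carriers(1)[of "Suc k"] stack_carriers(4)[of "Suc k"]
  define dx where "dx = stack m (xk k) - stack m (xh k)"
  define dy where "dy = stack m (yk k) - stack m (yh k)"
  define dz where "dz = zk k - zk (Suc k)"
  have d: "dx \<in> carrier_vec N" "dy \<in> carrier_vec MY" "dz \<in> carrier_vec RZ"
    unfolding dx_def dy_def dz_def using sc zk_carrier[of k] zk_carrier[of "Suc k"] by (auto simp del: zk.simps)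
  define w where "w = by_diag \<gamma> *\<^sub>v (bUT *\<^sub>v dz)"
  have w: "w \<in> carrier_vec MY" unfolding w_def by (rule bdiag_mult_carrier(1)[OF bUT_c[OF d]])
  have tx: "bdiag m nd \<theta> *\<^sub>v dx \<in> carrier_vec N" by (rule bdiag_mult_carrier(2)[OF d(1)])
  have dyw: "dy - w \<in> carrier_vec MY" using d w by simp
  have "\<xi> k - M *\<^sub>v (\<xi> k - \<xi>h k) = (stack m (xk k) - bdiag m nd \<theta> *\<^sub>v dx) @\<^sub>v (stack m (yk k) - (dy - w)) @\<^sub>v (zk k - dz)"
    unfolding \<xi>_diff dx_def[symmetric] dy_def[symmetric] dz_def[symmetric] M_mult[OF d] w_def[symmetric]
    by (rule append3_minus[OF sc(1) sc(3) zk_carrier tx dyw d(3)])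
  also have "stack m (xk k) - bdiag m nd \<theta> *\<^sub>v dx = stack m (xk (Suc k))"
  proof (rule vec_eq_blkI[of _ nd m])
    fix i assume i: "i < m"
    have "blx i (stack m (xk k) - bdiag m nd \<theta> *\<^sub>v dx) = xk k i - \<theta> i \<cdot>\<^sub>v (xk k i - xh k i)"
      using i d sc by (simp add: blk_minus[of _ _ m] blk_bdiag dx_def blx_stack[OF xk_carrier] blx_stack[OF xh_carrier])
    also have "\<dots> = xk (Suc k) i"
      using step_x i xk_carrier[OF i, of k] xh_carrier[OF i, of k] by (auto simp: algebra_simps)
    finally show "blx i (stack m (xk k) - bdiag m nd \<theta> *\<^sub>v dx) = blx i (stack m (xk (Suc k)))"
      using blx_stack[OF xk_carrier i] by simp
  qed (use sc d in auto)
  also have "stack m (yk k) - (dy - w) = stack m (yk (Suc k))"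
  proof (rule vec_eq_blkI[of _ "\<lambda>_. pq" m])
    fix i assume i: "i < m"
    have c: "dim_vec dy = offs (\<lambda>_. pq) m" "dim_vec w = offs (\<lambda>_. pq) m" "dim_vec (stack m (yh k)) = offs (\<lambda>_. pq) m"
      "dim_vec (bUT *\<^sub>v dz) = offs (\<lambda>_. pq) m"
      using d w sc bUT_carrier by (auto simp: offs_const)
    have "bly i (bUT *\<^sub>v dz) = lk k i - lk (Suc k) i"
      unfolding dz_def bly_bUT_minus[OF zk_carrier zk_carrier i] bUT_zk[OF i] ..
    then have "bly i w = \<gamma> i \<cdot>\<^sub>v (lk k i - lk (Suc k) i)" unfolding w_def by (simp add: blk_bdiag[OF c(4) i])
    moreover have "bly i dy = yk k i - yh k i"
      unfolding dy_def using i c(3) by (simp add: blk_minus[of _ _ m] bly_stack[OF yk_carrier] bly_stack[OF yh_carrier])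
    moreover have "bly i (stack m (yk k) - (dy - w)) = bly i (stack m (yk k)) - (bly i dy - bly i w)"
      using i c by (simp add: blk_minus[of _ _ m])
    ultimately have "bly i (stack m (yk k) - (dy - w)) = yk k i - ((yk k i - yh k i) - \<gamma> i \<cdot>\<^sub>v (lk k i - lk (Suc k) i))"
      using bly_stack[OF yk_carrier i] by simp
    also have "\<dots> = yk (Suc k) i"
      unfolding step_y[rule_format, OF i] using yk_carrier[OF i, of k] yh_carrier[OF i, of k] lk_carrier[OF i, of k] lk_carrier[OF i, of "Suc k"]
      by (intro eq_vecI) auto
    finally show "bly i (stack m (yk k) - (dy - w)) = bly i (stack m (yk (Suc k)))"
      using bly_stack[OF yk_carrier i] by simp
  qed (use sc w in \<open>auto simp: offs_const\<close>)
  also have "zk k - dz = zk (Suc k)"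
    unfolding dz_def using zk_carrier[of k] zk_carrier[of "Suc k"] by (intro eq_vecI) (auto simp del: zk.simps)
  finally show ?thesis ..
qed

text \<open>For each agent four inequalities are added: both minimality statements, each tested at
  the other's point, and both normal-cone statements likewise. All values of \<open>f\<close> and
  \<open>G\<close> cancel.\<close>

lemma residual_monotone:
  assumes xs: "xs \<in> carrier_vec N" and Ys: "Ys \<in> carrier_vec MY" and Zs: "Zs \<in> carrier_vec RZ"
    and zero: "xs @\<^sub>v Ys @\<^sub>v Zs \<in> Phi0"
  shows "0 \<le> (\<Sum>i<m. (xh k i - blx i xs) \<bullet> (vk k i + (1 / \<alpha> i) \<cdot>\<^sub>v (xk k i - xh k i)))
    + (\<Sum>i<m. (yh k i - bly i Ys) \<bullet> ((1 / \<gamma> i) \<cdot>\<^sub>v (yk k i - yh k i) - lk k i + bly i (bUT *\<^sub>v Zs)))"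
proof -
  have "0 \<le> (xh k i - blx i xs) \<bullet> (vk k i + (1 / \<alpha> i) \<cdot>\<^sub>v (xk k i - xh k i))
    + (yh k i - bly i Ys) \<bullet> ((1 / \<gamma> i) \<cdot>\<^sub>v (yk k i - yh k i) - lk k i + bly i (bUT *\<^sub>v Zs))" if i: "i < m" for i
  proof -
    define l where "l = bly i (bUT *\<^sub>v Zs)"
    define x' where "x' = blx i xs"
    define y' where "y' = bly i Ys"
    define e where "e = vk k i + (1 / \<alpha> i) \<cdot>\<^sub>v (xk k i - xh k i)"
    define d where "d = (1 / \<gamma> i) \<cdot>\<^sub>v (yk k i - yh k i) - lk k i"
    have \<Phi>: "x' \<in> \<Omega> i" "y' \<in> Kpol p q" "f i x' + y' \<bullet> G i x' \<le> f i (xh k i) + y' \<bullet> G i (xh k i)"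
      "(yh k i - y') \<bullet> (G i x' - l) \<le> 0"
      using zero xh_\<Omega>[OF i] yh_Kpol[OF i] i unfolding PhiZero_iff[OF xs Ys Zs] x'_def y'_def l_def by blast+
    have 1: "f i (xh k i) + yh k i \<bullet> G i (xh k i) + e \<bullet> (x' - xh k i) \<le> f i x' + yh k i \<bullet> G i x'"
      unfolding e_def by (rule prox_x[OF i \<Phi>(1)])
    have 2: "(y' - yh k i) \<bullet> (d + G i (xh k i)) \<le> 0" unfolding d_def by (rule prox_y[OF i \<Phi>(2)])
    have dims: "dim_vec x' = nd i" "dim_vec y' = pq" "dim_vec (xh k i) = nd i" "dim_vec (yh k i) = pq" "dim_vec e = nd i"
      "dim_vec d = pq" "dim_vec l = pq" "dim_vec (G i x') = pq" "dim_vec (G i (xh k i)) = pq"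
      using xh_carrier[OF i, of k] yh_carrier[OF i, of k] xk_carrier[OF i, of k] lk_carrier[OF i, of k]
        G_carrier[OF i \<Omega>_carrier[OF i \<Phi>(1)]] G_carrier[OF i xh_carrier[OF i, of k]]
      by (simp_all add: x'_def y'_def l_def e_def d_def)
    have "e \<bullet> (x' - xh k i) = - ((xh k i - x') \<bullet> e)" using dims by (simp add: sp_simps sp_comm[of e])
    then show ?thesis unfolding l_def[symmetric] x'_def[symmetric] y'_def[symmetric] e_def[symmetric] d_def[symmetric]
      using \<Phi>(3,4) 1 2 dims by (simp add: sp_simps)
  qed
  then show ?thesis unfolding sum.distrib[symmetric] by (intro sum_nonneg) auto
qed

text \<open>The \<open>Z\<close> block of \<open>Q d\<close> is \<open>-U Yh\<close>, by the dual
  update. Consensus of \<open>Ys\<close> allows \<open>Yh\<close> to be replaced by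
  \<open>Yh - Ys\<close>, and moving \<open>U\<close> to the other side merges this block into the
  \<open>Y\<close> block.\<close>

lemma residual_inner:
  assumes xs: "xs \<in> carrier_vec N" and Ys: "Ys \<in> carrier_vec MY" and Zs: "Zs \<in> carrier_vec RZ"
    and UY: "bU *\<^sub>v Ys = 0\<^sub>v RZ"
  shows "(\<xi>h k - (xs @\<^sub>v Ys @\<^sub>v Zs)) \<bullet> (Q *\<^sub>v (\<xi> k - \<xi>h k) + V k)
    = (\<Sum>i<m. (xh k i - blx i xs) \<bullet> (vk k i + (1 / \<alpha> i) \<cdot>\<^sub>v (xk k i - xh k i)))
    + (\<Sum>i<m. (yh k i - bly i Ys) \<bullet> ((1 / \<gamma> i) \<cdot>\<^sub>v (yk k i - yh k i) - lk k i + bly i (bUT *\<^sub>v Zs)))"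
proof -
  note sc = stack_carriers(1)[of k] stack_carriers(2)[of k] stack_carriers(3)[of k] stack_carriers(4)[of k] stack_carriers(5)[of k]
  define Xh Yh z z' where "Xh = stack m (xh k)" and "Yh = stack m (yh k)" and "z = zk k" and "z' = zk (Suc k)"
  define dx dy where "dx = stack m (xk k) - Xh" and "dy = stack m (yk k) - Yh"
  have zc: "z \<in> carrier_vec RZ" "z' \<in> carrier_vec RZ" unfolding z_def z'_def by (rule zk_carrier)+
  have c: "Xh \<in> carrier_vec N" "Yh \<in> carrier_vec MY" "dx \<in> carrier_vec N" "dy \<in> carrier_vec MY" "z - z' \<in> carrier_vec RZ"
    using sc zc by (auto simp: Xh_def Yh_def dx_def dy_def)
  define qx qy where "qx = bdiag m nd (\<lambda>i. 1 / \<alpha> i) *\<^sub>v dx" and "qy = by_diag (\<lambda>i. 1 / \<gamma> i) *\<^sub>v dy"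
  define w where "w = bUT *\<^sub>v (z - z')"
  have q: "qx \<in> carrier_vec N" "qy \<in> carrier_vec MY" "w \<in> carrier_vec MY"
    unfolding qx_def qy_def w_def using c by (auto intro: bdiag_mult_carrier bUT_c)
  have dd: "\<xi> k - \<xi>h k = dx @\<^sub>v dy @\<^sub>v (z - z')"
    unfolding dx_def dy_def Xh_def Yh_def z_def z'_def by (rule \<xi>_diff)
  have "Q *\<^sub>v (\<xi> k - \<xi>h k) = qx @\<^sub>v (qy - w) @\<^sub>v ((1 / \<beta>) \<cdot>\<^sub>v (z - z'))"
    unfolding dd Q_mult[OF c(3-5)] qx_def qy_def w_def ..
  moreover have "(qx @\<^sub>v (qy - w) @\<^sub>v ((1 / \<beta>) \<cdot>\<^sub>v (z - z'))) + V k = (qx + stack m (vk k)) @\<^sub>v (qy - w) @\<^sub>v ((1 / \<beta>) \<cdot>\<^sub>v (z - z'))"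
    using q zc sc(3) by (intro eq_vecI) auto
  moreover have "\<xi>h k - (xs @\<^sub>v Ys @\<^sub>v Zs) = (Xh - xs) @\<^sub>v (Yh - Ys) @\<^sub>v (z' - Zs)"
    unfolding Xh_def Yh_def z'_def by (rule append3_minus[OF sc(2) sc(5) zk_carrier xs Ys Zs])
  ultimately have "(\<xi>h k - (xs @\<^sub>v Ys @\<^sub>v Zs)) \<bullet> (Q *\<^sub>v (\<xi> k - \<xi>h k) + V k)
      = (Xh - xs) \<bullet> (qx + stack m (vk k)) + (Yh - Ys) \<bullet> (qy - w) + (z' - Zs) \<bullet> ((1 / \<beta>) \<cdot>\<^sub>v (z - z'))"
    using c q sc(3) zc xs Ys Zs by (simp only:) (subst sp_split; simp)
  moreover have "(z' - Zs) \<bullet> ((1 / \<beta>) \<cdot>\<^sub>v (z - z')) = - ((Yh - Ys) \<bullet> (bUT *\<^sub>v (z' - Zs)))"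
  proof -
    have bY: "bU *\<^sub>v Yh \<in> carrier_vec RZ" by (rule mult_mat_vec_carrier[OF bU_carrier c(2)])
    have "bU *\<^sub>v (Yh - Ys) = bU *\<^sub>v Yh"
      unfolding mult_minus_distrib_mat_vec[OF bU_carrier c(2) Ys] UY using bY by simp
    moreover have "(1 / \<beta>) \<cdot>\<^sub>v (z - z') = (- 1) \<cdot>\<^sub>v (bU *\<^sub>v Yh)"
      using \<beta>_pos zc(1) carrier_vecD[OF bY] unfolding z'_def z_def zk.simps Yh_def[symmetric]
      by (intro eq_vecI) (auto simp del: dim_mult_mat_vec)
    ultimately have "(z' - Zs) \<bullet> ((1 / \<beta>) \<cdot>\<^sub>v (z - z')) = - ((z' - Zs) \<bullet> (bU *\<^sub>v (Yh - Ys)))" by (simp add: sp_smult_right)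
    also have "(z' - Zs) \<bullet> (bU *\<^sub>v (Yh - Ys)) = (bUT *\<^sub>v (z' - Zs)) \<bullet> (Yh - Ys)"
      using sp_transpose[OF bU_carrier, of "Yh - Ys" "z' - Zs"] bU_transpose c Ys zc Zs by simp
    also have "\<dots> = (Yh - Ys) \<bullet> (bUT *\<^sub>v (z' - Zs))"
      using bUT_carrier c Ys by (intro sp_comm) simp
    finally show ?thesis .
  qed
  moreover have "(Yh - Ys) \<bullet> (qy - w) - (Yh - Ys) \<bullet> (bUT *\<^sub>v (z' - Zs))
      = (\<Sum>i<m. (yh k i - bly i Ys) \<bullet> ((1 / \<gamma> i) \<cdot>\<^sub>v (yk k i - yh k i) - lk k i + bly i (bUT *\<^sub>v Zs)))"
  proof -
    \<comment> \<open>The new multiplier \<open>lk (Suc k)\<close> occurs in both \<open>w\<close>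
      and the transposed term and drops out, leaving \<open>- lk k\<close> plus the multiplier of
      the zero.\<close>
    define u where "u = qy - w - bUT *\<^sub>v (z' - Zs)"
    have du: "dim_vec (bUT *\<^sub>v (z' - Zs)) = offs (\<lambda>_. pq) m" "dim_vec qy = offs (\<lambda>_. pq) m" "dim_vec w = offs (\<lambda>_. pq) m"
      "dim_vec dy = offs (\<lambda>_. pq) m" "dim_vec Ys = offs (\<lambda>_. pq) m" "dim_vec Yh = offs (\<lambda>_. pq) m"
      using bUT_carrier q c Ys by (auto simp: offs_const)
    have "(Yh - Ys) \<bullet> (qy - w) - (Yh - Ys) \<bullet> (bUT *\<^sub>v (z' - Zs)) = (Yh - Ys) \<bullet> u"
      unfolding u_def using du by (subst (2) sp_minus_right) auto
    also have "\<dots> = (\<Sum>i<m. bly i (Yh - Ys) \<bullet> bly i u)" using du by (intro sp_blocks) (simp add: u_def)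
    also have "\<dots> = (\<Sum>i<m. (yh k i - bly i Ys) \<bullet> ((1 / \<gamma> i) \<cdot>\<^sub>v (yk k i - yh k i) - lk k i + bly i (bUT *\<^sub>v Zs)))"
    proof (intro sum.cong refl arg_cong2[where f = scalar_prod])
      fix i assume "i \<in> {..<m}"
      then have i: "i < m" by simp
      show "bly i (Yh - Ys) = yh k i - bly i Ys"
        unfolding blk_minus[OF du(5) i] unfolding Yh_def blk_stacks[OF i] ..
      have 1: "bly i qy = (1 / \<gamma> i) \<cdot>\<^sub>v (yk k i - yh k i)"
      proof -
        have "bly i dy = yk k i - yh k i" unfolding dy_def unfolding blk_minus[OF du(6) i] unfolding Yh_def blk_stacks[OF i] ..
        then show ?thesis unfolding qy_def blk_bdiag[OF du(4) i] by simp
      qed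
      have 2: "bly i w = lk k i - lk (Suc k) i"
        unfolding w_def bly_bUT_minus[OF zc i] unfolding z_def z'_def bUT_zk[OF i] ..
      have 3: "bly i (bUT *\<^sub>v (z' - Zs)) = lk (Suc k) i - bly i (bUT *\<^sub>v Zs)"
        unfolding bly_bUT_minus[OF zc(2) Zs i] unfolding z'_def bUT_zk[OF i] ..
      have "bly i u = bly i qy - bly i w - bly i (bUT *\<^sub>v (z' - Zs))"
        unfolding u_def using i du by (simp add: blk_minus[of _ _ m] del: dim_mult_mat_vec)
      then show "bly i u = (1 / \<gamma> i) \<cdot>\<^sub>v (yk k i - yh k i) - lk k i + bly i (bUT *\<^sub>v Zs)"
        unfolding 1 2 3 using lk_carrier[OF i, of k] lk_carrier[OF i, of "Suc k"] yk_carrier[OF i, of k] yh_carrier[OF i, of k]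
        by (intro eq_vecI) (auto simp del: index_blk)
    qed
    finally show ?thesis .
  qed
  moreover have "(Xh - xs) \<bullet> (qx + stack m (vk k)) = (\<Sum>i<m. (xh k i - blx i xs) \<bullet> (vk k i + (1 / \<alpha> i) \<cdot>\<^sub>v (xk k i - xh k i)))"
  proof -
    have "(Xh - xs) \<bullet> (qx + stack m (vk k)) = (\<Sum>i<m. blx i (Xh - xs) \<bullet> blx i (qx + stack m (vk k)))"
      using q sc(3) by (intro sp_blocks) simp
    also have "\<dots> = (\<Sum>i<m. (xh k i - blx i xs) \<bullet> (vk k i + (1 / \<alpha> i) \<cdot>\<^sub>v (xk k i - xh k i)))"
    proof (intro sum.cong refl arg_cong2[where f = scalar_prod])
      fix i assume "i \<in> {..<m}"
      then have i: "i < m" by simp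
      show "blx i (Xh - xs) = xh k i - blx i xs"
        unfolding blk_minus[OF carrier_vecD[OF xs] i] unfolding Xh_def blk_stacks[OF i] ..
      have "blx i qx = (1 / \<alpha> i) \<cdot>\<^sub>v (xk k i - xh k i)"
      proof -
        have "blx i dx = xk k i - xh k i"
          unfolding dx_def unfolding blk_minus[OF carrier_vecD[OF c(1)] i] unfolding Xh_def blk_stacks[OF i] ..
        then show ?thesis unfolding qx_def blk_bdiag[OF carrier_vecD[OF c(3)] i] by simp
      qed
      then show "blx i (qx + stack m (vk k)) = vk k i + (1 / \<alpha> i) \<cdot>\<^sub>v (xk k i - xh k i)"
        unfolding blk_add[OF carrier_vecD[OF sc(3)] i] blk_stacks[OF i]
        using vk_carrier[OF i, of k] xk_carrier[OF i, of k] xh_carrier[OF i, of k]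
        by (simp add: comm_add_vec[of _ "nd i"])
    qed
    finally show ?thesis .
  qed
  ultimately show ?thesis by linarith
qed

lemma V_carrier: "V k \<in> carrier_vec T"
  by (rule append_carrier_vec[OF stack_carriers(3) append_carrier_vec[OF zero_carrier_vec zero_carrier_vec]])

theorem descent:
  assumes zero: "\<xi>s \<in> Phi0" and \<xi>s: "\<xi>s \<in> carrier_vec T"
  shows "qn H (\<xi> (Suc k) - \<xi>s) \<le> qn H (\<xi> k - \<xi>s) - qn D (\<xi> k - \<xi>h k) + 2 * ((\<xi>h k - \<xi>s) \<bullet> V k)"
proof -
  obtain xs Ys Zs where s: "xs \<in> carrier_vec N" "Ys \<in> carrier_vec MY" "Zs \<in> carrier_vec RZ" "\<xi>s = xs @\<^sub>v Ys @\<^sub>v Zs"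
    using \<xi>s by (rule split_T)
  define e d where "e = \<xi> k - \<xi>s" and "d = \<xi> k - \<xi>h k"
  have ed: "e \<in> carrier_vec T" "d \<in> carrier_vec T"
    unfolding e_def d_def using \<xi>_carrier[of k] \<xi>h_carrier[of k] \<xi>s by (auto simp del: zk.simps)
  have Md: "M *\<^sub>v d \<in> carrier_vec T" and Qd: "Q *\<^sub>v d \<in> carrier_vec T" using M_carrier Q_carrier ed by auto
  have "\<xi> (Suc k) - \<xi>s = e - M *\<^sub>v d"
    unfolding relaxation_step[of k] d_def[symmetric] e_def using \<xi>_carrier[of k] \<xi>s Md carrier_vecD[OF Md]
    by (intro eq_vecI) (auto simp del: dim_mult_mat_vec)
  moreover have ed': "e - d = \<xi>h k - \<xi>s"
    unfolding e_def d_def using carrier_vecD[OF \<xi>_carrier[of k]] carrier_vecD[OF \<xi>h_carrier[of k]] carrier_vecD[OF \<xi>s]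
    by (intro eq_vecI) (auto simp del: zk.simps index_append_vec)
  moreover have "0 \<le> (\<xi>h k - \<xi>s) \<bullet> (Q *\<^sub>v d + V k)"
    unfolding d_def s(4) using residual_monotone[OF s(1-3)] residual_inner[OF s(1-3)] zero
    unfolding s(4) PhiZero_iff[OF s(1-3)] by simp
  moreover have "(\<xi>h k - \<xi>s) \<bullet> (Q *\<^sub>v d + V k) = (\<xi>h k - \<xi>s) \<bullet> (Q *\<^sub>v d) + (\<xi>h k - \<xi>s) \<bullet> V k"
    using carrier_vecD[OF Qd] carrier_vecD[OF V_carrier[of k]] by (intro sp_add_right) simp
  ultimately show ?thesis using relaxation_identity[OF ed] unfolding d_def[symmetric] e_def[symmetric] by simp
qed

end

section \<open>Fejer monotonicity, cluster points and convergence\<close>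

lemma vconv_zeroI:
  assumes "\<And>k. s k \<in> carrier_vec n" "(\<lambda>k. vnorm (s k)) \<longlonglongrightarrow> 0"
  shows "vconv s (0\<^sub>v n)"
proof -
  have "s k - 0\<^sub>v n = s k" for k using assms(1)[of k] by auto
  then show ?thesis using assms unfolding vconv_def by auto
qed

context dpmm_iteration
begin

text \<open>Only the \<open>x\<close> part of \<open>V\<close> is nonzero, so \<open>xh\<close>
  alone has to be estimated. The sum of two consecutive distances on the right is there to cancel
  against a difference of squares later.\<close>

lemma perturbation_bound:
  assumes \<kappa>: "0 < \<kappa>" "\<forall>v\<in>carrier_vec T. \<kappa> * (v \<bullet> v) \<le> qn H v" and \<xi>s: "\<xi>s \<in> carrier_vec T"
  shows "2 * ((\<xi>h k - \<xi>s) \<bullet> V k) \<le> (\<Sum>i<m. 2 / (\<theta> i * sqrt \<kappa>) * eps i k) *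
    (sqrt (qn H (\<xi> (Suc k) - \<xi>s)) + sqrt (qn H (\<xi> k - \<xi>s)))"
proof -
  obtain xs Ys Zs where s: "xs \<in> carrier_vec N" "Ys \<in> carrier_vec MY" "Zs \<in> carrier_vec RZ" and eq: "\<xi>s = xs @\<^sub>v Ys @\<^sub>v Zs"
    using \<xi>s by (rule split_T)
  define h where "h k = sqrt (qn H (\<xi> k - \<xi>s))" for k
  have bnd: "vnorm (xk k i - blx i xs) \<le> h k / sqrt \<kappa>" if i: "i < m" for i k
  proof -
    define a u c where "a = stack m (xk k) - xs" and "u = stack m (yk k) - Ys" and "c = zk k - Zs"
    have auc: "a \<in> carrier_vec N" "u \<in> carrier_vec MY" "c \<in> carrier_vec RZ"
      unfolding a_def u_def c_def using stack_carriers zk_carrier s by auto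
    have d: "\<xi> k - \<xi>s = a @\<^sub>v u @\<^sub>v c"
      unfolding a_def u_def c_def eq by (rule append3_minus[OF stack_carriers(1) stack_carriers(4) zk_carrier s])
    have v: "a @\<^sub>v u @\<^sub>v c \<in> carrier_vec T" using auc by (intro append_carrier_vec)
    have "xk k i - blx i xs = blx i a" unfolding a_def using i s by (simp add: blk_minus[of _ _ m] blk_stacks)
    also have "vnorm \<dots> \<le> vnorm a" using auc i by (intro vnorm_blk_le) auto
    also have "\<dots> \<le> sqrt ((a @\<^sub>v u @\<^sub>v c) \<bullet> (a @\<^sub>v u @\<^sub>v c))"
      unfolding sp_split[OF auc auc] vnorm_def by (simp add: sp_self_nonneg)
    also have "\<dots> \<le> sqrt (qn H (a @\<^sub>v u @\<^sub>v c) / \<kappa>)"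
      using \<kappa> bspec[OF \<kappa>(2) v] by (simp add: pos_le_divide_eq mult.commute)
    finally show ?thesis unfolding h_def d by (simp add: real_sqrt_divide)
  qed
  have xhb: "vnorm (xh k i - blx i xs) \<le> 1 / \<theta> i * ((h (Suc k) + h k) / sqrt \<kappa>)" if i: "i < m" for i
  proof -
    have \<theta>: "0 < \<theta> i" "\<theta> i < 2" using \<theta>_rng i by auto
    have c: "xk k i \<in> carrier_vec (nd i)" "xh k i \<in> carrier_vec (nd i)" "xk (Suc k) i \<in> carrier_vec (nd i)"
      using i xk_carrier xh_carrier by auto
    \<comment> \<open>Solve the relaxation step for \<open>xh\<close>. The factor
      \<open>\<theta> i - 1\<close> has modulus less than 1 because
      \<open>0 < \<theta> i < 2\<close>, so both distances get the weight
      \<open>1 / \<theta> i\<close>.\<close>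
    have "xh k i - blx i xs = (1 / \<theta> i) \<cdot>\<^sub>v ((xk (Suc k) i - blx i xs) + (\<theta> i - 1) \<cdot>\<^sub>v (xk k i - blx i xs))"
      unfolding step_x[rule_format, OF i] using \<theta> c by (intro eq_vecI) (auto simp: field_simps)
    then have "vnorm (xh k i - blx i xs) = 1 / \<theta> i * vnorm ((xk (Suc k) i - blx i xs) + (\<theta> i - 1) \<cdot>\<^sub>v (xk k i - blx i xs))"
      using \<theta> by (simp add: vnorm_smult)
    also have "vnorm ((xk (Suc k) i - blx i xs) + (\<theta> i - 1) \<cdot>\<^sub>v (xk k i - blx i xs))
        \<le> vnorm (xk (Suc k) i - blx i xs) + \<bar>\<theta> i - 1\<bar> * vnorm (xk k i - blx i xs)"
      using vnorm_triangle[of "xk (Suc k) i - blx i xs" "(\<theta> i - 1) \<cdot>\<^sub>v (xk k i - blx i xs)"] by (simp add: vnorm_smult)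
    also have "\<dots> \<le> h (Suc k) / sqrt \<kappa> + 1 * (h k / sqrt \<kappa>)"
      using \<theta> vnorm_nonneg by (intro add_mono mult_mono bnd[OF i]) auto
    finally show ?thesis using \<theta> by (simp add: add_divide_distrib divide_right_mono mult_left_mono)
  qed
  have "(\<xi>h k - \<xi>s) \<bullet> V k = (stack m (xh k) - xs) \<bullet> stack m (vk k)"
  proof -
    have c: "stack m (xh k) - xs \<in> carrier_vec N" "stack m (yh k) - Ys \<in> carrier_vec MY" "zk (Suc k) - Zs \<in> carrier_vec RZ"
      using stack_carriers zk_carrier s by (auto simp del: zk.simps)
    have "\<xi>h k - \<xi>s = (stack m (xh k) - xs) @\<^sub>v (stack m (yh k) - Ys) @\<^sub>v (zk (Suc k) - Zs)"
      unfolding eq by (rule append3_minus[OF stack_carriers(2) stack_carriers(5) zk_carrier s])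
    then show ?thesis using sp_split[OF c stack_carriers(3) zero_carrier_vec zero_carrier_vec, of k]
      scalar_prod_right_zero[OF c(2)] scalar_prod_right_zero[OF c(3)] by (simp del: zk.simps)
  qed
  also have "\<dots> = (\<Sum>i<m. (xh k i - blx i xs) \<bullet> vk k i)"
    using stack_carriers(3)[of k] s(1)
    by (subst sp_blocks[of _ nd m]) (auto simp: blk_minus[of _ _ m] blk_stacks intro!: sum.cong)
  also have "\<dots> \<le> (\<Sum>i<m. 1 / \<theta> i * ((h (Suc k) + h k) / sqrt \<kappa>) * eps i k)"
  proof (rule sum_mono)
    fix i assume "i \<in> {..<m}"
    then have i: "i < m" by simp
    have "(xh k i - blx i xs) \<bullet> vk k i \<le> vnorm (xh k i - blx i xs) * vnorm (vk k i)"
      using cauchy_schwarz_vec[of "xh k i - blx i xs" "vk k i"] vk_carrier[OF i, of k] by simp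
    also have "\<dots> \<le> 1 / \<theta> i * ((h (Suc k) + h k) / sqrt \<kappa>) * eps i k"
      using step_v i vnorm_nonneg xhb[OF i] order_trans[OF vnorm_nonneg xhb[OF i]] by (intro mult_mono) auto
    finally show "(xh k i - blx i xs) \<bullet> vk k i \<le> 1 / \<theta> i * ((h (Suc k) + h k) / sqrt \<kappa>) * eps i k" .
  qed
  also have "\<dots> = (\<Sum>i<m. 1 / (\<theta> i * sqrt \<kappa>) * eps i k) * (h (Suc k) + h k)"
    unfolding sum_distrib_right by (intro sum.cong) (auto simp: field_simps)
  finally have "2 * ((\<xi>h k - \<xi>s) \<bullet> V k) \<le> 2 * ((\<Sum>i<m. 1 / (\<theta> i * sqrt \<kappa>) * eps i k) * (h (Suc k) + h k))" by simp
  also have "\<dots> = (\<Sum>i<m. 2 / (\<theta> i * sqrt \<kappa>) * eps i k) * (h (Suc k) + h k)"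
    by (simp add: sum_distrib_left sum_distrib_right mult.assoc)
  finally show ?thesis unfolding h_def .
qed

lemma quasi_Fejer:
  assumes zero: "\<xi>s \<in> Phi0" and \<xi>s: "\<xi>s \<in> carrier_vec T"
  shows "convergent (\<lambda>k. sqrt (qn H (\<xi> k - \<xi>s)))" "(\<lambda>k. vnorm (\<xi> k - \<xi>h k)) \<longlonglongrightarrow> 0"
proof -
  obtain \<kappa> where \<kappa>: "0 < \<kappa>" "\<forall>v\<in>carrier_vec T. \<kappa> * (v \<bullet> v) \<le> qn H v" using qn_H_ge by blast
  obtain \<kappa>' where \<kappa>': "0 < \<kappa>'" "\<forall>v\<in>carrier_vec T. \<kappa>' * (v \<bullet> v) \<le> qn D v" using qn_D_ge by blast
  define h where "h k = sqrt (qn H (\<xi> k - \<xi>s))" for k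
  define e where "e k = (\<Sum>i<m. 2 / (\<theta> i * sqrt \<kappa>) * eps i k)" for k
  define d where "d k = \<xi> k - \<xi>h k" for k
  have dc: "d k \<in> carrier_vec T" for k
    unfolding d_def using \<xi>_carrier[of k] \<xi>h_carrier[of k] by (auto simp del: zk.simps)
  have H0: "0 \<le> qn H v" if "v \<in> carrier_vec T" for v
    using \<kappa> that mult_nonneg_nonneg[of \<kappa> "v \<bullet> v"] sp_self_nonneg[of v] by (meson less_imp_le order_trans)
  have D0: "\<kappa>' * (vnorm (d k))\<^sup>2 \<le> qn D (d k)" for k using \<kappa>' dc by (simp add: vnorm_sq)
  have h2: "(h k)\<^sup>2 = qn H (\<xi> k - \<xi>s)" for k
    unfolding h_def using \<xi>_carrier[of k] \<xi>s by (intro real_sqrt_pow2 H0) auto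
  have h0: "0 \<le> h k" for k using \<xi>_carrier[of k] \<xi>s unfolding h_def by (intro real_sqrt_ge_zero H0) auto
  have \<theta>0: "0 < \<theta> i" if "i < m" for i using \<theta>_rng that by simp
  have e0: "0 \<le> e k" for k unfolding e_def
    using \<theta>0 \<kappa>(1) eps_nn by (intro sum_nonneg mult_nonneg_nonneg) (auto simp: less_imp_le)
  have es: "summable e" unfolding e_def using eps_sum by (intro summable_sum summable_mult) auto
  have main: "(h (Suc k))\<^sup>2 + \<kappa>' * (vnorm (d k))\<^sup>2 \<le> (h k)\<^sup>2 + e k * (h (Suc k) + h k)" for k
  proof -
    have "2 * ((\<xi>h k - \<xi>s) \<bullet> V k) \<le> e k * (h (Suc k) + h k)"
      unfolding e_def h_def by (rule perturbation_bound[OF \<kappa> \<xi>s])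
    then show ?thesis using descent[OF zero \<xi>s, of k] D0[of k] unfolding h2[symmetric] d_def by linarith
  qed
  \<comment> \<open>Dropping the \<open>D\<close> term and dividing the difference of squares by
    \<open>h (Suc k) + h k\<close> linearises the recursion; that sum is 0 only if both distances
    are.\<close>
  have step: "h (Suc k) \<le> h k + e k" for k
  proof (cases "h (Suc k) + h k = 0")
    case True
    then show ?thesis using h0[of k] h0[of "Suc k"] e0[of k] by linarith
  next
    case False
    then have pos: "0 < h (Suc k) + h k" using h0[of k] h0[of "Suc k"] by linarith
    have "0 \<le> \<kappa>' * (vnorm (d k))\<^sup>2" using \<kappa>'(1) by simp
    then have "(h (Suc k) - h k) * (h (Suc k) + h k) \<le> e k * (h (Suc k) + h k)"
      using main[of k] by (simp add: power2_eq_square algebra_simps)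
    then have "h (Suc k) - h k \<le> e k" using pos by (rule mult_right_le_imp_le)
    then show ?thesis by simp
  qed
  have conv: "convergent h" by (rule quasi_Fejer_convergent[OF h0 step e0 es])
  then show "convergent (\<lambda>k. sqrt (qn H (\<xi> k - \<xi>s)))" unfolding h_def .
  obtain l where l: "h \<longlonglongrightarrow> l" using conv convergent_def by blast
  have l': "(\<lambda>k. h (Suc k)) \<longlonglongrightarrow> l" using l by (rule LIMSEQ_Suc)
  have e': "e \<longlonglongrightarrow> 0" by (rule summable_LIMSEQ_zero[OF es])
  \<comment> \<open>Now the \<open>D\<close> term is kept: its bound tends to 0 because consecutive
    distances have the same limit and the errors are summable.\<close>
  have "(\<lambda>k. ((h k)\<^sup>2 - (h (Suc k))\<^sup>2 + e k * (h (Suc k) + h k)) / \<kappa>') \<longlonglongrightarrow> (l\<^sup>2 - l\<^sup>2 + 0 * (l + l)) / \<kappa>'"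
    using \<kappa>'(1) by (intro tendsto_intros l l' e') auto
  then have up: "(\<lambda>k. ((h k)\<^sup>2 - (h (Suc k))\<^sup>2 + e k * (h (Suc k) + h k)) / \<kappa>') \<longlonglongrightarrow> 0" by simp
  have "(\<lambda>k. (vnorm (d k))\<^sup>2) \<longlonglongrightarrow> 0"
  proof (rule tendsto_sandwich[OF _ _ tendsto_const up])
    show "\<forall>\<^sub>F k in sequentially. (vnorm (d k))\<^sup>2 \<le> ((h k)\<^sup>2 - (h (Suc k))\<^sup>2 + e k * (h (Suc k) + h k)) / \<kappa>'"
    proof (intro always_eventually allI)
      fix k
      have "(vnorm (d k))\<^sup>2 * \<kappa>' \<le> (h k)\<^sup>2 - (h (Suc k))\<^sup>2 + e k * (h (Suc k) + h k)"
        using main[of k] by (simp add: mult.commute)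
      then show "(vnorm (d k))\<^sup>2 \<le> ((h k)\<^sup>2 - (h (Suc k))\<^sup>2 + e k * (h (Suc k) + h k)) / \<kappa>'"
        using \<kappa>'(1) by (simp add: pos_le_divide_eq)
    qed
  qed simp
  then have "(\<lambda>k. sqrt ((vnorm (d k))\<^sup>2)) \<longlonglongrightarrow> sqrt 0" by (rule tendsto_real_sqrt)
  then show "(\<lambda>k. vnorm (\<xi> k - \<xi>h k)) \<longlonglongrightarrow> 0" by (simp add: d_def vnorm_nonneg del: zk.simps)
qed

text \<open>The limit conditions come from inequalities with a fixed test point on the right. The
  difficulty is complementarity between \<open>y\<close> and \<open>G x - l\<close>, as convergence
  of \<open>yh . G(xh)\<close> to \<open>y . G x\<close> is not at hand; it is rewritten as
  \<open>-(yh . d)\<close>, which does converge.\<close>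

lemma cluster_agent:
  assumes i: "i < m"
    and x: "vconv (\<lambda>k. xk (\<rho> k) i) x" "vconv (\<lambda>k. xh (\<rho> k) i) x" "x \<in> carrier_vec (nd i)"
    and y: "vconv (\<lambda>k. yk (\<rho> k) i) y" "vconv (\<lambda>k. yh (\<rho> k) i) y" "y \<in> carrier_vec pq"
    and l: "vconv (\<lambda>k. lk (\<rho> k) i) l" "l \<in> carrier_vec pq"
    and v: "vconv (\<lambda>k. vk (\<rho> k) i) (0\<^sub>v (nd i))"
  shows "x \<in> \<Omega> i \<and> y \<in> Kpol p q \<and> (\<forall>x'\<in>\<Omega> i. f i x + y \<bullet> G i x \<le> f i x' + y \<bullet> G i x') \<and>
    (\<forall>y'\<in>Kpol p q. (y' - y) \<bullet> (G i x - l) \<le> 0)"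
proof -
  have x\<Omega>: "x \<in> \<Omega> i" using xh_\<Omega>[OF i] by (intro vclosedD[OF \<Omega>_closed[rule_format, OF i] x(2)]) simp
  have yK: "y \<in> Kpol p q" using yh_Kpol[OF i] by (intro Kpol_limit[OF _ y(2)])
  define e where "e k = vk (\<rho> k) i + (1 / \<alpha> i) \<cdot>\<^sub>v (xk (\<rho> k) i - xh (\<rho> k) i)" for k
  define d where "d k = (1 / \<gamma> i) \<cdot>\<^sub>v (yk (\<rho> k) i - yh (\<rho> k) i) - lk (\<rho> k) i" for k
  have ev: "vconv e (0\<^sub>v (nd i) + (1 / \<alpha> i) \<cdot>\<^sub>v (x - x))"
    unfolding e_def using x by (intro vconv_add vconv_smult vconv_minus v tendsto_const) auto
  have dv: "vconv d ((1 / \<gamma> i) \<cdot>\<^sub>v (y - y) - l)"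
    unfolding d_def using y l by (intro vconv_smult vconv_minus tendsto_const) auto
  have E: "0\<^sub>v (nd i) + (1 / \<alpha> i) \<cdot>\<^sub>v (x - x) = 0\<^sub>v (nd i)" using x(3) by auto
  have Dl: "(1 / \<gamma> i) \<cdot>\<^sub>v (y - y) - l = (- 1) \<cdot>\<^sub>v l" using y(3) l(2) by auto
  note ev = ev[unfolded E] and dv = dv[unfolded Dl]
  have dG: "dim_vec (G i w) = pq" if "w \<in> carrier_vec (nd i)" for w using G_carrier[OF i that] by simp
  have dG': "dim_vec (G i (xh k i)) = pq" for k by (rule dG[OF xh_carrier[OF i]])
  have dd: "dim_vec (d k) = pq" for k unfolding d_def using lk_carrier[OF i, of "\<rho> k"] by simp
  have dyh: "dim_vec (yh k i) = pq" for k using yh_carrier[OF i, of k] by simp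
  have elim: "(\<lambda>k. e k \<bullet> (x' - xh (\<rho> k) i)) \<longlonglongrightarrow> 0" if "x' \<in> carrier_vec (nd i)" for x'
  proof -
    have "(\<lambda>k. e k \<bullet> (x' - xh (\<rho> k) i)) \<longlonglongrightarrow> 0\<^sub>v (nd i) \<bullet> (x' - x)"
      using that x by (intro vconv_scalar_prod ev vconv_minus vconv_const) auto
    moreover have "0\<^sub>v (nd i) \<bullet> (x' - x) = 0" using that x(3) by (intro scalar_prod_left_zero) auto
    ultimately show ?thesis by simp
  qed
  have px: "f i (xh (\<rho> k) i) + yh (\<rho> k) i \<bullet> G i (xh (\<rho> k) i)
      \<le> f i x' + yh (\<rho> k) i \<bullet> G i x' - e k \<bullet> (x' - xh (\<rho> k) i)" if "x' \<in> \<Omega> i" for x' k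
    using prox_x[OF i that, of "\<rho> k"] unfolding e_def by linarith
  \<comment> \<open>The cone test \<open>yh + y'\<close> makes the base point cancel.\<close>
  have py: "y' \<bullet> G i (xh (\<rho> k) i) \<le> - (y' \<bullet> d k)" if y': "y' \<in> Kpol p q" for y' k
  proof -
    have "yh (\<rho> k) i + y' \<in> Kpol p q" using y' yh_Kpol[OF i, of "\<rho> k"] by (auto simp: Kpol_def)
    from prox_y[OF i this, of "\<rho> k"] show ?thesis
      using dim_Kpol[OF y'] dyh dd[of k] dG' unfolding d_def[symmetric] by (simp add: sp_simps)
  qed
  \<comment> \<open>One inequality is \<open>py\<close> at \<open>yh\<close> itself, the other the
    test 0.\<close>
  have comp: "yh (\<rho> k) i \<bullet> G i (xh (\<rho> k) i) = - (yh (\<rho> k) i \<bullet> d k)" for k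
  proof (rule antisym)
    show "yh (\<rho> k) i \<bullet> G i (xh (\<rho> k) i) \<le> - (yh (\<rho> k) i \<bullet> d k)" by (rule py[OF yh_Kpol[OF i]])
    have z: "0\<^sub>v pq \<in> Kpol p q" by (auto simp: Kpol_def)
    have "0\<^sub>v pq \<bullet> d k = 0" "0\<^sub>v pq \<bullet> G i (xh (\<rho> k) i) = 0"
      using scalar_prod_left_zero[OF carrier_vecI[OF dd[of k]]] scalar_prod_left_zero[OF carrier_vecI[OF dG'[of "\<rho> k"]]] by auto
    then show "- (yh (\<rho> k) i \<bullet> d k) \<le> yh (\<rho> k) i \<bullet> G i (xh (\<rho> k) i)"
      using prox_y[OF i z, of "\<rho> k"] dyh dd[of k] dG' unfolding d_def[symmetric] by (simp add: sp_simps)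
  qed
  have fl: "liminf_ge (\<lambda>k. f i (xh (\<rho> k) i)) (f i x)"
    using f_cvx i xh_carrier[OF i] x by (intro vlscD[of "nd i"]) (auto simp: proper_closed_convex_def)
  have yl: "(\<lambda>k. yh (\<rho> k) i \<bullet> w) \<longlonglongrightarrow> y \<bullet> w" if "w \<in> carrier_vec pq" for w
    using that y by (intro vconv_scalar_prod vconv_const) auto
  have min: "f i x + y \<bullet> G i x \<le> f i x' + y \<bullet> G i x' - 0" if x': "x' \<in> \<Omega> i" for x'
  proof (rule liminf_ge_le)
    show "liminf_ge (\<lambda>k. f i (xh (\<rho> k) i) + yh (\<rho> k) i \<bullet> G i (xh (\<rho> k) i)) (f i x + y \<bullet> G i x)"
      using yh_Kpol[OF i] xh_carrier[OF i] x y
      by (intro liminf_ge_add fl K_convex_scalar_prod_liminf[OF G_K_convex[OF i]])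
    show "(\<lambda>k. f i x' + yh (\<rho> k) i \<bullet> G i x' - e k \<bullet> (x' - xh (\<rho> k) i)) \<longlonglongrightarrow> f i x' + y \<bullet> G i x' - 0"
      using G_carrier[OF i] \<Omega>_carrier[OF i x'] by (intro tendsto_intros yl elim) auto
  qed (rule px[OF x'])
  \<comment> \<open>Test the prox inequality at the cluster point \<open>x\<close>: \<open>f\<close>
    is semicontinuous on the left and constant on the right, and cancelling it leaves
    \<open>y . l <= y . G i x\<close>, the direction that semicontinuity of \<open>G\<close> does
    not give.\<close>
  have low: "f i x \<le> f i x + y \<bullet> G i x - 0 + y \<bullet> ((- 1) \<cdot>\<^sub>v l)"
  proof (rule liminf_ge_le[OF fl])
    show "f i (xh (\<rho> k) i) \<le> f i x + yh (\<rho> k) i \<bullet> G i x - e k \<bullet> (x - xh (\<rho> k) i) + yh (\<rho> k) i \<bullet> d k" for k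
      using px[OF x\<Omega>, of k] comp[of k] by linarith
    show "(\<lambda>k. f i x + yh (\<rho> k) i \<bullet> G i x - e k \<bullet> (x - xh (\<rho> k) i) + yh (\<rho> k) i \<bullet> d k)
        \<longlonglongrightarrow> f i x + y \<bullet> G i x - 0 + y \<bullet> ((- 1) \<cdot>\<^sub>v l)"
      using G_carrier[OF i] x(3) y(3) l(2) by (intro tendsto_intros yl elim vconv_scalar_prod[OF y(2) dv]) auto
  qed
  have up: "y' \<bullet> G i x \<le> - (y' \<bullet> ((- 1) \<cdot>\<^sub>v l))" if y': "y' \<in> Kpol p q" for y'
  proof (rule liminf_ge_le)
    show "liminf_ge (\<lambda>k. y' \<bullet> G i (xh (\<rho> k) i)) (y' \<bullet> G i x)"
      using y' xh_carrier[OF i] x by (intro K_convex_scalar_prod_liminf[OF G_K_convex[OF i]] vconv_const)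
    show "(\<lambda>k. - (y' \<bullet> d k)) \<longlonglongrightarrow> - (y' \<bullet> ((- 1) \<cdot>\<^sub>v l))"
      using dim_Kpol[OF y'] l(2) by (intro tendsto_intros vconv_scalar_prod[OF vconv_const dv]) simp
  qed (rule py[OF y'])
  have "(y' - y) \<bullet> (G i x - l) \<le> 0" if y': "y' \<in> Kpol p q" for y'
  proof -
    have "(y' - y) \<bullet> (G i x - l) = (y' \<bullet> G i x - y' \<bullet> l) - (y \<bullet> G i x - y \<bullet> l)"
      using dim_Kpol[OF y'] y(3) l(2) dG[OF x(3)] by (simp add: sp_simps)
    then show ?thesis using up[OF y'] low by (simp add: sp_smult_right)
  qed
  then show ?thesis using x\<Omega> yK min by simp
qed

lemma cluster_point_zero:
  assumes \<rho>: "strict_mono \<rho>" and lim: "vconv (\<lambda>k. \<xi> (\<rho> k)) w" "w \<in> carrier_vec T"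
    and gap: "(\<lambda>k. vnorm (\<xi> k - \<xi>h k)) \<longlonglongrightarrow> 0"
  shows "w \<in> Phi0"
proof -
  obtain x Y Z where c: "x \<in> carrier_vec N" "Y \<in> carrier_vec MY" "Z \<in> carrier_vec RZ" and w: "w = x @\<^sub>v Y @\<^sub>v Z"
    using lim(2) by (rule split_T)
  have dc: "\<xi> k - \<xi>h k \<in> carrier_vec T" for k
    using \<xi>_carrier[of k] \<xi>h_carrier[of k] by (auto simp del: zk.simps)
  have "(\<lambda>k. vnorm (\<xi> (\<rho> k) - \<xi>h (\<rho> k))) \<longlonglongrightarrow> 0"
    using LIMSEQ_subseq_LIMSEQ[OF gap \<rho>] by (simp add: o_def del: zk.simps)
  then have "vconv (\<lambda>k. \<xi> (\<rho> k) - \<xi>h (\<rho> k)) (0\<^sub>v T)" by (rule vconv_zeroI[OF dc])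
  \<comment> \<open>The vanishing gap gives \<open>\<xi>h\<close> the same limit along the
    subsequence.\<close>
  then have "vconv (\<lambda>k. \<xi> (\<rho> k) - (\<xi> (\<rho> k) - \<xi>h (\<rho> k))) (w - 0\<^sub>v T)"
    using lim by (intro vconv_minus) (auto simp del: zk.simps)
  moreover have "\<xi> k - (\<xi> k - \<xi>h k) = \<xi>h k" for k
    using carrier_vecD[OF \<xi>_carrier[of k]] carrier_vecD[OF \<xi>h_carrier[of k]]
    by (intro eq_vecI) (auto simp del: zk.simps index_append_vec)
  moreover have "w - 0\<^sub>v T = w" using lim(2) by auto
  ultimately have limh: "vconv (\<lambda>k. \<xi>h (\<rho> k)) w" by (simp del: zk.simps)
  have d: "dim_vec (stack m (xk k)) = dim_vec x" "dim_vec (stack m (xh k)) = dim_vec x"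
    "dim_vec (stack m (yk k)) = dim_vec Y" "dim_vec (stack m (yh k)) = dim_vec Y" "dim_vec (zk k) = dim_vec Z" for k
    using stack_carriers[of k] zk_carrier[of k] c by auto
  note t1 = vconv_append[OF lim(1)[unfolded w]]
  note t2 = vconv_append[OF limh[unfolded w]]
  have X: "vconv (\<lambda>k. stack m (xk (\<rho> k))) x" and YZ: "vconv (\<lambda>k. stack m (yk (\<rho> k)) @\<^sub>v zk (\<rho> k)) (Y @\<^sub>v Z)"
    using t1 d by simp_all
  have Xh: "vconv (\<lambda>k. stack m (xh (\<rho> k))) x" and YZh: "vconv (\<lambda>k. stack m (yh (\<rho> k)) @\<^sub>v zk (Suc (\<rho> k))) (Y @\<^sub>v Z)"
    using t2 d by (simp_all del: zk.simps)
  have Yl: "vconv (\<lambda>k. stack m (yk (\<rho> k))) Y" and Zl: "vconv (\<lambda>k. zk (\<rho> k)) Z"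
    using vconv_append[OF YZ] d by simp_all
  have Yh: "vconv (\<lambda>k. stack m (yh (\<rho> k))) Y" and Zh: "vconv (\<lambda>k. zk (Suc (\<rho> k))) Z"
    using vconv_append[OF YZh] d by (simp_all del: zk.simps)
  have dY: "dim_vec Y = offs (\<lambda>_. pq) m" using c by (simp add: offs_const)
  have agent: "blx i x \<in> \<Omega> i \<and> bly i Y \<in> Kpol p q \<and>
      (\<forall>x'\<in>\<Omega> i. f i (blx i x) + bly i Y \<bullet> G i (blx i x) \<le> f i x' + bly i Y \<bullet> G i x') \<and>
      (\<forall>y'\<in>Kpol p q. (y' - bly i Y) \<bullet> (G i (blx i x) - bly i (bUT *\<^sub>v Z)) \<le> 0)" if i: "i < m" for i
  proof (rule cluster_agent[OF i, of \<rho>])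
    show "vconv (\<lambda>k. xk (\<rho> k) i) (blx i x)" using vconv_blk[OF X carrier_vecD[OF c(1)] i] by (simp add: blk_stacks[OF i])
    show "vconv (\<lambda>k. xh (\<rho> k) i) (blx i x)" using vconv_blk[OF Xh carrier_vecD[OF c(1)] i] by (simp add: blk_stacks[OF i])
    show "vconv (\<lambda>k. yk (\<rho> k) i) (bly i Y)" using vconv_blk[OF Yl dY i] by (simp add: blk_stacks[OF i])
    show "vconv (\<lambda>k. yh (\<rho> k) i) (bly i Y)" using vconv_blk[OF Yh dY i] by (simp add: blk_stacks[OF i])
    have "vconv (\<lambda>k. bUT *\<^sub>v zk (\<rho> k)) (bUT *\<^sub>v Z)" by (rule vconv_mult_mat_vec[OF bUT_carrier Zl c(3)])
    moreover have "dim_vec (bUT *\<^sub>v Z) = offs (\<lambda>_. pq) m" using bUT_carrier by (simp add: offs_const)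
    ultimately show "vconv (\<lambda>k. lk (\<rho> k) i) (bly i (bUT *\<^sub>v Z))" using vconv_blk[OF _ _ i] bUT_zk[OF i] by fastforce
    have "(\<lambda>k. vnorm (vk k i)) \<longlonglongrightarrow> 0"
    proof (rule tendsto_sandwich[OF _ _ tendsto_const])
      show "(\<lambda>k. eps i k) \<longlonglongrightarrow> 0" using eps_sum i by (intro summable_LIMSEQ_zero) auto
    qed (use step_v i vnorm_nonneg in auto)
    from LIMSEQ_subseq_LIMSEQ[OF this \<rho>] show "vconv (\<lambda>k. vk (\<rho> k) i) (0\<^sub>v (nd i))"
      using vk_carrier[OF i] by (intro vconv_zeroI) (auto simp: o_def)
  qed (use blk_carrier[of "\<lambda>_. pq"] in auto)
  have bYh: "bU *\<^sub>v stack m (yh k) \<in> carrier_vec RZ" for k by (rule mult_mat_vec_carrier[OF bU_carrier stack_carriers(5)])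
  have "bU *\<^sub>v Y = 0\<^sub>v RZ"
  proof (rule eq_vecI)
    fix j assume "j < dim_vec (0\<^sub>v RZ)"
    then have j: "j < RZ" by simp
    have "vconv (\<lambda>k. bU *\<^sub>v stack m (yh (\<rho> k))) (bU *\<^sub>v Y)" by (rule vconv_mult_mat_vec[OF bU_carrier Yh c(2)])
    then have 1: "(\<lambda>k. (bU *\<^sub>v stack m (yh (\<rho> k))) $ j) \<longlonglongrightarrow> (bU *\<^sub>v Y) $ j"
      using bU_carrier j by (intro vconv_index) auto
    \<comment> \<open>By the dual update, \<open>U Yh\<close> is
      \<open>(zk (Suc k) - zk k) / \<beta>\<close>, and both terms have the limit \<open>Z\<close>
      along the subsequence; this gives consensus.\<close>
    have "(\<lambda>k. (zk (Suc (\<rho> k)) $ j - zk (\<rho> k) $ j) / \<beta>) \<longlonglongrightarrow> (Z $ j - Z $ j) / \<beta>"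
      using j c \<beta>_pos by (intro tendsto_intros vconv_index[OF Zh] vconv_index[OF Zl]) auto
    moreover have "(zk (Suc k) $ j - zk k $ j) / \<beta> = (bU *\<^sub>v stack m (yh k)) $ j" for k
      using \<beta>_pos j carrier_vecD[OF bYh[of k]] by (simp del: dim_mult_mat_vec index_mult_mat_vec)
    ultimately have "(\<lambda>k. (bU *\<^sub>v stack m (yh (\<rho> k))) $ j) \<longlonglongrightarrow> 0" by (simp del: zk.simps)
    then show "(bU *\<^sub>v Y) $ j = 0\<^sub>v RZ $ j" using LIMSEQ_unique[OF 1] j by simp
  qed (use bU_carrier in simp)
  then show ?thesis unfolding w PhiZero_iff[OF c] using agent by blast
qed

theorem iterates_bounded:
  assumes zero: "\<xi>s \<in> Phi0" and \<xi>s: "\<xi>s \<in> carrier_vec T"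
  shows "\<exists>B. \<forall>k. vnorm (\<xi> k) \<le> B"
proof -
  obtain \<kappa> where \<kappa>: "0 < \<kappa>" "\<forall>v\<in>carrier_vec T. \<kappa> * (v \<bullet> v) \<le> qn H v" using qn_H_ge by blast
  obtain C where C: "\<And>k. norm (sqrt (qn H (\<xi> k - \<xi>s))) \<le> C"
    using convergent_imp_Bseq[OF quasi_Fejer(1)[OF zero \<xi>s]] unfolding Bseq_def by blast
  have "vnorm (\<xi> k) \<le> C / sqrt \<kappa> + vnorm \<xi>s" for k
  proof -
    have d: "\<xi> k - \<xi>s \<in> carrier_vec T" using \<xi>_carrier[of k] \<xi>s by auto
    have "(\<xi> k - \<xi>s) \<bullet> (\<xi> k - \<xi>s) \<le> qn H (\<xi> k - \<xi>s) / \<kappa>"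
      using \<kappa>(1) bspec[OF \<kappa>(2) d] by (simp add: pos_le_divide_eq mult.commute)
    then have "vnorm (\<xi> k - \<xi>s) \<le> sqrt (qn H (\<xi> k - \<xi>s)) / sqrt \<kappa>"
      unfolding vnorm_def by (metis real_sqrt_divide real_sqrt_le_iff)
    also have "\<dots> \<le> C / sqrt \<kappa>" using C[of k] \<kappa>(1) by (intro divide_right_mono) auto
    finally have 1: "vnorm (\<xi> k - \<xi>s) \<le> C / sqrt \<kappa>" .
    have "\<xi> k = (\<xi> k - \<xi>s) + \<xi>s"
      using carrier_vecD[OF \<xi>_carrier[of k]] carrier_vecD[OF \<xi>s] by (intro eq_vecI) (auto simp del: index_append_vec)
    then have "vnorm (\<xi> k) \<le> vnorm (\<xi> k - \<xi>s) + vnorm \<xi>s"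
      using vnorm_triangle[of "\<xi> k - \<xi>s" \<xi>s] by (metis index_minus_vec(2))
    then show ?thesis using 1 by linarith
  qed
  then show ?thesis by blast
qed

theorem iterates_converge:
  assumes "Phi0 \<inter> carrier_vec T \<noteq> {}"
  shows "\<exists>w\<in>Phi0. w \<in> carrier_vec T \<and> vconv \<xi> w"
proof -
  obtain \<xi>s where s: "\<xi>s \<in> Phi0" "\<xi>s \<in> carrier_vec T" using assms by blast
  obtain B where B: "\<And>k. vnorm (\<xi> k) \<le> B" using iterates_bounded[OF s] by blast
  obtain \<rho> w where \<rho>: "strict_mono \<rho>" "w \<in> carrier_vec T" "vconv (\<xi> \<circ> \<rho>) w"
    using bounded_vec_convergent_subsequence[of \<xi> T B] \<xi>_carrier B by blast
  have lim: "vconv (\<lambda>k. \<xi> (\<rho> k)) w" using \<rho>(3) by (simp add: o_def)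
  have w: "w \<in> Phi0" by (rule cluster_point_zero[OF \<rho>(1) lim \<rho>(2) quasi_Fejer(2)[OF s]])
  obtain \<kappa> where \<kappa>: "0 < \<kappa>" "\<forall>v\<in>carrier_vec T. \<kappa> * (v \<bullet> v) \<le> qn H v" using qn_H_ge by blast
  define h where "h k = sqrt (qn H (\<xi> k - w))" for k
  \<comment> \<open>The distance to \<open>w\<close> converges as a whole sequence, because
    \<open>w\<close> is itself a zero; so its limit can be read off along \<open>\<rho>\<close>,
    where it is 0.\<close>
  obtain l where l: "h \<longlonglongrightarrow> l"
    using quasi_Fejer(1)[OF w \<rho>(2)] unfolding h_def convergent_def by blast
  have wz: "w - w = 0\<^sub>v T" using \<rho>(2) by auto
  have "vconv (\<lambda>k. \<xi> (\<rho> k) - w) (0\<^sub>v T)" unfolding wz[symmetric] by (intro vconv_minus lim vconv_const) simp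
  then have "(\<lambda>k. (\<xi> (\<rho> k) - w) \<bullet> (H *\<^sub>v (\<xi> (\<rho> k) - w))) \<longlonglongrightarrow> 0\<^sub>v T \<bullet> (H *\<^sub>v 0\<^sub>v T)"
    using H_carrier by (intro vconv_scalar_prod vconv_mult_mat_vec[OF H_carrier]) auto
  moreover have "0\<^sub>v T \<bullet> (H *\<^sub>v 0\<^sub>v T) = 0" using H_carrier by (intro scalar_prod_left_zero) auto
  ultimately have "(\<lambda>k. sqrt (qn H (\<xi> (\<rho> k) - w))) \<longlonglongrightarrow> sqrt 0" unfolding qn_def by (intro tendsto_real_sqrt) simp
  moreover have "(\<lambda>k. h (\<rho> k)) \<longlonglongrightarrow> l" using LIMSEQ_subseq_LIMSEQ[OF l \<rho>(1)] by (simp add: o_def)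
  ultimately have "l = 0" unfolding h_def using LIMSEQ_unique by fastforce
  then have h0: "(\<lambda>k. h k / sqrt \<kappa>) \<longlonglongrightarrow> 0" using tendsto_divide[OF l tendsto_const, of "sqrt \<kappa>"] \<kappa>(1) by simp
  have "(\<lambda>k. vnorm (\<xi> k - w)) \<longlonglongrightarrow> 0"
  proof (rule tendsto_sandwich[OF _ _ tendsto_const h0])
    show "\<forall>\<^sub>F k in sequentially. vnorm (\<xi> k - w) \<le> h k / sqrt \<kappa>"
    proof (intro always_eventually allI)
      fix k
      have d: "\<xi> k - w \<in> carrier_vec T" using \<xi>_carrier[of k] \<rho>(2) by auto
      have "(\<xi> k - w) \<bullet> (\<xi> k - w) \<le> qn H (\<xi> k - w) / \<kappa>"
        using \<kappa>(1) bspec[OF \<kappa>(2) d] by (simp add: pos_le_divide_eq mult.commute)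
      then show "vnorm (\<xi> k - w) \<le> h k / sqrt \<kappa>"
        unfolding vnorm_def h_def by (metis real_sqrt_divide real_sqrt_le_iff)
    qed
  qed (simp add: vnorm_nonneg)
  then have "vconv \<xi> w" unfolding vconv_def using carrier_vecD[OF \<xi>_carrier] carrier_vecD[OF \<rho>(2)] by simp
  then show ?thesis using w \<rho>(2) by blast
qed

end

section \<open>Transfer to the stated matrices and sequences\<close>

theorem theorem1:
  fixes m p q r :: nat
    and nd :: "nat \<Rightarrow> nat"
    and f :: "nat \<Rightarrow> real vec \<Rightarrow> real"
    and A :: "nat \<Rightarrow> real mat" and b :: "nat \<Rightarrow> real vec"
    and g :: "nat \<Rightarrow> real vec \<Rightarrow> real vec"
    and \<Omega> :: "nat \<Rightarrow> real vec set"
    and E :: "(nat \<times> nat) set"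
    and L U :: "real mat"
    and \<theta> \<alpha> \<gamma> :: "nat \<Rightarrow> real" and \<beta> :: real
    and eps :: "nat \<Rightarrow> nat \<Rightarrow> real"
    and xk yk lk xh yh vk :: "nat \<Rightarrow> nat \<Rightarrow> real vec"
    and N MY RZ :: nat
    and bU Theta Ups Gam Q M H D :: "real mat"
    and X Y Lam Xh Yh Zk Zh \<xi> \<xi>h V :: "nat \<Rightarrow> real vec"
    and phik :: "nat \<Rightarrow> nat \<Rightarrow> real vec \<Rightarrow> real vec \<Rightarrow> ereal"
  assumes m2: "m \<ge> 2"
    and nd_pos: "\<forall>i<m. nd i \<ge> 1"
    \<comment> \<open>problem data\<close>
    and A_dim: "\<forall>i<m. A i \<in> carrier_mat p (nd i)"
    and b_dim: "\<forall>i<m. b i \<in> carrier_vec p"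
    and g_dim: "\<forall>i<m. \<forall>x\<in>carrier_vec (nd i). g i x \<in> carrier_vec q"
    \<comment> \<open>(A1)\<close>
    and E_sub: "E \<subseteq> {0..<m} \<times> {0..<m}"
    and E_sym: "sym E"
    and E_conn: "\<forall>i<m. \<forall>j<m. (i, j) \<in> E\<^sup>*"
    and L_dim: "L \<in> carrier_mat m m"
    and L_sym: "L\<^sup>T = L"
    and L_comp: "\<forall>i<m. \<forall>j<m. i \<noteq> j \<and> (i, j) \<notin> E \<longrightarrow> L $$ (i, j) = 0"
    and L_null: "{v \<in> carrier_vec m. L *\<^sub>v v = 0\<^sub>v m} = {c \<cdot>\<^sub>v vec m (\<lambda>_. 1) | c. True}"
    and U_dim: "U \<in> carrier_mat r m"
    and L_UU: "L = U\<^sup>T * U"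
    and U_rank: "full_row_rank U"
    and U_one: "U *\<^sub>v vec m (\<lambda>_. 1) = 0\<^sub>v r"
    \<comment> \<open>(A2)\<close>
    and f_cvx: "\<forall>i<m. proper_closed_convex (nd i) (f i)"
    and g_cvx: "\<forall>i<m. \<forall>c<q. proper_closed_convex (nd i) (\<lambda>x. g i x $ c)"
    and \<Omega>_ne: "\<forall>i<m. \<Omega> i \<noteq> {}"
    and \<Omega>_closed: "\<forall>i<m. vclosed (nd i) (\<Omega> i)"
    and \<Omega>_cvx: "\<forall>i<m. vconvex_set (nd i) (\<Omega> i)"
    and P_solvable: "\<exists>x. optimalP m nd f A b g \<Omega> p q x"
    \<comment> \<open>(A3) Slater\<close>
    and slater: "\<exists>xb. (\<forall>i<m. xb i \<in> vinterior (nd i) (\<Omega> i)) \<and>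
                   vsum p m (\<lambda>i. A i *\<^sub>v xb i - b i) = 0\<^sub>v p \<and>
                   (\<forall>c<q. (\<Sum>i<m. g i (xb i) $ c) < 0)"
    \<comment> \<open>parameters\<close>
    and \<theta>_rng: "\<forall>i<m. 0 < \<theta> i \<and> \<theta> i < 2"
    and \<alpha>_pos: "\<forall>i<m. 0 < \<alpha> i"
    and \<gamma>_pos: "\<forall>i<m. 0 < \<gamma> i"
    and \<beta>_pos: "0 < \<beta>"
    and \<gamma>\<beta>: "\<forall>i<m. 0 < \<gamma> i * \<beta> \<and> \<gamma> i * \<beta> < 1 / lam_max L"
    and eps_nn: "\<forall>i<m. \<forall>k. 0 \<le> eps i k"
    and eps_sum: "\<forall>i<m. summable (\<lambda>k. eps i k)"
    \<comment> \<open>inexact DPMM\<close>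
    and phik_def: "\<And>k i x y. phik k i x y =
         ereal (f i x + 1 / (2 * \<gamma> i) *
                  (projK p q (y + \<gamma> i \<cdot>\<^sub>v Gfun A b g i x) \<bullet> projK p q (y + \<gamma> i \<cdot>\<^sub>v Gfun A b g i x) - y \<bullet> y)
                + 1 / (2 * \<alpha> i) * ((x - xk k i) \<bullet> (x - xk k i)))
         + ind (\<Omega> i) x"
    and init_x: "\<forall>i<m. xk 0 i \<in> \<Omega> i"
    and init_y: "\<forall>i<m. yk 0 i \<in> Kpol p q"
    and init_l: "\<forall>i<m. lk 0 i = 0\<^sub>v (p + q)"
    and step_v: "\<forall>k. \<forall>i<m. vk k i \<in> esubdiff (nd i) (\<lambda>x. phik k i x (yk k i - \<gamma> i \<cdot>\<^sub>v lk k i)) (xh k i)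
                          \<and> vnorm (vk k i) \<le> eps i k"
    and step_yh: "\<forall>k. \<forall>i<m. yh k i = projK p q (yk k i - \<gamma> i \<cdot>\<^sub>v lk k i + \<gamma> i \<cdot>\<^sub>v Gfun A b g i (xh k i))"
    and step_x: "\<forall>k. \<forall>i<m. xk (Suc k) i = (1 - \<theta> i) \<cdot>\<^sub>v xk k i + \<theta> i \<cdot>\<^sub>v xh k i"
    and step_l: "\<forall>k. \<forall>i<m. lk (Suc k) i = lk k i + \<beta> \<cdot>\<^sub>v vsum (p + q) m (\<lambda>j. L $$ (i, j) \<cdot>\<^sub>v yh k j)"
    and step_y: "\<forall>k. \<forall>i<m. yk (Suc k) i = yh k i + \<gamma> i \<cdot>\<^sub>v (lk k i - lk (Suc k) i)"
    \<comment> \<open>stacked quantities\<close>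
    and N_def: "N = (\<Sum>i<m. nd i)"
    and MY_def: "MY = m * (p + q)"
    and RZ_def: "RZ = r * (p + q)"
    and bU_def: "bU = kron U (1\<^sub>m (p + q))"
    and X_def: "\<And>k. X k = stack m (xk k)"
    and Y_def: "\<And>k. Y k = stack m (yk k)"
    and Lam_def: "\<And>k. Lam k = stack m (lk k)"
    and Xh_def: "\<And>k. Xh k = stack m (xh k)"
    and Yh_def: "\<And>k. Yh k = stack m (yh k)"
    and Zk_def: "\<And>k. Zk k = (THE Z. Z \<in> carrier_vec RZ \<and> Lam k = bU\<^sup>T *\<^sub>v Z)"
    and Zh_def: "\<And>k. Zh k = (THE Z. Z \<in> carrier_vec RZ \<and> Lam (Suc k) = bU\<^sup>T *\<^sub>v Z)"
    and xi_def: "\<And>k. \<xi> k = X k @\<^sub>v Y k @\<^sub>v Zk k"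
    and xih_def: "\<And>k. \<xi>h k = Xh k @\<^sub>v Yh k @\<^sub>v Zh k"
    and V_def: "\<And>k. V k = stack m (vk k) @\<^sub>v 0\<^sub>v MY @\<^sub>v 0\<^sub>v RZ"
    \<comment> \<open>matrices\<close>
    and Theta_def: "Theta = bdiag m nd \<theta>"
    and Ups_def: "Ups = bdiag m nd \<alpha>"
    and Gam_def: "Gam = bdiag m (\<lambda>_. p + q) \<gamma>"
    and Q_def: "Q = four_block_mat (minv Ups) (0\<^sub>m N (MY + RZ)) (0\<^sub>m (MY + RZ) N)
                     (four_block_mat (minv Gam) (- bU\<^sup>T) (0\<^sub>m RZ MY) ((1 / \<beta>) \<cdot>\<^sub>m 1\<^sub>m RZ))"
    and M_def: "M = four_block_mat Theta (0\<^sub>m N (MY + RZ)) (0\<^sub>m (MY + RZ) N)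
                     (four_block_mat (1\<^sub>m MY) (- (Gam * bU\<^sup>T)) (0\<^sub>m RZ MY) (1\<^sub>m RZ))"
    and H_def: "H = Q * minv M"
    and D_def: "D = Q\<^sup>T + Q - M\<^sup>T * H * M"
  shows
    "(\<forall>\<xi>s\<in>PhiZero m nd f A b g \<Omega> p q U. \<forall>k.
        qn H (\<xi> (Suc k) - \<xi>s) \<le> qn H (\<xi> k - \<xi>s) - qn D (\<xi> k - \<xi>h k) + 2 * ((\<xi>h k - \<xi>s) \<bullet> V k))
     \<and> (\<exists>B. \<forall>k. vnorm (\<xi> k) \<le> B)
     \<and> (\<exists>\<xi>inf\<in>PhiZero m nd f A b g \<Omega> p q U.
          vconv \<xi> \<xi>inf
          \<and> optimalP m nd f A b g \<Omega> p q (vec_first \<xi>inf N)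
          \<and> (\<exists>yinf. vec_first (vec_last \<xi>inf (MY + RZ)) MY = stack m (\<lambda>_. yinf)
                    \<and> optimalD m nd f A b g \<Omega> p q yinf))"
proof -
  interpret I: dpmm_iteration m p q r nd f A b g \<Omega> L U \<theta> \<alpha> \<gamma> \<beta> eps xk yk lk xh yh vk
    using step_v unfolding phik_def
    by unfold_locales (use assms in auto)
  have N: "N = offs nd m" by (simp add: N_def offs_def)
  have bUT: "bU\<^sup>T = kron U\<^sup>T (1\<^sub>m (p + q))" unfolding bU_def by (rule I.bU_transpose)
  \<comment> \<open>Full row rank makes each definite description equal to the recursive
    \<open>zk\<close>; the hatted vector is built from the next \<open>\<Lambda>\<close> and so is
    \<open>zk (Suc k)\<close>.\<close>
  have Zk: "Zk k = I.zk k" for k unfolding Zk_def Lam_def bUT RZ_def by (rule I.the_zk)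
  have Zh: "Zh k = I.zk (Suc k)" for k unfolding Zh_def Lam_def bUT RZ_def by (rule I.the_zk)
  have QQ: "Q = I.Q" unfolding Q_def I.Q_def N MY_def RZ_def Ups_def Gam_def bU_def ..
  have MM: "M = I.M" unfolding M_def I.M_def N MY_def RZ_def Theta_def Gam_def bU_def ..
  have HH: "H = I.H" unfolding H_def I.H_def QQ MM ..
  have DD: "D = I.D" unfolding D_def I.D_def QQ MM HH ..
  have xi: "\<xi> = (\<lambda>k. stack m (xk k) @\<^sub>v stack m (yk k) @\<^sub>v I.zk k)"
    by (rule ext) (simp add: xi_def X_def Y_def Zk)
  have xih: "\<xi>h k = stack m (xh k) @\<^sub>v stack m (yh k) @\<^sub>v I.zk (Suc k)" for k
    unfolding xih_def Xh_def Yh_def Zh ..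
  have V: "V k = stack m (vk k) @\<^sub>v 0\<^sub>v (m * (p + q)) @\<^sub>v 0\<^sub>v (r * (p + q))" for k
    unfolding V_def MY_def RZ_def ..
  have carrier: "PhiZero m nd f A b g \<Omega> p q U \<subseteq> carrier_vec (offs nd m + (m * (p + q) + r * (p + q)))"
    using U_dim by (auto simp: PhiZero_def Let_def offs_def add.assoc)
  \<comment> \<open>Boundedness and convergence are measured from some zero; solvability and
    Slater's condition provide one.\<close>
  obtain x0 Y0 Z0 where z0: "x0 @\<^sub>v Y0 @\<^sub>v Z0 \<in> PhiZero m nd f A b g \<Omega> p q U"
    using I.PhiZero_nonempty[OF P_solvable slater] by blast
  have a: "\<forall>\<xi>s\<in>PhiZero m nd f A b g \<Omega> p q U. \<forall>k.
      qn H (\<xi> (Suc k) - \<xi>s) \<le> qn H (\<xi> k - \<xi>s) - qn D (\<xi> k - \<xi>h k) + 2 * ((\<xi>h k - \<xi>s) \<bullet> V k)"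
    unfolding xi xih V HH DD using I.descent carrier by blast
  have b: "\<exists>B. \<forall>k. vnorm (\<xi> k) \<le> B"
    unfolding xi using I.iterates_bounded[OF z0] z0 carrier by blast
  obtain w where w: "w \<in> PhiZero m nd f A b g \<Omega> p q U"
    "w \<in> carrier_vec (offs nd m + (m * (p + q) + r * (p + q)))" "vconv \<xi> w"
    unfolding xi using I.iterates_converge z0 carrier by blast
  obtain x Y' Z where c: "x \<in> carrier_vec (offs nd m)" "Y' \<in> carrier_vec (m * (p + q))" "Z \<in> carrier_vec (r * (p + q))"
    and weq: "w = x @\<^sub>v Y' @\<^sub>v Z" using w(2) by (rule I.split_T)
  have "optimalP m nd f A b g \<Omega> p q (vec_first w N)"
    "\<exists>yinf. vec_first (vec_last w (MY + RZ)) MY = stack m (\<lambda>_. yinf) \<and> optimalD m nd f A b g \<Omega> p q yinf"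
    unfolding weq N MY_def RZ_def vec_split3[OF c] using I.PhiZero_optimal[OF c] w(1) weq by auto
  then show ?thesis using a b w by blast
qed

end
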